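(* Let $r \ge 2$ be a fixed integer and let $m, d, k \ge 1$ be integers such that $k \in o(\sqrt m)$. Let $\epsilon_r = (1 - 2^{-1/r})^r$. Let $\Psi$ be an $m$-variable $(d,k)$-CSP with variable frequency at most $r$. Then the algorithm $\mathsf{CSP\text{-}SAT}(\Psi)$ (described in the context) correctly decides the satisfiability of $\Psi$. Moreover, if $d \ge 3$ then it runs deterministically in time $d^{(1-\epsilon_r)m + o(m)}$; if $d = 2$ then it runs in expected time $2^{(1-\epsilon_r)m + o(m)}$ if the separator $R$ used by the algorithm is found randomly, and in deterministic time $2^{(1-2\epsilon_r^2)m + o(m)}$ if $R$ is found deterministically.
   Context: A $(d,k)$-CSP $\Psi = (X,\mathcal C)$ consists of a set $X$ of variables taking values in an alphabet $\Sigma$ of size $d$ and a set $\mathcal C$ of constraints, each on at most $k$ of the variables; it is given by the truth tables of its constraints. An assignment satisfies $\Psi$ if it satisfies every constraint. The variable frequency of $\Psi$ is the largest number of constraints that any variable appears in. For a partial assignment $\rho$, $\Psi|_\rho$ is the CSP on the remaining variables obtained by fixing in every constraint the values given by $\rho$. The hypergraph $H_\Psi = (V,E)$ has vertex set $V = \mathcal C$ and, for each variable $x \in X$, a hyperedge $e_x$ consisting of all constraints containing $x$. It thus has $m$ hyperedges of size at most $r$ and maximum vertex degree at most $k$. A balanced separator of a hypergraph $(V,E)$ is a set $R \subseteq E$ such that every connected component of $(V, E\setminus R)$ is incident to at most $|E|/2$ edges of $E \setminus R$. Algorithm $\mathsf{CSP\text{-}SAT}(\Psi)$: Construct $H_\Psi$.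 Find a balanced separator $R$ of $H_\Psi$ of size at most $(\frac12 - \epsilon_r)m + o(m)$, in one of two ways. Randomly: after padding hyperedges with new vertices so that all have size $r$ (keeping maximum degree at most $k$) and discarding isolated vertices, repeatedly choose a random vertex set $S$, including each vertex independently with probability $2^{-1/r}$, until the number of hyperedges inside $S$ is $m/2 \pm o(m)$ and the number of hyperedges meeting both $S$ and its complement $\overline S$ is at most $(\frac12-\epsilon_r)m + o(m)$; take $R$ to be the latter hyperedges together with $o(m)$ further hyperedges chosen so that at most $m/2$ remain inside each of $S$ and $\overline S$ (expected polynomial time). Deterministically: exhaustively check all sets of at most $(\frac12-\epsilon_r)m+o(m)$ hyperedges. Then, for every assignment $\rho \in \Sigma^R$ to the variables corresponding to the hyperedges of $R$: write $\Psi|_\rho = \bigwedge_{i=1}^t \Psi_i$, where the $\Psi_i$ correspond to the connected components of $H_{\Psi|_\rho}$ (which is $H_\Psi$ with the hyperedges of $R$ removed); for each $i$ exhaustively check whether $\Psi_i$ is satisfiable; if all $\Psi_i$ are satisfiable, return "satisfiable". If no $\rho$ leads to this, return "unsatisfiable". Asymptotic notation is as $m \to \infty$ with $r$ fixed. *)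

theory Defs
  imports "HOL-Probability.SPMF" "HOL-Library.Landau_Symbols"
begin

text \<open>
  Variables and alphabet symbols are natural numbers, the alphabet of size d being {0..<d}.
  The truth table of a constraint lists its value on the tuples over {0..<d} (one entry for each
  variable of the scope) in lexicographic order, so that the value on a tuple is found at the
  position given by reading the tuple as a numeral in base d.
\<close>

datatype constr = Constr (scope: "nat list") (table: "bool list")

datatype csp = CSP (vars: "nat list") (alph: nat) (constrs: "constr list")

definition tuple_index :: "nat \<Rightarrow> nat list \<Rightarrow> nat" where
  "tuple_index d vs = foldl (\<lambda>i a. i * d + a) 0 vs"

definition satisfies :: "nat \<Rightarrow> (nat \<Rightarrow> nat) \<Rightarrow> constr \<Rightarrow> bool" where
  "satisfies d \<sigma> c \<longleftrightarrow> table c ! tuple_index d (map \<sigma> (scope c))"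

definition satisfiable :: "csp \<Rightarrow> bool" where
  "satisfiable \<Psi> \<longleftrightarrow> (\<exists>\<sigma>. (\<forall>x\<in>set (vars \<Psi>). \<sigma> x < alph \<Psi>) \<and>
     (\<forall>c\<in>set (constrs \<Psi>). satisfies (alph \<Psi>) \<sigma> c))"

text \<open>The two lists of a CSP stand for sets, hence the distinctness conditions.\<close>

definition is_csp :: "nat \<Rightarrow> nat \<Rightarrow> csp \<Rightarrow> bool" where
  "is_csp d k \<Psi> \<longleftrightarrow> alph \<Psi> = d \<and> distinct (vars \<Psi>) \<and> distinct (constrs \<Psi>) \<and>
     (\<forall>c\<in>set (constrs \<Psi>). distinct (scope c) \<and> set (scope c) \<subseteq> set (vars \<Psi>) \<and>
        length (scope c) \<le> k \<and> length (table c) = d ^ length (scope c))"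

definition num_vars :: "csp \<Rightarrow> nat" where
  "num_vars \<Psi> = card (set (vars \<Psi>))"

definition var_frequency :: "csp \<Rightarrow> nat" where
  "var_frequency \<Psi> = Max ((\<lambda>x. card {c \<in> set (constrs \<Psi>). x \<in> set (scope c)}) ` set (vars \<Psi>))"

text \<open>
  A hyperedge is a pair of a label and a vertex list.  In the hypergraph of a CSP, the
  vertices are the positions in the list of constraints, and the label of the hyperedge of a
  variable is that variable; thus different variables always give different hyperedges.  Sets of
  hyperedges are given by their labels.
\<close>

type_synonym edge = "nat \<times> nat list"

datatype hypergraph = Hypergraph (verts: "nat list") (edges: "edge list")

definition linked :: "edge list \<Rightarrow> nat \<Rightarrow> nat \<Rightarrow> bool" where
  "linked E = (\<lambda>u v. \<exists>(x, e)\<in>set E. u \<in> set e \<and> v \<in> set e)\<^sup>*\<^sup>*"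

definition conn_components :: "nat list \<Rightarrow> edge list \<Rightarrow> nat set set" where
  "conn_components V E = (\<lambda>u. {v \<in> set V. linked E u v}) ` set V"

definition balanced_separator :: "hypergraph \<Rightarrow> nat set \<Rightarrow> bool" where
  "balanced_separator H R \<longleftrightarrow>
     (\<forall>C\<in>conn_components (verts H) (filter (\<lambda>(x, e). x \<notin> R) (edges H)).
        real (card {(x, e) \<in> set (edges H). x \<notin> R \<and> set e \<inter> C \<noteq> {}})
          \<le> real (card (set (edges H))) / 2)"

definition eps :: "nat \<Rightarrow> real" where
  "eps r = (1 - 2 powr (- 1 / real r)) ^ r"


section \<open>Computations that count their steps\<close>

text \<open>
  Programs are written in a monad that counts steps.  A step is charged
  for every function call, i.e. for each clause of each recursive function below; between two calls
  only a bounded number of elementary operations happen: building or destructing a list cell, pair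
  or record, and arithmetic and comparisons on symbols, indices, counters and thresholds.
\<close>

datatype 'a timed = Timed (result: 'a) (steps: nat)

definition ret :: "'a \<Rightarrow> 'a timed" where
  "ret x = Timed x 0"

definition bind_timed :: "'a timed \<Rightarrow> ('a \<Rightarrow> 'b timed) \<Rightarrow> 'b timed" where
  "bind_timed p f = Timed (result (f (result p))) (steps p + steps (f (result p)))"

adhoc_overloading Monad_Syntax.bind \<rightleftharpoons> bind_timed

definition tick :: "'a timed \<Rightarrow> 'a timed" where
  "tick p = Timed (result p) (Suc (steps p))"

primrec length_t :: "'a list \<Rightarrow> nat timed" where
  "length_t [] = tick (ret 0)"
| "length_t (x # xs) = tick (do { n \<leftarrow> length_t xs; ret (Suc n) })"

primrec append_t :: "'a list \<Rightarrow> 'a list \<Rightarrow> 'a list timed" where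
  "append_t [] ys = tick (ret ys)"
| "append_t (x # xs) ys = tick (do { zs \<leftarrow> append_t xs ys; ret (x # zs) })"

primrec concat_t :: "'a list list \<Rightarrow> 'a list timed" where
  "concat_t [] = tick (ret [])"
| "concat_t (xs # xss) = tick (do { ys \<leftarrow> concat_t xss; append_t xs ys })"

primrec map_t :: "('a \<Rightarrow> 'b timed) \<Rightarrow> 'a list \<Rightarrow> 'b list timed" where
  "map_t f [] = tick (ret [])"
| "map_t f (x # xs) = tick (do { y \<leftarrow> f x; ys \<leftarrow> map_t f xs; ret (y # ys) })"

primrec filter_t :: "('a \<Rightarrow> bool timed) \<Rightarrow> 'a list \<Rightarrow> 'a list timed" where
  "filter_t p [] = tick (ret [])"
| "filter_t p (x # xs) = tick (do { b \<leftarrow> p x; ys \<leftarrow> filter_t p xs; ret (if b then x # ys else ys) })"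

primrec any_t :: "('a \<Rightarrow> bool timed) \<Rightarrow> 'a list \<Rightarrow> bool timed" where
  "any_t p [] = tick (ret False)"
| "any_t p (x # xs) = tick (do { b \<leftarrow> p x; if b then ret True else any_t p xs })"

primrec all_t :: "('a \<Rightarrow> bool timed) \<Rightarrow> 'a list \<Rightarrow> bool timed" where
  "all_t p [] = tick (ret True)"
| "all_t p (x # xs) = tick (do { b \<leftarrow> p x; if b then all_t p xs else ret False })"

definition not_t :: "bool timed \<Rightarrow> bool timed" where
  "not_t p = tick (do { b \<leftarrow> p; ret (\<not> b) })"

definition member_t :: "nat \<Rightarrow> nat list \<Rightarrow> bool timed" where
  "member_t x xs = any_t (\<lambda>y. tick (ret (y = x))) xs"

primrec nth_t :: "'a list \<Rightarrow> nat \<Rightarrow> 'a timed" where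
  "nth_t [] i = tick (ret undefined)"
| "nth_t (x # xs) i = tick (if i = 0 then ret x else nth_t xs (i - 1))"

primrec take_t :: "nat \<Rightarrow> 'a list \<Rightarrow> 'a list timed" where
  "take_t n [] = tick (ret [])"
| "take_t n (x # xs) = tick (if n = 0 then ret [] else do { ys \<leftarrow> take_t (n - 1) xs; ret (x # ys) })"

primrec zip_t :: "'a list \<Rightarrow> 'b list \<Rightarrow> ('a \<times> 'b) list timed" where
  "zip_t [] ys = tick (ret [])"
| "zip_t (x # xs) ys = tick (case ys of [] \<Rightarrow> ret [] | y # ys' \<Rightarrow> do { zs \<leftarrow> zip_t xs ys'; ret ((x, y) # zs) })"

text \<open>The list [i, ..., i + n - 1].\<close>

primrec range_t :: "nat \<Rightarrow> nat \<Rightarrow> nat list timed" where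
  "range_t i 0 = tick (ret [])"
| "range_t i (Suc n) = tick (do { xs \<leftarrow> range_t (Suc i) n; ret (i # xs) })"


section \<open>Hypergraphs and separators\<close>

definition hypergraph_of :: "csp \<Rightarrow> hypergraph timed" where
  "hypergraph_of \<Psi> = tick (do {
     n \<leftarrow> length_t (constrs \<Psi>);
     V \<leftarrow> range_t 0 n;
     cs \<leftarrow> zip_t V (constrs \<Psi>);
     E \<leftarrow> map_t (\<lambda>x. do {
            ics \<leftarrow> filter_t (\<lambda>(i, c). member_t x (scope c)) cs;
            e \<leftarrow> map_t (\<lambda>(i, c). ret i) ics;
            ret (x, e) }) (vars \<Psi>);
     ret (Hypergraph V E) })"

definition meets_t :: "nat list \<Rightarrow> nat list \<Rightarrow> bool timed" where
  "meets_t e B = any_t (\<lambda>v. member_t v B) e"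

text \<open>
  The connected components are computed by starting from single vertices and uniting, for each
  hyperedge in turn, all blocks that it meets.
\<close>

definition unite_t :: "nat list \<Rightarrow> nat list list \<Rightarrow> nat list list timed" where
  "unite_t e P = tick (do {
     M \<leftarrow> filter_t (meets_t e) P;
     N \<leftarrow> filter_t (\<lambda>B. not_t (meets_t e B)) P;
     if M = [] then ret N else do { B \<leftarrow> concat_t M; ret (B # N) } })"

primrec components_t :: "nat list \<Rightarrow> edge list \<Rightarrow> nat list list timed" where
  "components_t V [] = tick (map_t (\<lambda>v. ret [v]) V)"
| "components_t V (xe # E) = tick (do { P \<leftarrow> components_t V E; unite_t (snd xe) P })"

definition incident_t :: "edge list \<Rightarrow> nat list \<Rightarrow> edge list timed" where
  "incident_t E B = filter_t (\<lambda>(x, e). meets_t e B) E"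

definition balanced_t :: "hypergraph \<Rightarrow> nat list \<Rightarrow> bool timed" where
  "balanced_t H R = tick (do {
     E \<leftarrow> filter_t (\<lambda>(x, e). not_t (member_t x R)) (edges H);
     P \<leftarrow> components_t (verts H) E;
     m \<leftarrow> length_t (edges H);
     all_t (\<lambda>B. do { I \<leftarrow> incident_t E B; l \<leftarrow> length_t I; ret (2 * l \<le> m) }) P })"

text \<open>
  Exhaustive search through all sets that arise from R by adding at most b elements of the
  list; the result is None if none of them passes the test.
\<close>

primrec search_t ::
  "(nat list \<Rightarrow> bool timed) \<Rightarrow> nat list \<Rightarrow> nat \<Rightarrow> nat list \<Rightarrow> nat list option timed" where
  "search_t p [] b R = tick (do { ok \<leftarrow> p R; ret (if ok then Some R else None) })"
| "search_t p (x # xs) b R = tick (do {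
     res \<leftarrow> search_t p xs b R;
     if res \<noteq> None \<or> b = 0 then ret res else search_t p xs (b - 1) (x # R) })"

text \<open>
  The number s is the value, for the number m of hyperedges, of the o(m) terms in the sizes
  of the sets handled by the algorithm.
\<close>

definition separator_det :: "nat \<Rightarrow> nat \<Rightarrow> hypergraph \<Rightarrow> nat list option timed" where
  "separator_det r s H = tick (do {
     xs \<leftarrow> map_t (\<lambda>(x, e). ret x) (edges H);
     m \<leftarrow> length_t xs;
     search_t (balanced_t H) xs (nat \<lfloor>(1 / 2 - eps r) * real m\<rfloor> + s) [] })"


section \<open>Restriction, decomposition and exhaustive check\<close>

text \<open>Partial assignments are association lists.\<close>

type_synonym passign = "(nat \<times> nat) list"

definition assigned_t :: "passign \<Rightarrow> nat \<Rightarrow> bool timed" where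
  "assigned_t \<rho> x = any_t (\<lambda>(y, a). tick (ret (y = x))) \<rho>"

primrec lookup_t :: "passign \<Rightarrow> nat \<Rightarrow> nat timed" where
  "lookup_t [] x = tick (ret undefined)"
| "lookup_t (ya # \<rho>) x = tick (if fst ya = x then ret (snd ya) else lookup_t \<rho> x)"

primrec tuple_index_t :: "nat \<Rightarrow> nat \<Rightarrow> nat list \<Rightarrow> nat timed" where
  "tuple_index_t d i [] = tick (ret i)"
| "tuple_index_t d i (a # as) = tick (tuple_index_t d (i * d + a) as)"

definition satisfies_t :: "nat \<Rightarrow> passign \<Rightarrow> constr \<Rightarrow> bool timed" where
  "satisfies_t d \<sigma> c = tick (do {
     vs \<leftarrow> map_t (lookup_t \<sigma>) (scope c);
     i \<leftarrow> tuple_index_t d 0 vs;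
     nth_t (table c) i })"

text \<open>All tuples of the given length over {0..<d}, in lexicographic order.\<close>

primrec tuples_t :: "nat \<Rightarrow> nat \<Rightarrow> nat list list timed" where
  "tuples_t d 0 = tick (ret [[]])"
| "tuples_t d (Suc n) = tick (do {
     T \<leftarrow> tuples_t d n;
     as \<leftarrow> range_t 0 d;
     Ts \<leftarrow> map_t (\<lambda>a. map_t (\<lambda>t. ret (a # t)) T) as;
     concat_t Ts })"

definition restrict_constr_t :: "nat \<Rightarrow> passign \<Rightarrow> constr \<Rightarrow> constr timed" where
  "restrict_constr_t d \<rho> c = tick (do {
     ys \<leftarrow> filter_t (\<lambda>x. not_t (assigned_t \<rho> x)) (scope c);
     n \<leftarrow> length_t ys;
     T \<leftarrow> tuples_t d n;
     tab \<leftarrow> map_t (\<lambda>t. do {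
              \<tau> \<leftarrow> zip_t ys t;
              \<sigma> \<leftarrow> append_t \<tau> \<rho>;
              satisfies_t d \<sigma> c }) T;
     ret (Constr ys tab) })"

definition restrict_t :: "csp \<Rightarrow> passign \<Rightarrow> csp timed" where
  "restrict_t \<Psi> \<rho> = tick (do {
     xs \<leftarrow> filter_t (\<lambda>x. not_t (assigned_t \<rho> x)) (vars \<Psi>);
     cs \<leftarrow> map_t (restrict_constr_t (alph \<Psi>) \<rho>) (constrs \<Psi>);
     ret (CSP xs (alph \<Psi>) cs) })"

text \<open>
  One CSP for each connected component of the hypergraph.  Variables
  that occur in no constraint belong to no component and are dropped.
\<close>

definition split_t :: "csp \<Rightarrow> csp list timed" where
  "split_t \<Psi> = tick (do {
     H \<leftarrow> hypergraph_of \<Psi>;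
     P \<leftarrow> components_t (verts H) (edges H);
     map_t (\<lambda>B. do {
       I \<leftarrow> incident_t (edges H) B;
       xs \<leftarrow> map_t (\<lambda>(x, e). ret x) I;
       cs \<leftarrow> map_t (\<lambda>i. nth_t (constrs \<Psi>) i) B;
       ret (CSP xs (alph \<Psi>) cs) }) P })"

primrec any_symbol_t :: "(nat \<Rightarrow> bool timed) \<Rightarrow> nat \<Rightarrow> bool timed" where
  "any_symbol_t p 0 = tick (ret False)"
| "any_symbol_t p (Suc a) = tick (do { b \<leftarrow> p a; if b then ret True else any_symbol_t p a })"

text \<open>Does some extension of the partial assignment to the listed variables pass the test?\<close>

primrec any_assign_t ::
  "nat \<Rightarrow> (passign \<Rightarrow> bool timed) \<Rightarrow> nat list \<Rightarrow> passign \<Rightarrow> bool timed" where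
  "any_assign_t d p [] \<rho> = tick (p \<rho>)"
| "any_assign_t d p (x # xs) \<rho> = tick (any_symbol_t (\<lambda>a. any_assign_t d p xs ((x, a) # \<rho>)) d)"

definition exhaustive_sat_t :: "csp \<Rightarrow> bool timed" where
  "exhaustive_sat_t \<Phi> =
     tick (any_assign_t (alph \<Phi>) (\<lambda>\<sigma>. all_t (satisfies_t (alph \<Phi>) \<sigma>) (constrs \<Phi>)) (vars \<Phi>) [])"

definition solve_t :: "csp \<Rightarrow> nat list \<Rightarrow> bool timed" where
  "solve_t \<Psi> R = tick (any_assign_t (alph \<Psi>) (\<lambda>\<rho>. do {
     \<Phi> \<leftarrow> restrict_t \<Psi> \<rho>;
     \<Phi>s \<leftarrow> split_t \<Phi>;
     all_t exhaustive_sat_t \<Phi>s }) R [])"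

text \<open>
  The answers ``satisfiable'' and ``unsatisfiable'' are Some True and Some False; None means that
  the search for a separator failed.
\<close>

definition csp_sat_det :: "nat \<Rightarrow> nat \<Rightarrow> csp \<Rightarrow> bool option timed" where
  "csp_sat_det r s \<Psi> = tick (do {
     H \<leftarrow> hypergraph_of \<Psi>;
     res \<leftarrow> separator_det r s H;
     (case res of None \<Rightarrow> ret None | Some R \<Rightarrow> do { b \<leftarrow> solve_t \<Psi> R; ret (Some b) }) })"


section \<open>Randomised version\<close>

text \<open>
  Randomised computations are subprobability distributions of results with step counts;
  the missing mass is the probability of not terminating.  Drawing a coin of given bias takes one
  step.
\<close>

definition lift_timed :: "'a timed \<Rightarrow> 'a timed spmf" where
  "lift_timed p = return_spmf p"

definition bind_rand :: "'a timed spmf \<Rightarrow> ('a \<Rightarrow> 'b timed spmf) \<Rightarrow> 'b timed spmf"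
    (infixl \<open>\<bind>\<^sub>r\<close> 54) where
  "p \<bind>\<^sub>r f = bind_spmf p (\<lambda>x. map_spmf (\<lambda>y. Timed (result y) (steps x + steps y)) (f (result x)))"

definition coin :: "real \<Rightarrow> bool timed spmf" where
  "coin q = map_spmf (\<lambda>b. tick (ret b)) (spmf_of_pmf (bernoulli_pmf q))"

text \<open>Repeat until the result is not None.\<close>

partial_function (spmf) repeat_rand :: "'a option timed spmf \<Rightarrow> 'a timed spmf" where
  "repeat_rand p = bind_spmf p (\<lambda>x. case result x of
       None \<Rightarrow> map_spmf (\<lambda>y. Timed (result y) (Suc (steps x + steps y))) (repeat_rand p)
     | Some a \<Rightarrow> return_spmf (Timed a (Suc (steps x))))"

definition expected_steps :: "'a timed spmf \<Rightarrow> ennreal" where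
  "expected_steps p =
     (if lossless_spmf p then \<integral>\<^sup>+ x. of_nat (steps x) \<partial>measure_spmf p else \<infinity>)"

primrec sample :: "real \<Rightarrow> nat list \<Rightarrow> nat list timed spmf" where
  "sample q [] = lift_timed (tick (ret []))"
| "sample q (v # V) =
     coin q \<bind>\<^sub>r (\<lambda>b. sample q V \<bind>\<^sub>r (\<lambda>S. lift_timed (tick (ret (if b then v # S else S)))))"

text \<open>
  Padding of all hyperedges to size r with the new vertices i, i + 1, ...; also returns the first
  number that was not used.
\<close>

primrec pad_t :: "nat \<Rightarrow> nat \<Rightarrow> edge list \<Rightarrow> (edge list \<times> nat) timed" where
  "pad_t r i [] = tick (ret ([], i))"
| "pad_t r i (xe # E) = tick (do {
     l \<leftarrow> length_t (snd xe);
     new \<leftarrow> range_t i (r - l);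
     e \<leftarrow> append_t (snd xe) new;
     (E', j) \<leftarrow> pad_t r (i + (r - l)) E;
     ret ((fst xe, e) # E', j) })"

text \<open>The vertices of H must be 0, ..., n - 1, as is the case for hypergraphs of CSPs.\<close>

definition padded_t :: "nat \<Rightarrow> hypergraph \<Rightarrow> hypergraph timed" where
  "padded_t r H = tick (do {
     n \<leftarrow> length_t (verts H);
     (E, j) \<leftarrow> pad_t r n (edges H);
     V \<leftarrow> range_t 0 j;
     V' \<leftarrow> filter_t (\<lambda>v. any_t (\<lambda>(x, e). member_t v e) E) V;
     ret (Hypergraph V' E) })"

text \<open>
  A, B and C are the hyperedges inside S, inside its complement, and meeting both.  If the
  sizes are as required, C is completed to a separator by some of the hyperedges of A or B, such
  that at most m/2 hyperedges remain in either of them.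
\<close>

definition cut_t :: "nat \<Rightarrow> nat \<Rightarrow> edge list \<Rightarrow> nat list \<Rightarrow> nat list option timed" where
  "cut_t r s E S = tick (do {
     m \<leftarrow> length_t E;
     A \<leftarrow> filter_t (\<lambda>(x, e). all_t (\<lambda>v. member_t v S) e) E;
     B \<leftarrow> filter_t (\<lambda>(x, e). all_t (\<lambda>v. not_t (member_t v S)) e) E;
     C \<leftarrow> filter_t (\<lambda>(x, e). do {
            b \<leftarrow> any_t (\<lambda>v. member_t v S) e;
            if b then any_t (\<lambda>v. not_t (member_t v S)) e else ret False }) E;
     a \<leftarrow> length_t A;
     b \<leftarrow> length_t B;
     c \<leftarrow> length_t C;
     if \<bar>real a - real m / 2\<bar> \<le> real s \<and> real c \<le> (1 / 2 - eps r) * real m + real s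
     then do {
       A' \<leftarrow> take_t (a - m div 2) A;
       B' \<leftarrow> take_t (b - m div 2) B;
       D \<leftarrow> append_t A' B';
       R \<leftarrow> append_t C D;
       xs \<leftarrow> map_t (\<lambda>(x, e). ret x) R;
       ret (Some xs) }
     else ret None })"

definition separator_rand :: "nat \<Rightarrow> nat \<Rightarrow> hypergraph \<Rightarrow> nat list timed spmf" where
  "separator_rand r s H = lift_timed (padded_t r H) \<bind>\<^sub>r (\<lambda>H'.
     repeat_rand (sample (2 powr (- 1 / real r)) (verts H') \<bind>\<^sub>r (\<lambda>S. lift_timed (cut_t r s (edges H') S))))"

definition csp_sat_rand :: "nat \<Rightarrow> nat \<Rightarrow> csp \<Rightarrow> bool timed spmf" where
  "csp_sat_rand r s \<Psi> = lift_timed (tick (hypergraph_of \<Psi>)) \<bind>\<^sub>r (\<lambda>H.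
     separator_rand r s H \<bind>\<^sub>r (\<lambda>R. lift_timed (solve_t \<Psi> R)))"


section \<open>Results of the subroutines\<close>

lemma result_simps [simp]:
  "result (ret x) = x"
  "result (bind_timed p f) = result (f (result p))"
  "result (tick p) = result p"
  by (simp_all add: ret_def bind_timed_def tick_def)

lemma result_length_t [simp]: "result (length_t xs) = length xs"
  by (induction xs) simp_all

lemma result_append_t [simp]: "result (append_t xs ys) = xs @ ys"
  by (induction xs) simp_all

lemma result_concat_t [simp]: "result (concat_t xss) = concat xss"
  by (induction xss) simp_all

lemma result_map_t [simp]: "result (map_t f xs) = map (\<lambda>x. result (f x)) xs"
  by (induction xs) simp_all

lemma result_filter_t [simp]: "result (filter_t p xs) = filter (\<lambda>x. result (p x)) xs"
  by (induction xs) simp_all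

lemma result_any_t [simp]: "result (any_t p xs) \<longleftrightarrow> (\<exists>x\<in>set xs. result (p x))"
  by (induction xs) auto

lemma result_all_t [simp]: "result (all_t p xs) \<longleftrightarrow> (\<forall>x\<in>set xs. result (p x))"
  by (induction xs) auto

lemma result_not_t [simp]: "result (not_t b) \<longleftrightarrow> \<not> result b"
  by (simp add: not_t_def)

lemma result_member_t [simp]: "result (member_t v vs) \<longleftrightarrow> v \<in> set vs"
  by (auto simp: member_t_def)

lemma result_zip_t [simp]: "result (zip_t xs ys) = zip xs ys"
  by (induction xs arbitrary: ys) (auto split: list.split)

lemma result_range_t [simp]: "result (range_t i n) = [i..<i + n]"
proof (induction n arbitrary: i)
  case (Suc n)
  show ?case by (simp add: Suc upt_rec[of i])
qed simp

lemma result_take_t [simp]: "result (take_t n xs) = take n xs"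
  by (induction xs arbitrary: n) (auto simp: take_Cons')

lemma result_nth_t: "i < length xs \<Longrightarrow> result (nth_t xs i) = xs ! i"
  by (induction xs arbitrary: i) (auto simp: nth_Cons')

lemma result_meets_t [simp]: "result (meets_t e B) \<longleftrightarrow> set e \<inter> set B \<noteq> {}"
  by (auto simp: meets_t_def)

lemma result_hypergraph_of:
  "result (hypergraph_of \<Psi>) = Hypergraph [0..<length (constrs \<Psi>)]
     (map (\<lambda>x. (x, filter (\<lambda>i. x \<in> set (scope (constrs \<Psi> ! i))) [0..<length (constrs \<Psi>)])) (vars \<Psi>))"
proof -
  have zip_eq: "zip [0..<length cs] cs = map (\<lambda>i. (i, cs ! i)) [0..<length cs]" for cs :: "constr list"
    by (rule nth_equalityI) auto
  show ?thesis
    by (simp add: hypergraph_of_def zip_eq filter_map o_def case_prod_unfold)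
qed

lemma linked_sym: "linked E u v \<Longrightarrow> linked E v u"
proof -
  assume *: "linked E u v"
  have "symp (\<lambda>u v. \<exists>(x, e)\<in>set E. u \<in> set e \<and> v \<in> set e)"
    by (auto intro!: sympI)
  then show ?thesis
    using * symp_rtranclp[of "\<lambda>u v. \<exists>(x, e)\<in>set E. u \<in> set e \<and> v \<in> set e"]
    unfolding linked_def by (auto dest: sympD)
qed

lemma linked_trans: "linked E u v \<Longrightarrow> linked E v w \<Longrightarrow> linked E u w"
  by (simp add: linked_def)

lemma linked_mono: "linked E u v \<Longrightarrow> linked (xe # E) u v"
  unfolding linked_def by (erule rtranclp_mono[THEN predicate2D, rotated]) auto

lemma linked_edge: "(x, e) \<in> set E \<Longrightarrow> u \<in> set e \<Longrightarrow> v \<in> set e \<Longrightarrow> linked E u v"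
  unfolding linked_def by (rule r_into_rtranclp) auto

definition block_partition :: "nat list \<Rightarrow> edge list \<Rightarrow> nat list list \<Rightarrow> bool" where
  "block_partition V E P \<longleftrightarrow> (\<Union>B\<in>set P. set B) = set V \<and> [] \<notin> set P \<and>
     (\<forall>B\<in>set P. \<forall>C\<in>set P. set B \<inter> set C \<noteq> {} \<longrightarrow> B = C) \<and>
     (\<forall>B\<in>set P. \<forall>u\<in>set B. \<forall>v\<in>set B. linked E u v) \<and>
     (\<forall>(x, e)\<in>set E. \<forall>B\<in>set P. set e \<inter> set B \<noteq> {} \<longrightarrow> set e \<subseteq> set B)"

lemma block_partitionI:
  assumes "(\<Union>B\<in>set P. set B) = set V" "[] \<notin> set P"
    and "\<And>B C. B \<in> set P \<Longrightarrow> C \<in> set P \<Longrightarrow> set B \<inter> set C \<noteq> {} \<Longrightarrow> B = C"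
    and "\<And>B u v. B \<in> set P \<Longrightarrow> u \<in> set B \<Longrightarrow> v \<in> set B \<Longrightarrow> linked E u v"
    and "\<And>y f B. (y, f) \<in> set E \<Longrightarrow> B \<in> set P \<Longrightarrow> set f \<inter> set B \<noteq> {} \<Longrightarrow> set f \<subseteq> set B"
  shows "block_partition V E P"
proof -
  have "case xe of (x, e) \<Rightarrow> \<forall>B\<in>set P. set e \<inter> set B \<noteq> {} \<longrightarrow> set e \<subseteq> set B" if "xe \<in> set E" for xe
    by (cases xe) (use that assms(5) in \<open>simp; blast\<close>)
  then show ?thesis
    unfolding block_partition_def by (intro conjI ballI impI assms(1-4))
qed

lemma block_partition_unite:
  assumes P: "block_partition V E P" and e: "set e \<subseteq> set V"
  shows "block_partition V ((x, e) # E) (result (unite_t e P))"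
proof -
  define M where "M = filter (\<lambda>B. set e \<inter> set B \<noteq> {}) P"
  define N where "N = filter (\<lambda>B. \<not> set e \<inter> set B \<noteq> {}) P"
  have res: "result (unite_t e P) = (if M = [] then N else concat M # N)"
    by (simp add: unite_t_def M_def N_def)
  have PMN: "set P = set M \<union> set N" by (auto simp: M_def N_def)
  have cov: "(\<Union>B\<in>set P. set B) = set V" and ne: "[] \<notin> set P"
    and dis: "\<And>B C. B \<in> set P \<Longrightarrow> C \<in> set P \<Longrightarrow> set B \<inter> set C \<noteq> {} \<Longrightarrow> B = C"
    and con: "\<And>B u v. B \<in> set P \<Longrightarrow> u \<in> set B \<Longrightarrow> v \<in> set B \<Longrightarrow> linked E u v"
    and clo: "\<And>y f B. (y, f) \<in> set E \<Longrightarrow> B \<in> set P \<Longrightarrow> set f \<inter> set B \<noteq> {} \<Longrightarrow> set f \<subseteq> set B"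
    using P unfolding block_partition_def by blast+
  have MN: "set B \<inter> set C = {}" if "B \<in> set M" "C \<in> set N" for B C
  proof (rule ccontr)
    assume "set B \<inter> set C \<noteq> {}"
    then have "B = C" using dis that PMN by blast
    then show False using that by (auto simp: M_def N_def)
  qed
  have eM: "set e \<subseteq> (\<Union>B\<in>set M. set B)"
  proof
    fix u assume u: "u \<in> set e"
    then obtain B where "B \<in> set P" "u \<in> set B" using e cov by blast
    then show "u \<in> (\<Union>B\<in>set M. set B)" using u by (auto simp: M_def)
  qed
  have eN: "set e \<inter> set C = {}" if "C \<in> set N" for C
    using that by (auto simp: N_def)
  have conM: "linked ((x, e) # E) u v" if u: "u \<in> set (concat M)" and v: "v \<in> set (concat M)" for u v
  proof -
    obtain B u' where B: "B \<in> set M" "u \<in> set B" "u' \<in> set B" "u' \<in> set e"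
      using u by (auto simp: M_def)
    obtain C v' where C: "C \<in> set M" "v \<in> set C" "v' \<in> set C" "v' \<in> set e"
      using v by (auto simp: M_def)
    have "linked ((x, e) # E) u u'" "linked ((x, e) # E) v' v"
      using B C con PMN by (auto intro!: linked_mono)
    moreover have "linked ((x, e) # E) u' v'"
      using B C by (intro linked_edge[of x e]) auto
    ultimately show ?thesis by (meson linked_trans)
  qed
  have cloM: "set f \<subseteq> set (concat M)"
    if f: "(y, f) \<in> set E" "set f \<inter> set (concat M) \<noteq> {}" for y f
  proof -
    obtain B where B: "B \<in> set M" "set f \<inter> set B \<noteq> {}"
      using f(2) unfolding set_concat by blast
    then have "set f \<subseteq> set B" using clo[OF f(1)] PMN by blast
    then show ?thesis using B(1) by auto
  qed
  show ?thesis
  proof (cases "M = []")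
    case True
    then have e0: "set e = {}" using eM by auto
    have N: "set N = set P" using True PMN by simp
    have *: "linked ((x, e) # E) u v" if "B \<in> set P" "u \<in> set B" "v \<in> set B" for B u v
      using con[OF that] by (rule linked_mono)
    have **: "set f \<subseteq> set B"
      if "(y, f) \<in> set ((x, e) # E)" "B \<in> set P" "set f \<inter> set B \<noteq> {}" for y f B
      using that clo[of y f B] e0 by auto
    show ?thesis
      unfolding res if_P[OF True]
      by (rule block_partitionI; unfold N; rule cov ne dis * **; assumption)
  next
    case False
    then have cne: "concat M \<noteq> []" using ne PMN by (cases M) auto
    have 1: "(\<Union>B\<in>set (concat M # N). set B) = set V" using cov PMN by auto
    have 2: "[] \<notin> set (concat M # N)" using cne ne PMN by auto
    have 3: "B = C" if BC: "B \<in> set (concat M # N)" "C \<in> set (concat M # N)" "set B \<inter> set C \<noteq> {}" for B C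
    proof -
      have *: "set (concat M) \<inter> set D = {}" if "D \<in> set N" for D
        using MN that by auto
      consider "B = concat M" "C = concat M" | "B = concat M" "C \<in> set N"
        | "B \<in> set N" "C = concat M" | "B \<in> set N" "C \<in> set N"
        using BC(1,2) by auto
      then show ?thesis
        using BC(3) * dis PMN by cases blast+
    qed
    have 4: "linked ((x, e) # E) u v"
      if "B \<in> set (concat M # N)" "u \<in> set B" "v \<in> set B" for B u v
    proof (cases "B = concat M")
      case True
      then show ?thesis using that(2,3) conM by simp
    next
      case F: False
      then have "B \<in> set P" using that(1) PMN by auto
      then show ?thesis using con[of B u v] that(2,3) by (blast intro: linked_mono)
    qed
    have 5: "set f \<subseteq> set B"
      if "(y, f) \<in> set ((x, e) # E)" "B \<in> set (concat M # N)" "set f \<inter> set B \<noteq> {}" for y f B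
    proof (cases "B = concat M")
      case True
      then show ?thesis using that cloM[of y f] eM by auto
    next
      case F: False
      then have B: "B \<in> set N" using that by auto
      then have "(y, f) \<in> set E" using that eN[of B] by auto
      then show ?thesis using clo[of y f B] that B PMN by auto
    qed
    show ?thesis
      unfolding res if_not_P[OF False] by (rule block_partitionI) (rule 1 2 3 4 5; assumption)+
  qed
qed

lemma block_partition_components_t:
  "(\<And>x e. (x, e) \<in> set E \<Longrightarrow> set e \<subseteq> set V) \<Longrightarrow> block_partition V E (result (components_t V E))"
proof (induction E)
  case Nil
  show ?case by (auto simp: block_partition_def linked_def)
next
  case (Cons xe E)
  obtain x e where xe: "xe = (x, e)" by (cases xe)
  have "block_partition V E (result (components_t V E))"
    using Cons by (metis list.set_intros(2))
  then show ?case
    using Cons.prems[of x e] block_partition_unite by (simp add: xe)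
qed

lemma set_result_components_t:
  assumes "\<And>x e. (x, e) \<in> set E \<Longrightarrow> set e \<subseteq> set V"
  shows "set ` set (result (components_t V E)) = conn_components V E"
proof -
  define P where "P = result (components_t V E)"
  have P: "block_partition V E P"
    unfolding P_def using assms by (rule block_partition_components_t)
  have stay: "v \<in> set B" if "linked E u v" "u \<in> set B" "B \<in> set P" for u v B
    using that(1) unfolding linked_def
  proof (induction rule: rtranclp_induct)
    case base
    show ?case by (rule that(2))
  next
    case (step v w)
    then obtain x e where e: "(x, e) \<in> set E" "v \<in> set e" "w \<in> set e" by auto
    then have "set e \<subseteq> set B"
      using P step.IH that(3) unfolding block_partition_def by blast
    then show ?case using e by auto
  qed
  have sub: "set B \<subseteq> set V" if "B \<in> set P" for B
    using P that unfolding block_partition_def by blast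
  have block: "set B = {v \<in> set V. linked E u v}" if "B \<in> set P" "u \<in> set B" for B u
    using P that stay sub[of B] unfolding block_partition_def by blast
  have cov: "\<exists>B\<in>set P. u \<in> set B" if "u \<in> set V" for u
    using P that unfolding block_partition_def by blast
  have ne: "\<exists>u. u \<in> set B" if "B \<in> set P" for B
    using P that unfolding block_partition_def by (metis ex_in_conv set_empty)
  show ?thesis
    unfolding conn_components_def P_def[symmetric]
  proof (intro set_eqI iffI)
    fix C assume "C \<in> set ` set P"
    then obtain B u where "C = set B" "B \<in> set P" "u \<in> set B" using ne by blast
    then show "C \<in> (\<lambda>u. {v \<in> set V. linked E u v}) ` set V"
      using block sub by blast
  next
    fix C assume "C \<in> (\<lambda>u. {v \<in> set V. linked E u v}) ` set V"
    then obtain u where u: "u \<in> set V" "C = {v \<in> set V. linked E u v}" by blast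
    then obtain B where "B \<in> set P" "u \<in> set B" using cov by blast
    then show "C \<in> set ` set P" using block u by blast
  qed
qed

lemma result_balanced_t:
  assumes "distinct (edges H)" and "\<And>x e. (x, e) \<in> set (edges H) \<Longrightarrow> set e \<subseteq> set (verts H)"
  shows "result (balanced_t H R) \<longleftrightarrow> balanced_separator H (set R)"
proof -
  define E where "E = filter (\<lambda>(x, e). x \<notin> set R) (edges H)"
  have len: "length (filter (\<lambda>(x, e). set e \<inter> C \<noteq> {}) E)
      = card {(x, e) \<in> set (edges H). x \<notin> set R \<and> set e \<inter> C \<noteq> {}}" for C
  proof -
    have "distinct (filter (\<lambda>(x, e). set e \<inter> C \<noteq> {}) E)"
      using assms(1) by (simp add: E_def)
    from distinct_card[OF this] have "length (filter (\<lambda>(x, e). set e \<inter> C \<noteq> {}) E)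
        = card (set (filter (\<lambda>(x, e). set e \<inter> C \<noteq> {}) E))" ..
    also have "set (filter (\<lambda>(x, e). set e \<inter> C \<noteq> {}) E)
        = {(x, e) \<in> set (edges H). x \<notin> set R \<and> set e \<inter> C \<noteq> {}}"
      by (auto simp: E_def)
    finally show ?thesis .
  qed
  have comp: "set ` set (result (components_t (verts H) E)) = conn_components (verts H) E"
    by (rule set_result_components_t) (use assms(2) in \<open>auto simp: E_def\<close>)
  have "result (balanced_t H R) \<longleftrightarrow> (\<forall>B\<in>set (result (components_t (verts H) E)).
      2 * length (filter (\<lambda>(x, e). set e \<inter> set B \<noteq> {}) E) \<le> length (edges H))"
    by (simp add: balanced_t_def E_def incident_t_def case_prod_unfold)
  also have "\<dots> \<longleftrightarrow> (\<forall>C\<in>conn_components (verts H) E.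
      2 * length (filter (\<lambda>(x, e). set e \<inter> C \<noteq> {}) E) \<le> length (edges H))"
    by (simp add: comp[symmetric])
  also have "\<dots> \<longleftrightarrow> balanced_separator H (set R)"
  proof -
    have "2 * a \<le> b \<longleftrightarrow> real a \<le> real b / 2" for a b :: nat
      by linarith
    then show ?thesis
      unfolding balanced_separator_def E_def[symmetric] len distinct_card[OF assms(1)] by simp
  qed
  finally show ?thesis .
qed

end

theory Submission
  imports Defs "HOL-Probability.Hoeffding" "HOL-Real_Asymp.Real_Asymp"
begin

text \<open>
  Put each vertex of the padded hypergraph into S with probability q, where q to the power r is 1/2.
  Then the numbers of hyperedges inside S and outside S have expectations m/2 and eps r * m.  Two
  disjoint hyperedges behave independently and at most m r k pairs meet, so by Chebyshev's inequality
  both numbers are, with probability at least 1/2, within a constant times the square root of m r k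
  of their means.  This square root is o(m), so that about (1/2 - eps r) m hyperedges cross the cut;
  these and o(m) more form a balanced separator R.  For each of the d ^ |R| assignments to R the
  remaining components have at most m/2 variables, which gives d ^ ((1 - eps r) m) up to
  subexponential factors.  In the deterministic search, the sets of at most (1/2 - eps r) m + s
  hyperedges are counted by an exponential-moment bound for binomial tails.
\<close>


section \<open>Bounds on numbers of steps\<close>

text \<open>The exponent's error term must be chosen before d, so every overhead is measured in base
  d. The sizes of all lists are at most N = 16 r m d^k, where d^k accounts for the truth tables.
  Apart from two exponential enumerations the step counts are powers of N, and N^15 is at most d to
  the power 15 (log 2 (16 r m) + k), an exponent that is sublinear and free of d.

  The three running times reflect which enumeration dominates. As eps r is at most 9/100, even all
  2^m sets of hyperedges are no more than d^((1 - eps r) m) when d >= 3, so the exhaustive search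
  for R is absorbed by the cost of solving. For d = 2 it becomes the bottleneck: Hoeffding's lemma
  bounds the number of candidate sets by 2^((1 - 2 (eps r)^2) m), up to the slack, and this exceeds
  the cost of solving. Sampling R avoids the search.

  Balance and size of R are separate matters. The completed set of crossing hyperedges is balanced
  for every vertex set S; randomness only makes it small. The deterministic version uses the random
  cut merely as a proof that a small separator exists.\<close>

lemma steps_simps [simp]:
  "steps (ret x) = 0"
  "steps (bind_timed p f) = steps p + steps (f (result p))"
  "steps (tick p) = Suc (steps p)"
  by (simp_all add: ret_def bind_timed_def tick_def)

lemma steps_length_t [simp]: "steps (length_t xs) = Suc (length xs)"
  by (induction xs) simp_all

lemma steps_append_t [simp]: "steps (append_t xs ys) = Suc (length xs)"
  by (induction xs) simp_all

lemma steps_concat_t [simp]: "steps (concat_t xss) = Suc (2 * length xss + length (concat xss))"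
  by (induction xss) simp_all

lemma steps_take_t_le: "steps (take_t n xs) \<le> Suc (length xs)"
  by (induction xs arbitrary: n) simp_all

lemma steps_zip_t_le: "steps (zip_t xs ys) \<le> Suc (length xs)"
  by (induction xs arbitrary: ys) (simp_all split: list.split)

lemma steps_range_t [simp]: "steps (range_t i n) = Suc n"
  by (induction n arbitrary: i) simp_all

lemma steps_nth_t_le: "steps (nth_t xs i) \<le> Suc (length xs)"
  by (induction xs arbitrary: i) simp_all

lemma steps_lookup_t_le: "steps (lookup_t \<rho> x) \<le> Suc (length \<rho>)"
  by (induction \<rho>) simp_all

lemma steps_tuple_index_t [simp]: "steps (tuple_index_t d i as) = Suc (length as)"
  by (induction as arbitrary: i) simp_all

lemma steps_map_t_le:
  assumes "\<And>x. x \<in> set xs \<Longrightarrow> steps (f x) \<le> c"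
  shows "steps (map_t f xs) \<le> length xs * Suc c + 1"
  using assms
proof (induction xs)
  case (Cons x xs)
  then have "steps (f x) \<le> c" "steps (map_t f xs) \<le> length xs * Suc c + 1" by auto
  then show ?case by simp
qed simp

lemma steps_filter_t_le:
  assumes "\<And>x. x \<in> set xs \<Longrightarrow> steps (f x) \<le> c"
  shows "steps (filter_t f xs) \<le> length xs * Suc c + 1"
  using assms
proof (induction xs)
  case (Cons x xs)
  then have "steps (f x) \<le> c" "steps (filter_t f xs) \<le> length xs * Suc c + 1" by auto
  then show ?case by simp
qed simp

lemma steps_any_t_le:
  assumes "\<And>x. x \<in> set xs \<Longrightarrow> steps (f x) \<le> c"
  shows "steps (any_t f xs) \<le> length xs * Suc c + 1"
  using assms
proof (induction xs)
  case (Cons x xs)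
  then have "steps (f x) \<le> c" "steps (any_t f xs) \<le> length xs * Suc c + 1" by auto
  then show ?case by simp
qed simp

lemma steps_all_t_le:
  assumes "\<And>x. x \<in> set xs \<Longrightarrow> steps (f x) \<le> c"
  shows "steps (all_t f xs) \<le> length xs * Suc c + 1"
  using assms
proof (induction xs)
  case (Cons x xs)
  then have "steps (f x) \<le> c" "steps (all_t f xs) \<le> length xs * Suc c + 1" by auto
  then show ?case by simp
qed simp

lemma steps_any_symbol_t_le:
  assumes "\<And>a. a < d \<Longrightarrow> steps (p a) \<le> c"
  shows "steps (any_symbol_t p d) \<le> d * Suc c + 1"
  using assms
proof (induction d)
  case (Suc d)
  then have "steps (p d) \<le> c" "steps (any_symbol_t p d) \<le> d * Suc c + 1" by auto
  then show ?case by simp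
qed simp

text \<open>One level turns a bound t into d * (t + 1) + 2. The summand 4 makes the recursion purely
  multiplicative, because d * (t + 1) + 6 <= d * (t + 4) for d >= 2, with equality at d = 2; no
  overhead accumulates along the levels.\<close>

lemma steps_any_assign_t_le:
  assumes "d \<ge> 2"
    and "\<And>\<sigma>. map fst \<sigma> = rev xs @ map fst \<rho> \<Longrightarrow> steps (p \<sigma>) \<le> c"
  shows "steps (any_assign_t d p xs \<rho>) + 4 \<le> (c + 5) * d ^ length xs"
  using assms(2)
proof (induction xs arbitrary: \<rho>)
  case (Cons x xs)
  define T where "T = (c + 5) * d ^ length xs"
  have "steps (any_assign_t d p xs ((x, a) # \<rho>)) + 4 \<le> T" for a
    unfolding T_def by (rule Cons.IH) (simp add: Cons.prems)
  moreover have "5 * 1 \<le> T"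
    unfolding T_def using \<open>d \<ge> 2\<close> by (intro mult_le_mono) auto
  then have "T \<ge> 5" by simp
  ultimately have "steps (any_assign_t d p xs ((x, a) # \<rho>)) \<le> T - 4" for a
    by (metis add_le_imp_le_diff)
  then have "steps (any_symbol_t (\<lambda>a. any_assign_t d p xs ((x, a) # \<rho>)) d) \<le> d * Suc (T - 4) + 1"
    by (rule steps_any_symbol_t_le)
  moreover have "d * Suc (T - 4) + 6 \<le> d * T"
  proof -
    obtain u where "T = u + 5" using \<open>T \<ge> 5\<close> by (metis add.commute le_Suc_ex)
    then show ?thesis using \<open>d \<ge> 2\<close> by (simp add: algebra_simps)
  qed
  ultimately show ?case by (simp add: T_def mult_ac)
qed (simp add: add.commute)

text \<open>The weight \<open>(1 / q) ^ b * (1 + q) ^ n\<close> obeys a Pascal recursion exactly: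
  skipping an element contributes the weight for n - 1 and b, taking it contributes q times that,
  which is the weight for n - 1 and b - 1. For q <= 1 it is the exponential-moment bound on the
  number of sets of at most b among n elements; q = 1 counts all sets. The summand 1 on the left
  lets two recursive calls pay for the step of their caller.\<close>

lemma steps_search_t_le:
  fixes q :: real
  assumes "\<And>S. set S \<subseteq> set xs \<union> set R \<Longrightarrow> length S \<le> length xs + length R \<Longrightarrow> steps (p S) \<le> c"
    and "1 / 2 \<le> q" "q \<le> 1"
  shows "real (steps (search_t p xs b R)) + 1 \<le> (real c + 2) * ((1 / q) ^ b * (1 + q) ^ length xs)"
  using assms(1)
proof (induction xs arbitrary: b R)
  case Nil
  have "1 \<le> (1 / q) ^ b" using assms(2,3) by (intro one_le_power) simp
  then have *: "(real c + 2) * 1 \<le> (real c + 2) * (1 / q) ^ b" by (intro mult_left_mono) auto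
  have "steps (p R) \<le> c" by (rule Nil.prems) auto
  then have "real (steps (search_t p [] b R)) + 1 \<le> (real c + 2) * 1" by simp
  from order_trans[OF this *] show ?case by simp
next
  case (Cons x xs)
  define f where "f b = (1 / q) ^ b * (1 + q) ^ length xs" for b
  have f1: "1 \<le> f b" for b
  proof -
    have "1 * 1 \<le> f b"
      unfolding f_def using assms(2,3) by (intro mult_mono one_le_power) auto
    then show ?thesis by simp
  qed
  have 1: "real (steps (search_t p xs b R)) + 1 \<le> (real c + 2) * f b" for b
    unfolding f_def by (intro Cons.IH Cons.prems) auto
  have 2: "real (steps (search_t p xs b (x # R))) + 1 \<le> (real c + 2) * f b" for b
    unfolding f_def by (intro Cons.IH Cons.prems) auto
  have "q * f b \<ge> 1 / 2 * 1"
    using f1[of b] assms(2) by (intro mult_mono) auto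
  then have 3: "(real c + 2) * (q * f b) \<ge> 2 * (1 / 2)"
    by (intro mult_mono) auto
  have expand: "(1 / q) ^ b * (1 + q) ^ length (x # xs) = f b + q * f b"
    by (simp add: f_def algebra_simps)
  show ?case
  proof (cases "b = 0")
    case True
    then show ?thesis
      using 1[of b] 3 unfolding expand by (simp add: algebra_simps)
  next
    case False
    then obtain b' where b: "b = Suc b'" by (cases b) auto
    have "q * f b = f b'" using assms(2) by (simp add: f_def b)
    moreover have "steps (search_t p (x # xs) b R) \<le>
        Suc (steps (search_t p xs b R) + steps (search_t p xs b' (x # R)))"
      by (simp add: b)
    ultimately show ?thesis
      using 1[of b] 2[of b'] unfolding expand by (simp add: algebra_simps)
  qed
qed


text \<open>
  Step counts are bounded by powers of one number N that exceeds the sizes of all lists; as N is at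
  least 16, constant factors are absorbed by raising the exponent.
\<close>

locale size_bound =
  fixes N :: nat
  assumes N_ge: "16 \<le> N"
begin

lemma power_le: "x \<le> N ^ e \<Longrightarrow> e \<le> E \<Longrightarrow> x \<le> N ^ E"
  using N_ge power_increasing[of e E N] by linarith

lemma absorb: "x \<le> 15 * N ^ e + 1 \<Longrightarrow> Suc e \<le> E \<Longrightarrow> x \<le> N ^ E"
proof (rule power_le)
  assume "x \<le> 15 * N ^ e + 1"
  also have "\<dots> \<le> 16 * N ^ e" using N_ge by simp
  also have "\<dots> \<le> N * N ^ e" using N_ge by (rule mult_le_mono1)
  finally show "x \<le> N ^ Suc e" by simp
qed

lemma linear_le:
  assumes "x \<le> 4 * N + 2" "2 \<le> E"
  shows "x \<le> N ^ E"
  by (rule absorb[of _ 1]) (use assms N_ge in auto)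

text \<open>The length contributes one factor N and the constants are absorbed by a second one,
  hence the pattern \<open>e + 2 \<le> E\<close> in the bounds for list functions below.\<close>

lemma list_le:
  assumes "x \<le> n * Suc (N ^ e) + 1" "n \<le> N" "e + 2 \<le> E"
  shows "x \<le> N ^ E"
proof (rule absorb)
  have "n * Suc (N ^ e) \<le> N * Suc (N ^ e)" using assms(2) by (rule mult_le_mono1)
  moreover have "N \<le> N * N ^ e" using N_ge by simp
  ultimately show "x \<le> 15 * N ^ Suc e + 1"
    using assms(1) unfolding mult_Suc_right power_Suc by linarith
qed (use assms in simp)

lemma map_t_le:
  assumes "\<And>x. x \<in> set xs \<Longrightarrow> steps (f x) \<le> N ^ e" "length xs \<le> N" "e + 2 \<le> E"
  shows "steps (map_t f xs) \<le> N ^ E"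
  by (rule list_le[OF steps_map_t_le assms(2,3)]) (rule assms(1))

lemma filter_t_le:
  assumes "\<And>x. x \<in> set xs \<Longrightarrow> steps (f x) \<le> N ^ e" "length xs \<le> N" "e + 2 \<le> E"
  shows "steps (filter_t f xs) \<le> N ^ E"
  by (rule list_le[OF steps_filter_t_le assms(2,3)]) (rule assms(1))

lemma any_t_le:
  assumes "\<And>x. x \<in> set xs \<Longrightarrow> steps (f x) \<le> N ^ e" "length xs \<le> N" "e + 2 \<le> E"
  shows "steps (any_t f xs) \<le> N ^ E"
  by (rule list_le[OF steps_any_t_le assms(2,3)]) (rule assms(1))

lemma all_t_le:
  assumes "\<And>x. x \<in> set xs \<Longrightarrow> steps (f x) \<le> N ^ e" "length xs \<le> N" "e + 2 \<le> E"
  shows "steps (all_t f xs) \<le> N ^ E"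
  by (rule list_le[OF steps_all_t_le assms(2,3)]) (rule assms(1))

lemma length_t_le: "length xs \<le> N \<Longrightarrow> 2 \<le> E \<Longrightarrow> steps (length_t xs) \<le> N ^ E"
  and append_t_le: "length xs \<le> N \<Longrightarrow> 2 \<le> E \<Longrightarrow> steps (append_t xs ys) \<le> N ^ E"
  and range_t_le: "n \<le> N \<Longrightarrow> 2 \<le> E \<Longrightarrow> steps (range_t i n) \<le> N ^ E"
  and tuple_index_t_le: "length as \<le> N \<Longrightarrow> 2 \<le> E \<Longrightarrow> steps (tuple_index_t d i as) \<le> N ^ E"
  and zip_t_le: "length xs \<le> N \<Longrightarrow> 2 \<le> E \<Longrightarrow> steps (zip_t xs zs) \<le> N ^ E"
  and take_t_le: "length xs \<le> N \<Longrightarrow> 2 \<le> E \<Longrightarrow> steps (take_t n xs) \<le> N ^ E"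
  and nth_t_le: "length xs \<le> N \<Longrightarrow> 2 \<le> E \<Longrightarrow> steps (nth_t xs n) \<le> N ^ E"
  and lookup_t_le: "length \<rho> \<le> N \<Longrightarrow> 2 \<le> E \<Longrightarrow> steps (lookup_t \<rho> x) \<le> N ^ E"
  using steps_zip_t_le[of xs zs] steps_take_t_le[of n xs] steps_nth_t_le[of xs n]
    steps_lookup_t_le[of \<rho> x]
  by (auto intro!: linear_le)

lemma concat_t_le:
  "length xss \<le> N \<Longrightarrow> length (concat xss) \<le> N \<Longrightarrow> 2 \<le> E \<Longrightarrow> steps (concat_t xss) \<le> N ^ E"
  by (auto intro!: linear_le)

lemma member_t_le: "length xs \<le> N \<Longrightarrow> 2 \<le> E \<Longrightarrow> steps (member_t x xs) \<le> N ^ E"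
  unfolding member_t_def
  by (rule linear_le[OF order_trans[OF steps_any_t_le[where c = 1]]]) auto

lemma assigned_t_le: "length \<rho> \<le> N \<Longrightarrow> 2 \<le> E \<Longrightarrow> steps (assigned_t \<rho> x) \<le> N ^ E"
  unfolding assigned_t_def
  by (rule linear_le[OF order_trans[OF steps_any_t_le[where c = 1]]]) auto

lemma not_t_le: "steps p \<le> N ^ e \<Longrightarrow> Suc e \<le> E \<Longrightarrow> steps (not_t p) \<le> N ^ E"
  unfolding not_t_def by (rule absorb) auto

lemma meets_t_le: "length e \<le> N \<Longrightarrow> length B \<le> N \<Longrightarrow> 4 \<le> E \<Longrightarrow> steps (meets_t e B) \<le> N ^ E"
  unfolding meets_t_def by (rule any_t_le[where e = 2]) (auto intro: member_t_le)

lemma length_le_concat: "B \<in> set P \<Longrightarrow> length B \<le> length (concat P)"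
  by (induction P) auto

lemma unite_t_le:
  assumes "length e \<le> N" "length P \<le> N" "length (concat P) \<le> N" "8 \<le> E"
  shows "steps (unite_t e P) \<le> N ^ E"
proof -
  define M where "M = filter (\<lambda>B. set e \<inter> set B \<noteq> {}) P"
  have B: "length B \<le> N" if "B \<in> set P" for B
    using length_le_concat[OF that] assms(3) by simp
  have 1: "steps (filter_t (meets_t e) P) \<le> N ^ 7"
    by (rule filter_t_le[where e = 4]) (auto intro: meets_t_le B assms)
  have 2: "steps (filter_t (\<lambda>B. not_t (meets_t e B)) P) \<le> N ^ 7"
    by (rule filter_t_le[where e = 5]) (auto intro!: not_t_le[where e = 4] meets_t_le B assms)
  have "length (concat M) \<le> length (concat P)"
    unfolding M_def by (induction P) auto
  moreover have "length M \<le> length P" by (simp add: M_def)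
  ultimately have 3: "steps (concat_t M) \<le> N ^ 7"
    using assms by (intro concat_t_le) auto
  have "steps (unite_t e P) \<le> Suc (steps (filter_t (meets_t e) P)
      + steps (filter_t (\<lambda>B. not_t (meets_t e B)) P) + steps (concat_t M))"
    by (simp add: unite_t_def M_def)
  then show ?thesis using 1 2 3 assms(4) by (intro absorb[of _ 7]) auto
qed

end

text \<open>Uniting only regroups entries and never creates additional blocks. All intermediate
  partitions therefore stay within the size of the vertex list, and the bound for one union applies
  throughout \<open>components_t\<close>.\<close>

lemma concat_unite_t:
  "length (concat (result (unite_t e P))) = length (concat P)" and
  length_unite_t: "length (result (unite_t e P)) \<le> length P"
proof -
  define M where "M = filter (\<lambda>B. set e \<inter> set B \<noteq> {}) P"
  define L where "L = filter (\<lambda>B. \<not> set e \<inter> set B \<noteq> {}) P"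
  have res: "result (unite_t e P) = (if M = [] then L else concat M # L)"
    by (simp add: unite_t_def M_def L_def)
  have "length (concat M) + length (concat L) = length (concat P)"
    unfolding M_def L_def by (induction P) auto
  then show "length (concat (result (unite_t e P))) = length (concat P)"
    by (auto simp: res)
  have "length M + length L = length P"
    unfolding M_def L_def by (rule sum_length_filter_compl)
  moreover have "1 \<le> length M" if "M \<noteq> []" using that by (cases M) auto
  ultimately show "length (result (unite_t e P)) \<le> length P"
    by (auto simp: res)
qed

lemma length_components_t:
  "length (result (components_t V E)) \<le> length V"
  "length (concat (result (components_t V E))) = length V"
proof (induction E)
  case Nil
  { case 1 show ?case by simp }
  { case 2 show ?case by (induction V) auto }
next
  case (Cons xe E)
  { case 1 show ?case using Cons length_unite_t[of "snd xe" "result (components_t V E)"] by simp }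
  { case 2 show ?case using Cons by (simp add: concat_unite_t) }
qed

context size_bound
begin

lemma components_t_le:
  assumes V: "length V \<le> N" and E: "length E \<le> N"
    and e: "\<And>x e. (x, e) \<in> set E \<Longrightarrow> length e \<le> N" and "10 \<le> K"
  shows "steps (components_t V E) \<le> N ^ K"
proof -
  \<comment> \<open>The number of edges stays an explicit factor during the induction; absorbing the
    cost of each edge separately would raise the exponent once per edge.\<close>
  have "steps (components_t V E) \<le> Suc (length E) * Suc (N ^ 8)"
    using e
  proof (induction E)
    case Nil
    have "steps (map_t (\<lambda>v. ret [v]) V) \<le> N ^ 8"
      using V by (intro map_t_le[where e = 0]) auto
    then show ?case by simp
  next
    case (Cons xe E)
    have "steps (unite_t (snd xe) (result (components_t V E))) \<le> N ^ 8"
      using V length_components_t[of V E] Cons.prems[of "fst xe" "snd xe"]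
      by (intro unite_t_le) auto
    moreover have "steps (components_t V E) \<le> Suc (length E) * Suc (N ^ 8)"
      using Cons by (metis list.set_intros(2))
    ultimately show ?case by simp
  qed
  moreover have "Suc (length E) * Suc (N ^ 8) \<le> Suc N * Suc (N ^ 8)"
    using E by (intro mult_le_mono1) simp
  moreover have "Suc N * Suc (N ^ 8) \<le> 15 * N ^ 9 + 1"
  proof -
    have "N ^ 9 = N * N ^ 8" by (simp add: power_numeral_reduce)
    moreover have "N ^ 8 \<le> N ^ 9" "N \<le> N ^ 9"
      using N_ge by (auto intro!: power_increasing self_le_power)
    ultimately show ?thesis unfolding mult_Suc mult_Suc_right by linarith
  qed
  ultimately show ?thesis using \<open>10 \<le> K\<close> by (intro absorb[of _ 9]) auto
qed

lemma incident_t_le: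
  assumes "length E \<le> N" "\<And>x e. (x, e) \<in> set E \<Longrightarrow> length e \<le> N" "length B \<le> N" "6 \<le> K"
  shows "steps (incident_t E B) \<le> N ^ K"
  unfolding incident_t_def
  by (rule filter_t_le[where e = 4]) (use assms in \<open>auto intro!: meets_t_le\<close>)

lemma balanced_t_le:
  assumes V: "length (verts H) \<le> N" and E: "length (edges H) \<le> N"
    and e: "\<And>x e. (x, e) \<in> set (edges H) \<Longrightarrow> length e \<le> N"
    and R: "length R \<le> N" and "11 \<le> K"
  shows "steps (balanced_t H R) \<le> N ^ K"
proof -
  define E' where "E' = filter (\<lambda>(x, e). x \<notin> set R) (edges H)"
  define P where "P = result (components_t (verts H) E')"
  define test where "test = (\<lambda>B. do { I \<leftarrow> incident_t E' B; l \<leftarrow> length_t I;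
      ret (2 * l \<le> length (edges H)) })"
  have lE': "length E' \<le> N" and eE': "\<And>x e. (x, e) \<in> set E' \<Longrightarrow> length e \<le> N"
    using E e by (auto simp: E'_def intro: order_trans[OF length_filter_le])
  have 1: "steps (filter_t (\<lambda>(x, e). not_t (member_t x R)) (edges H)) \<le> N ^ 10"
    by (rule filter_t_le[where e = 3])
      (use R E in \<open>auto intro!: not_t_le[where e = 2] member_t_le\<close>)
  have 2: "steps (components_t (verts H) E') \<le> N ^ 10"
    by (rule components_t_le[OF V lE' eE']) auto
  have 3: "steps (length_t (edges H)) \<le> N ^ 10"
    using E by (rule length_t_le) simp
  have B: "steps (test B) \<le> N ^ 7" if "B \<in> set P" for B
  proof -
    have "length B \<le> N"
      using length_le_concat[OF that] V length_components_t(2)[of "verts H" E'] by (simp add: P_def)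
    then have "steps (incident_t E' B) \<le> N ^ 6"
      using lE' eE' by (intro incident_t_le) auto
    moreover have "length (result (incident_t E' B)) \<le> N"
      using lE' by (auto simp: incident_t_def intro: order_trans[OF length_filter_le])
    then have "steps (length_t (result (incident_t E' B))) \<le> N ^ 6"
      by (rule length_t_le) simp
    ultimately show ?thesis
      unfolding test_def by (intro absorb[of _ 6]) auto
  qed
  have 4: "steps (all_t test P) \<le> N ^ 10"
    by (rule all_t_le[where e = 7])
      (use B V length_components_t(1)[of "verts H" E'] in \<open>auto simp: P_def\<close>)
  have "result (filter_t (\<lambda>(x, e). not_t (member_t x R)) (edges H)) = E'"
    by (simp add: E'_def case_prod_unfold)
  then have "steps (balanced_t H R) = Suc (steps (filter_t (\<lambda>(x, e). not_t (member_t x R)) (edges H))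
     + (steps (components_t (verts H) E') + (steps (length_t (edges H)) + steps (all_t test P))))"
    by (simp only: balanced_t_def steps_simps P_def test_def result_length_t)
  then show ?thesis using 1 2 3 4 \<open>11 \<le> K\<close> by (intro absorb[of _ 10]) auto
qed

lemma hypergraph_of_le:
  assumes "length (constrs \<Psi>) \<le> N" "length (vars \<Psi>) \<le> N"
    and "\<And>c. c \<in> set (constrs \<Psi>) \<Longrightarrow> length (scope c) \<le> N" and "8 \<le> K"
  shows "steps (hypergraph_of \<Psi>) \<le> N ^ K"
proof -
  define cs where "cs = zip [0..<length (constrs \<Psi>)] (constrs \<Psi>)"
  define row where "row = (\<lambda>x. do { ics \<leftarrow> filter_t (\<lambda>(i, c). member_t x (scope c)) cs;
      e \<leftarrow> map_t (\<lambda>(i, c). ret i) ics; ret (x, e) })"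
  have lcs: "length cs \<le> N" using assms(1) by (simp add: cs_def)
  have row: "steps (row x) \<le> N ^ 5" for x
  proof -
    define ics where "ics = result (filter_t (\<lambda>(i, c). member_t x (scope c)) cs)"
    have "length (scope c) \<le> N" if "(i, c) \<in> set cs" for i c
      using assms(3) set_zip_rightD[of i c] that by (auto simp: cs_def)
    then have "steps (filter_t (\<lambda>(i, c). member_t x (scope c)) cs) \<le> N ^ 4"
      using lcs by (intro filter_t_le[where e = 2]) (auto intro!: member_t_le)
    moreover have "length ics \<le> N"
      using lcs by (auto simp: ics_def intro: order_trans[OF length_filter_le])
    then have "steps (map_t (\<lambda>(i, c). ret i) ics) \<le> N ^ 4"
      by (intro map_t_le[where e = 0]) auto
    ultimately show ?thesis
      unfolding row_def by (intro absorb[of _ 4]) (auto simp: ics_def)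
  qed
  have 1: "steps (length_t (constrs \<Psi>)) \<le> N ^ 7"
    using assms(1) by (rule length_t_le) simp
  have 2: "steps (range_t 0 (length (constrs \<Psi>))) \<le> N ^ 7"
    using assms(1) by (rule range_t_le) simp
  have 3: "steps (zip_t [0..<length (constrs \<Psi>)] (constrs \<Psi>)) \<le> N ^ 7"
    by (rule zip_t_le) (use assms in auto)
  have 4: "steps (map_t row (vars \<Psi>)) \<le> N ^ 7"
    using row assms by (intro map_t_le[where e = 5]) auto
  have "steps (hypergraph_of \<Psi>) = Suc (steps (length_t (constrs \<Psi>)) +
     (steps (range_t 0 (length (constrs \<Psi>))) + (steps (zip_t [0..<length (constrs \<Psi>)] (constrs \<Psi>))
       + steps (map_t row (vars \<Psi>)))))"
    unfolding row_def cs_def hypergraph_of_def steps_simps result_length_t result_range_t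
      result_zip_t by simp
  then show ?thesis using 1 2 3 4 \<open>8 \<le> K\<close> by (intro absorb[of _ 7]) auto
qed

lemma satisfies_t_le:
  assumes "length (scope c) \<le> N" "length (table c) \<le> N" "length \<sigma> \<le> N" "5 \<le> K"
  shows "steps (satisfies_t d \<sigma> c) \<le> N ^ K"
proof -
  have 1: "steps (map_t (lookup_t \<sigma>) (scope c)) \<le> N ^ 4"
    using assms by (intro map_t_le[where e = 2]) (auto intro!: lookup_t_le)
  define vs where "vs = result (map_t (lookup_t \<sigma>) (scope c))"
  define i where "i = result (tuple_index_t d 0 vs)"
  have 2: "steps (tuple_index_t d 0 vs) \<le> N ^ 4"
    by (rule tuple_index_t_le) (use assms in \<open>auto simp: vs_def\<close>)
  have 3: "steps (nth_t (table c) i) \<le> N ^ 4"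
    by (rule nth_t_le) (use assms in auto)
  have "steps (satisfies_t d \<sigma> c) = Suc (steps (map_t (lookup_t \<sigma>) (scope c)) +
      (steps (tuple_index_t d 0 vs) + steps (nth_t (table c) i)))"
    by (simp only: satisfies_t_def steps_simps vs_def i_def)
  then show ?thesis
    using 1 2 3 assms(4) by (intro absorb[of _ 4]) auto
qed

text \<open>The bound d ^ n <= N for the full length holds for all shorter lengths as well, so each
  level builds at most N tuples. Its cost is linear in N and thus at most
  \<open>N ^ 2\<close>.\<close>

lemma tuples_t_le_aux:
  assumes "1 \<le> d" "d \<le> N" "d ^ n \<le> N"
  shows "length (result (tuples_t d n)) = d ^ n \<and> steps (tuples_t d n) \<le> Suc n * N ^ 2"
  using assms(3)
proof (induction n)
  case 0
  show ?case using N_ge by simp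
next
  case (Suc n)
  have dn: "d ^ n \<le> d ^ Suc n" using assms(1) by (simp add: mult_le_cancel1)
  then have "d ^ n \<le> N" using Suc.prems by (rule order_trans)
  then have IH: "length (result (tuples_t d n)) = d ^ n" "steps (tuples_t d n) \<le> Suc n * N ^ 2"
    using Suc.IH by blast+
  define T where "T = result (tuples_t d n)"
  have conc: "length (concat (map (\<lambda>a. map ((#) a) T) as)) = length as * d ^ n" for as
    using IH by (induction as) (auto simp: T_def)
  have *: "steps (map_t (\<lambda>a. map_t (\<lambda>t. ret (a # t)) T) [0..<d]) \<le> d * Suc (d ^ n * Suc 0 + 1) + 1"
    using steps_map_t_le[of "[0..<d]" "\<lambda>a. map_t (\<lambda>t. ret (a # t)) T" "d ^ n * Suc 0 + 1"]
      steps_map_t_le[of T "\<lambda>t. ret (_ # t)" 0] IH by (simp add: T_def)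
  have "steps (tuples_t d (Suc n)) = Suc (steps (tuples_t d n) + (Suc d +
     (steps (map_t (\<lambda>a. map_t (\<lambda>t. ret (a # t)) T) [0..<d]) + Suc (2 * d + d * d ^ n))))"
    by (simp add: conc T_def[symmetric])
  also have "\<dots> \<le> steps (tuples_t d n) + 8 * N + 5"
    using * Suc.prems assms(2) by simp
  also have "\<dots> \<le> Suc n * N ^ 2 + N ^ 2"
  proof -
    have "8 * N + 5 \<le> 16 * N" using N_ge by simp
    also have "\<dots> \<le> N * N" using N_ge by (rule mult_le_mono1)
    finally show ?thesis using IH by (simp add: power2_eq_square)
  qed
  finally show ?case by (simp add: conc T_def[symmetric])
qed

lemma tuples_t_le:
  assumes "1 \<le> d" "d \<le> N" "d ^ n \<le> N" "n \<le> N" "4 \<le> K"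
  shows "steps (tuples_t d n) \<le> N ^ K"
proof -
  have "steps (tuples_t d n) \<le> Suc n * N ^ 2"
    using tuples_t_le_aux assms by blast
  also have "\<dots> \<le> Suc N * N ^ 2" using assms by (intro mult_le_mono1) simp
  also have "\<dots> \<le> 15 * N ^ 3 + 1"
  proof -
    have "N ^ 3 = N * N ^ 2" "N ^ 2 \<le> N ^ 3"
      using power_increasing[of 2 3 N] N_ge by (auto simp: power_numeral_reduce)
    then show ?thesis unfolding mult_Suc by linarith
  qed
  finally show ?thesis using assms(5) by (intro absorb[of _ 3]) auto
qed

end


section \<open>Correctness of the reduction to components\<close>

lemma result_lookup_t [simp]:
  "result (lookup_t \<rho> x) = (case map_of \<rho> x of None \<Rightarrow> undefined | Some a \<Rightarrow> a)"
  by (induction \<rho>) auto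

lemma result_tuple_index_t [simp]: "result (tuple_index_t d 0 as) = tuple_index d as"
proof -
  have "result (tuple_index_t d i as) = foldl (\<lambda>i a. i * d + a) i as" for i
    by (induction as arbitrary: i) simp_all
  from this[of 0] show ?thesis by (simp add: tuple_index_def)
qed

lemma result_assigned_t [simp]: "result (assigned_t \<rho> x) \<longleftrightarrow> x \<in> fst ` set \<rho>"
  by (force simp: assigned_t_def)

lemma result_any_symbol_t [simp]: "result (any_symbol_t p d) \<longleftrightarrow> (\<exists>a<d. result (p a))"
  by (induction d) (auto simp: less_Suc_eq)

text \<open>Values are put in front of the association list one by one, so the complete assignment
  is a reversed zip, and \<open>map_of\<close> returns the value given last.\<close>

lemma result_any_assign_t:
  "result (any_assign_t d p xs \<rho>) \<longleftrightarrow>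
     (\<exists>vs. length vs = length xs \<and> set vs \<subseteq> {..<d} \<and> result (p (rev (zip xs vs) @ \<rho>)))"
proof (induction xs arbitrary: \<rho>)
  case (Cons x xs)
  show ?case
  proof
    assume "result (any_assign_t d p (x # xs) \<rho>)"
    then obtain a vs where "a < d" "length vs = length xs" "set vs \<subseteq> {..<d}"
      "result (p (rev (zip xs vs) @ (x, a) # \<rho>))" by (auto simp: Cons.IH)
    then show "\<exists>vs. length vs = length (x # xs) \<and> set vs \<subseteq> {..<d} \<and>
        result (p (rev (zip (x # xs) vs) @ \<rho>))"
      by (intro exI[of _ "a # vs"]) auto
  next
    assume "\<exists>vs. length vs = length (x # xs) \<and> set vs \<subseteq> {..<d} \<and>
        result (p (rev (zip (x # xs) vs) @ \<rho>))"
    then obtain vs where vs: "length vs = length (x # xs)" "set vs \<subseteq> {..<d}"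
      "result (p (rev (zip (x # xs) vs) @ \<rho>))" by blast
    then obtain a vs' where "vs = a # vs'" by (cases vs) auto
    then show "result (any_assign_t d p (x # xs) \<rho>)"
      using vs by (auto simp: Cons.IH)
  qed
qed simp

lemma map_of_rev_zip:
  assumes "length vs = length xs" "x \<in> set xs"
  obtains a where "map_of (rev (zip xs vs)) x = Some a" "a \<in> set vs"
proof -
  have "x \<in> fst ` set (rev (zip xs vs))"
    using assms by (auto simp: set_zip in_set_conv_nth image_iff)
  then obtain a where "map_of (rev (zip xs vs)) x = Some a"
    by (metis map_of_eq_None_iff not_None_eq)
  moreover from this have "a \<in> set vs" by (auto dest!: map_of_SomeD set_zip_rightD)
  ultimately show ?thesis by (rule that)
qed

lemma map_of_rev_zip_map:
  assumes "x \<in> set xs"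
  shows "map_of (rev (zip xs (map \<sigma> xs))) x = Some (\<sigma> x)"
proof -
  obtain a where a: "map_of (rev (zip xs (map \<sigma> xs))) x = Some a"
    by (rule map_of_rev_zip[OF length_map assms])
  then have "(x, a) \<in> set (zip xs (map \<sigma> xs))" by (auto dest!: map_of_SomeD)
  then have "a = \<sigma> x" by (auto simp: set_zip)
  with a show ?thesis by simp
qed

text \<open>This is the part of \<open>is_csp\<close> that restrictions and components inherit.
  Distinctness of the constraints is not inherited, because two constraints can become equal once
  some of their variables are fixed.\<close>

definition wf_constr :: "nat \<Rightarrow> nat set \<Rightarrow> constr \<Rightarrow> bool" where
  "wf_constr d X c \<longleftrightarrow> set (scope c) \<subseteq> X \<and> length (table c) = d ^ length (scope c)"

lemma tuple_index_Cons: "tuple_index d (a # as) = a * d ^ length as + tuple_index d as"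
proof -
  have "foldl (\<lambda>i a. i * d + a) i as = i * d ^ length as + foldl (\<lambda>i a. i * d + a) 0 as" for i
  proof (induction as arbitrary: i)
    case (Cons b as)
    show ?case using Cons[of "i * d + b"] Cons[of b] by (simp add: algebra_simps)
  qed simp
  from this[of a] show ?thesis by (simp add: tuple_index_def)
qed

lemma tuple_index_less: "set as \<subseteq> {..<d} \<Longrightarrow> tuple_index d as < d ^ length as"
proof (induction as)
  case (Cons a as)
  then have "tuple_index d as < d ^ length as" "Suc a \<le> d" by auto
  then have "tuple_index d (a # as) < Suc a * d ^ length as" by (simp add: tuple_index_Cons)
  also have "\<dots> \<le> d * d ^ length as" using \<open>Suc a \<le> d\<close> by (rule mult_le_mono1)
  finally show ?case by simp
qed (simp add: tuple_index_def)

lemma length_concat_Cons: "length (concat (map (\<lambda>a. map ((#) a) T) as)) = length as * length T"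
  by (induction as) auto

lemma nth_concat_Cons:
  assumes "i < length T" "j < length as"
  shows "concat (map (\<lambda>a. map ((#) a) T) as) ! (j * length T + i) = as ! j # T ! i"
  using assms(2)
proof (induction as arbitrary: j)
  case (Cons a as)
  show ?case
    by (cases j) (use Cons assms(1) in \<open>auto simp: nth_append add.assoc\<close>)
qed simp

text \<open>The enumeration lists the tuples in the order of their numerals in base d. Hence a list
  obtained by mapping a function over it is a truth table in the sense of
  \<open>satisfies\<close>.\<close>

lemma result_tuples_t:
  "length (result (tuples_t d n)) = d ^ n"
  "length t = n \<Longrightarrow> set t \<subseteq> {..<d} \<Longrightarrow> result (tuples_t d n) ! tuple_index d t = t"
proof (induction n arbitrary: t)
  case 0
  { case 1 show ?case by simp }
  { case 2 then show ?case by (simp add: tuple_index_def) }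
next
  case (Suc n)
  { case 1 show ?case using Suc(1) by (simp add: length_concat_Cons) }
  { case 2
    then obtain a u where t: "t = a # u" by (cases t) auto
    with 2 have u: "length u = n" "set u \<subseteq> {..<d}" "a < d" by auto
    then have "tuple_index d u < d ^ n" using tuple_index_less by blast
    then show ?case
      using u Suc(1) Suc(2)[of u] nth_concat_Cons[of "tuple_index d u" "result (tuples_t d n)" a "[0..<d]"]
      by (simp add: t tuple_index_Cons) }
qed

lemma result_satisfies_t:
  assumes "length (table c) = d ^ length (scope c)"
    and "\<And>x. x \<in> set (scope c) \<Longrightarrow> map_of \<sigma> x = Some (\<tau> x) \<and> \<tau> x < d"
  shows "result (satisfies_t d \<sigma> c) \<longleftrightarrow> satisfies d \<tau> c"
proof -
  have eq: "map (\<lambda>x. result (lookup_t \<sigma> x)) (scope c) = map \<tau> (scope c)"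
    using assms(2) by simp
  have "tuple_index d (map \<tau> (scope c)) < d ^ length (map \<tau> (scope c))"
    by (rule tuple_index_less) (use assms(2) in auto)
  then show ?thesis
    unfolding satisfies_t_def satisfies_def result_simps result_map_t eq result_tuple_index_t
    using assms(1) by (simp add: result_nth_t)
qed

lemma satisfies_cong:
  "(\<And>x. x \<in> set (scope c) \<Longrightarrow> \<sigma> x = \<tau> x) \<Longrightarrow> satisfies d \<sigma> c \<longleftrightarrow> satisfies d \<tau> c"
  unfolding satisfies_def by (simp cong: map_cong)

lemma result_exhaustive_sat_t:
  assumes "\<And>c. c \<in> set (constrs \<Phi>) \<Longrightarrow> wf_constr (alph \<Phi>) (set (vars \<Phi>)) c"
  shows "result (exhaustive_sat_t \<Phi>) \<longleftrightarrow> satisfiable \<Phi>"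
proof
  assume "result (exhaustive_sat_t \<Phi>)"
  then obtain vs where vs: "length vs = length (vars \<Phi>)" "set vs \<subseteq> {..<alph \<Phi>}"
    and sat: "\<And>c. c \<in> set (constrs \<Phi>) \<Longrightarrow> result (satisfies_t (alph \<Phi>) (rev (zip (vars \<Phi>) vs)) c)"
    by (auto simp: exhaustive_sat_t_def result_any_assign_t)
  define \<sigma> where "\<sigma> x = the (map_of (rev (zip (vars \<Phi>) vs)) x)" for x
  have \<sigma>: "map_of (rev (zip (vars \<Phi>) vs)) x = Some (\<sigma> x) \<and> \<sigma> x < alph \<Phi>" if "x \<in> set (vars \<Phi>)" for x
    using map_of_rev_zip[OF vs(1) that] vs(2) by (metis \<sigma>_def lessThan_iff option.sel subsetD)
  have "satisfies (alph \<Phi>) \<sigma> c" if c: "c \<in> set (constrs \<Phi>)" for c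
    using result_satisfies_t[of c "alph \<Phi>" "rev (zip (vars \<Phi>) vs)" \<sigma>] assms[OF c] \<sigma> sat[OF c]
    by (auto simp: wf_constr_def)
  with \<sigma> show "satisfiable \<Phi>" by (auto simp: satisfiable_def)
next
  assume "satisfiable \<Phi>"
  then obtain \<sigma> where \<sigma>: "\<And>x. x \<in> set (vars \<Phi>) \<Longrightarrow> \<sigma> x < alph \<Phi>"
    and sat: "\<And>c. c \<in> set (constrs \<Phi>) \<Longrightarrow> satisfies (alph \<Phi>) \<sigma> c"
    by (auto simp: satisfiable_def)
  have "result (satisfies_t (alph \<Phi>) (rev (zip (vars \<Phi>) (map \<sigma> (vars \<Phi>)))) c)"
    if c: "c \<in> set (constrs \<Phi>)" for c
    using result_satisfies_t[of c "alph \<Phi>" "rev (zip (vars \<Phi>) (map \<sigma> (vars \<Phi>)))" \<sigma>] assms[OF c] \<sigma> sat[OF c]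
    by (force simp: wf_constr_def map_of_rev_zip_map)
  then show "result (exhaustive_sat_t \<Phi>)"
    using \<sigma> by (auto simp: exhaustive_sat_t_def result_any_assign_t intro!: exI[of _ "map \<sigma> (vars \<Phi>)"])
qed

section \<open>Restriction by a partial assignment\<close>

definition override :: "passign \<Rightarrow> (nat \<Rightarrow> nat) \<Rightarrow> nat \<Rightarrow> nat" where
  "override \<rho> \<tau> x = (case map_of \<rho> x of None \<Rightarrow> \<tau> x | Some a \<Rightarrow> a)"

text \<open>Looking up the values of \<open>\<tau>\<close> on the remaining scope hits, by
  \<open>result_tuples_t\<close>, exactly the entry that was computed from this tuple. That entry is
  the value of \<open>c\<close> under the tuple followed by \<open>\<rho>\<close>, which on the
  scope of \<open>c\<close> is \<open>override \<rho> \<tau>\<close>.\<close>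

lemma restrict_constr_t:
  fixes \<rho> :: passign
  assumes "length (table c) = d ^ length (scope c)"
  defines "c' \<equiv> result (restrict_constr_t d \<rho> c)"
  shows scope_restrict_constr_t: "scope c' = filter (\<lambda>x. x \<notin> fst ` set \<rho>) (scope c)"
    and length_table_restrict_constr_t: "length (table c') = d ^ length (scope c')"
    and satisfies_restrict_constr_t:
      "(\<And>x a. (x, a) \<in> set \<rho> \<Longrightarrow> a < d) \<Longrightarrow> (\<And>x. x \<in> set (scope c') \<Longrightarrow> \<tau> x < d) \<Longrightarrow>
        satisfies d \<tau> c' \<longleftrightarrow> satisfies d (override \<rho> \<tau>) c"
proof -
  define ys where "ys = filter (\<lambda>x. x \<notin> fst ` set \<rho>) (scope c)"
  define T where "T = result (tuples_t d (length ys))"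
  have c': "c' = Constr ys (map (\<lambda>t. result (satisfies_t d (zip ys t @ \<rho>) c)) T)"
    by (simp add: c'_def restrict_constr_t_def ys_def T_def)
  show "scope c' = ys" by (simp add: c')
  show "length (table c') = d ^ length (scope c')" by (simp add: c' T_def result_tuples_t(1))
  assume \<rho>: "\<And>x a. (x, a) \<in> set \<rho> \<Longrightarrow> a < d" and \<tau>: "\<And>x. x \<in> set (scope c') \<Longrightarrow> \<tau> x < d"
  have ys: "set (map \<tau> ys) \<subseteq> {..<d}" using \<tau> by (auto simp: c')
  have less: "tuple_index d (map \<tau> ys) < d ^ length ys"
    using tuple_index_less[OF ys] by simp
  have "map_of (zip ys (map \<tau> ys) @ \<rho>) x = Some (override \<rho> \<tau> x) \<and> override \<rho> \<tau> x < d"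
    if x: "x \<in> set (scope c)" for x
  proof (cases "x \<in> fst ` set \<rho>")
    case True
    then obtain a where a: "map_of \<rho> x = Some a" by (metis map_of_eq_None_iff not_None_eq)
    moreover have "x \<notin> set ys" using True by (simp add: ys_def)
    moreover have "a < d" using \<rho> a by (blast dest: map_of_SomeD)
    ultimately show ?thesis
      by (simp add: override_def map_add_def map_of_zip_map)
  next
    case False
    then have "map_of \<rho> x = None" by (simp add: map_of_eq_None_iff)
    moreover have "x \<in> set ys" using False x by (simp add: ys_def)
    then have "map_of (zip ys (map \<tau> ys)) x = Some (\<tau> x)" by (simp add: map_of_zip_map)
    ultimately show ?thesis
      using \<tau> \<open>x \<in> set ys\<close> by (auto simp: override_def map_add_def c')
  qed
  then have "result (satisfies_t d (zip ys (map \<tau> ys) @ \<rho>) c) \<longleftrightarrow> satisfies d (override \<rho> \<tau>) c"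
    by (rule result_satisfies_t[OF assms(1)])
  then show "satisfies d \<tau> c' \<longleftrightarrow> satisfies d (override \<rho> \<tau>) c"
    using less result_tuples_t(2)[OF _ ys] by (simp add: satisfies_def c' T_def result_tuples_t(1))
qed

lemma result_restrict_t:
  "result (restrict_t \<Psi> \<rho>) = CSP (filter (\<lambda>x. x \<notin> fst ` set \<rho>) (vars \<Psi>)) (alph \<Psi>)
     (map (\<lambda>c. result (restrict_constr_t (alph \<Psi>) \<rho> c)) (constrs \<Psi>))"
  by (simp add: restrict_t_def)

lemma wf_restrict_t:
  assumes "\<And>c. c \<in> set (constrs \<Psi>) \<Longrightarrow> wf_constr (alph \<Psi>) (set (vars \<Psi>)) c"
    and "c \<in> set (constrs (result (restrict_t \<Psi> \<rho>)))"
  shows "wf_constr (alph \<Psi>) (set (vars (result (restrict_t \<Psi> \<rho>)))) c"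
proof -
  obtain b where b: "b \<in> set (constrs \<Psi>)" "c = result (restrict_constr_t (alph \<Psi>) \<rho> b)"
    using assms(2) unfolding result_restrict_t csp.sel set_map by blast
  have "wf_constr (alph \<Psi>) (set (vars \<Psi>)) b" using b(1) by (rule assms(1))
  then have "set (scope b) \<subseteq> set (vars \<Psi>)" "scope c = filter (\<lambda>x. x \<notin> fst ` set \<rho>) (scope b)"
    "length (table c) = alph \<Psi> ^ length (scope c)"
    unfolding wf_constr_def b(2)
    by (simp_all only: scope_restrict_constr_t length_table_restrict_constr_t)
  then show ?thesis
    unfolding result_restrict_t wf_constr_def csp.sel set_filter by auto
qed

section \<open>Decomposition into connected components\<close>

definition component_csp :: "csp \<Rightarrow> nat list \<Rightarrow> csp" where
  "component_csp \<Phi> B =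
     CSP (map fst (filter (\<lambda>(x, e). set e \<inter> set B \<noteq> {}) (edges (result (hypergraph_of \<Phi>)))))
       (alph \<Phi>) (map ((!) (constrs \<Phi>)) B)"

definition blocks :: "csp \<Rightarrow> nat list list" where
  "blocks \<Phi> = (let H = result (hypergraph_of \<Phi>) in result (components_t (verts H) (edges H)))"

lemma block_partition_blocks:
  "block_partition [0..<length (constrs \<Phi>)] (edges (result (hypergraph_of \<Phi>))) (blocks \<Phi>)"
proof -
  have "block_partition (verts H) (edges H) (result (components_t (verts H) (edges H)))"
    if "H = result (hypergraph_of \<Phi>)" for H
  proof (rule block_partition_components_t)
    fix x e assume "(x, e) \<in> set (edges H)"
    then show "set e \<subseteq> set (verts H)" unfolding that result_hypergraph_of hypergraph.sel
     by auto
  qed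
  moreover have "verts (result (hypergraph_of \<Phi>)) = [0..<length (constrs \<Phi>)]"
    by (simp add: result_hypergraph_of)
  ultimately show ?thesis unfolding blocks_def Let_def by metis
qed

lemma blocks_cover: "(\<Union>B\<in>set (blocks \<Phi>). set B) = {..<length (constrs \<Phi>)}"
proof -
  have "(\<Union>B\<in>set (blocks \<Phi>). set B) = set [0..<length (constrs \<Phi>)]"
    using block_partition_blocks[of \<Phi>] unfolding block_partition_def by (rule conjunct1)
  then show ?thesis by (simp add: atLeast0LessThan)
qed

lemma blocks_bound: "B \<in> set (blocks \<Phi>) \<Longrightarrow> i \<in> set B \<Longrightarrow> i < length (constrs \<Phi>)"
  using blocks_cover[of \<Phi>] by blast

lemma result_split_t: "result (split_t \<Phi>) = map (component_csp \<Phi>) (blocks \<Phi>)"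
proof -
  define E where "E = edges (result (hypergraph_of \<Phi>))"
  have "result (split_t \<Phi>) = map (\<lambda>B. CSP (map fst (filter (\<lambda>(x, e). set e \<inter> set B \<noteq> {}) E))
      (alph \<Phi>) (map (\<lambda>i. result (nth_t (constrs \<Phi>) i)) B)) (blocks \<Phi>)"
    by (simp add: split_t_def blocks_def Let_def incident_t_def case_prod_unfold E_def)
  also have "\<dots> = map (component_csp \<Phi>) (blocks \<Phi>)"
    by (rule map_cong) (auto simp: component_csp_def E_def intro!: result_nth_t blocks_bound)
  finally show ?thesis .
qed

lemma edge_hypergraph_of:
  "(x, e) \<in> set (edges (result (hypergraph_of \<Phi>))) \<longleftrightarrow>
     x \<in> set (vars \<Phi>) \<and> e = filter (\<lambda>i. x \<in> set (scope (constrs \<Phi> ! i))) [0..<length (constrs \<Phi>)]"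
  by (auto simp: result_hypergraph_of)

lemma alph_component_csp [simp]: "alph (component_csp \<Phi> B) = alph \<Phi>"
  by (simp add: component_csp_def)

lemma vars_component_csp:
  "set (vars (component_csp \<Phi> B)) =
     {x \<in> set (vars \<Phi>). \<exists>i\<in>set B. i < length (constrs \<Phi>) \<and> x \<in> set (scope (constrs \<Phi> ! i))}"
  by (auto simp: component_csp_def result_hypergraph_of filter_map o_def)

lemma wf_component_csp:
  assumes "\<And>c. c \<in> set (constrs \<Phi>) \<Longrightarrow> wf_constr (alph \<Phi>) (set (vars \<Phi>)) c"
    and "B \<in> set (blocks \<Phi>)" and "c \<in> set (constrs (component_csp \<Phi> B))"
  shows "wf_constr (alph \<Phi>) (set (vars (component_csp \<Phi> B))) c"
proof -
  obtain i where i: "i \<in> set B" "c = constrs \<Phi> ! i"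
    using assms(3) by (auto simp: component_csp_def)
  then have less: "i < length (constrs \<Phi>)" using blocks_bound assms(2) by blast
  then have "wf_constr (alph \<Phi>) (set (vars \<Phi>)) c" using i assms(1) by simp
  then show ?thesis using i less unfolding wf_constr_def vars_component_csp by blast
qed

text \<open>Different components share no variable, so satisfying assignments of the components can
  be glued together. Each constraint sits in some block and its whole scope takes its values from
  the assignment of that block.\<close>

lemma satisfiable_iff_components:
  assumes wf: "\<And>c. c \<in> set (constrs \<Phi>) \<Longrightarrow> wf_constr (alph \<Phi>) (set (vars \<Phi>)) c"
    and "alph \<Phi> \<ge> 1"
  shows "satisfiable \<Phi> \<longleftrightarrow> (\<forall>B\<in>set (blocks \<Phi>). satisfiable (component_csp \<Phi> B))"
proof
  assume "satisfiable \<Phi>"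
  then obtain \<sigma> where "\<And>x. x \<in> set (vars \<Phi>) \<Longrightarrow> \<sigma> x < alph \<Phi>"
    and "\<And>c. c \<in> set (constrs \<Phi>) \<Longrightarrow> satisfies (alph \<Phi>) \<sigma> c"
    by (auto simp: satisfiable_def)
  note \<sigma> = this
  show "\<forall>B\<in>set (blocks \<Phi>). satisfiable (component_csp \<Phi> B)"
  proof
    fix B assume B: "B \<in> set (blocks \<Phi>)"
    have "c \<in> set (constrs \<Phi>)" if "c \<in> set (constrs (component_csp \<Phi> B))" for c
      using that blocks_bound[OF B] by (auto simp: component_csp_def)
    then show "satisfiable (component_csp \<Phi> B)"
      unfolding satisfiable_def alph_component_csp vars_component_csp using \<sigma> by blast
  qed
next
  define e where "e x = {i. i < length (constrs \<Phi>) \<and> x \<in> set (scope (constrs \<Phi> ! i))}" for x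
  assume "\<forall>B\<in>set (blocks \<Phi>). satisfiable (component_csp \<Phi> B)"
  then have "\<forall>B\<in>set (blocks \<Phi>). \<exists>\<tau>. (\<forall>x\<in>set (vars (component_csp \<Phi> B)). \<tau> x < alph \<Phi>) \<and>
      (\<forall>c\<in>set (constrs (component_csp \<Phi> B)). satisfies (alph \<Phi>) \<tau> c)"
    by (simp add: satisfiable_def)
  from bchoice[OF this] obtain \<sigma> where
    \<sigma>: "\<And>B x. B \<in> set (blocks \<Phi>) \<Longrightarrow> x \<in> set (vars (component_csp \<Phi> B)) \<Longrightarrow> \<sigma> B x < alph \<Phi>" and
    sat: "\<And>B c. B \<in> set (blocks \<Phi>) \<Longrightarrow> c \<in> set (constrs (component_csp \<Phi> B)) \<Longrightarrow>
      satisfies (alph \<Phi>) (\<sigma> B) c"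
    by blast
  note P = block_partition_blocks[of \<Phi>]
  \<comment> \<open>An edge that meets a block lies inside it, and distinct blocks are disjoint; so
    a nonempty edge meets only one block.\<close>
  have unique: "B = C"
    if x: "x \<in> set (vars \<Phi>)" and B: "B \<in> set (blocks \<Phi>)" "e x \<inter> set B \<noteq> {}"
      and C: "C \<in> set (blocks \<Phi>)" "e x \<inter> set C \<noteq> {}" for x B C
  proof -
    define f where "f = filter (\<lambda>i. x \<in> set (scope (constrs \<Phi> ! i))) [0..<length (constrs \<Phi>)]"
    have f: "(x, f) \<in> set (edges (result (hypergraph_of \<Phi>)))" "set f = e x"
      using x by (auto simp: edge_hypergraph_of f_def e_def)
    then have "e x \<subseteq> set B" "e x \<subseteq> set C"
      using P B C unfolding block_partition_def by blast+
    then have "set B \<inter> set C \<noteq> {}" using B by blast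
    then show ?thesis using P B(1) C(1) unfolding block_partition_def by blast
  qed
  \<comment> \<open>The default 0 is used for variables that occur in no constraint. It is a legal
    symbol because the alphabet is nonempty.\<close>
  define \<tau> where "\<tau> x = (if \<exists>B\<in>set (blocks \<Phi>). e x \<inter> set B \<noteq> {}
     then \<sigma> (SOME B. B \<in> set (blocks \<Phi>) \<and> e x \<inter> set B \<noteq> {}) x else 0)" for x
  have \<tau>_eq: "\<tau> x = \<sigma> B x"
    if "x \<in> set (vars \<Phi>)" "B \<in> set (blocks \<Phi>)" "e x \<inter> set B \<noteq> {}" for x B
  proof -
    have "(SOME B. B \<in> set (blocks \<Phi>) \<and> e x \<inter> set B \<noteq> {}) = B"
      by (rule some_equality) (use that unique in blast)+
    then show ?thesis using that by (auto simp: \<tau>_def)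
  qed
  have "\<tau> x < alph \<Phi>" if x: "x \<in> set (vars \<Phi>)" for x
  proof (cases "\<exists>B\<in>set (blocks \<Phi>). e x \<inter> set B \<noteq> {}")
    case True
    then obtain B where B: "B \<in> set (blocks \<Phi>)" "e x \<inter> set B \<noteq> {}" by blast
    then have "x \<in> set (vars (component_csp \<Phi> B))" using x by (auto simp: vars_component_csp e_def)
    then show ?thesis using \<sigma> B \<tau>_eq[OF x B] by simp
  next
    case False
    then show ?thesis using \<open>alph \<Phi> \<ge> 1\<close> by (simp add: \<tau>_def)
  qed
  moreover have "satisfies (alph \<Phi>) \<tau> c" if c: "c \<in> set (constrs \<Phi>)" for c
  proof -
    obtain i where i: "i < length (constrs \<Phi>)" "c = constrs \<Phi> ! i"
      using c by (metis in_set_conv_nth)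
    then obtain B where B: "B \<in> set (blocks \<Phi>)" "i \<in> set B"
      using blocks_cover[of \<Phi>] by blast
    then have "c \<in> set (constrs (component_csp \<Phi> B))" using i by (simp add: component_csp_def)
    moreover have "\<tau> x = \<sigma> B x" if "x \<in> set (scope c)" for x
      by (rule \<tau>_eq) (use that B i wf[OF c] in \<open>auto simp: wf_constr_def e_def\<close>)
    ultimately show ?thesis using sat[OF B(1)] satisfies_cong[of c \<tau> "\<sigma> B"] by blast
  qed
  ultimately show "satisfiable \<Phi>" by (auto simp: satisfiable_def)
qed

text \<open>Trying all assignments to \<open>R\<close> and deciding the components separately loses
  nothing, whatever set of variables \<open>R\<close> is. Balance affects only the running time, so
  this one lemma gives the correctness of both versions of the algorithm.\<close>

lemma result_solve_t:
  assumes wf: "\<And>c. c \<in> set (constrs \<Psi>) \<Longrightarrow> wf_constr (alph \<Psi>) (set (vars \<Psi>)) c"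
    and "alph \<Psi> \<ge> 1" and R: "set R \<subseteq> set (vars \<Psi>)"
  shows "result (solve_t \<Psi> R) \<longleftrightarrow> satisfiable \<Psi>"
proof -
  have check: "(\<forall>\<Phi>'\<in>set (result (split_t (result (restrict_t \<Psi> \<rho>)))). result (exhaustive_sat_t \<Phi>'))
      \<longleftrightarrow> satisfiable (result (restrict_t \<Psi> \<rho>))" for \<rho>
  proof -
    define \<Phi> where "\<Phi> = result (restrict_t \<Psi> \<rho>)"
    have alph: "alph \<Phi> = alph \<Psi>" by (simp add: \<Phi>_def result_restrict_t)
    have wf': "wf_constr (alph \<Phi>) (set (vars \<Phi>)) c" if "c \<in> set (constrs \<Phi>)" for c
      using wf_restrict_t[OF wf] that unfolding alph unfolding \<Phi>_def by blast
    have "result (exhaustive_sat_t (component_csp \<Phi> B)) \<longleftrightarrow> satisfiable (component_csp \<Phi> B)"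
      if "B \<in> set (blocks \<Phi>)" for B
      using wf_component_csp[OF wf' that]
      by (intro result_exhaustive_sat_t) (auto simp: component_csp_def)
    then show ?thesis
      using satisfiable_iff_components[OF wf'] alph \<open>alph \<Psi> \<ge> 1\<close>
      by (simp add: result_split_t \<Phi>_def)
  qed
  have solve: "result (solve_t \<Psi> R) \<longleftrightarrow> (\<exists>vs. length vs = length R \<and> set vs \<subseteq> {..<alph \<Psi>} \<and>
      satisfiable (result (restrict_t \<Psi> (rev (zip R vs)))))"
    by (simp add: solve_t_def result_any_assign_t check)
  have sat: "satisfiable (result (restrict_t \<Psi> \<rho>)) \<longleftrightarrow>
      (\<exists>\<tau>. (\<forall>x\<in>set (vars \<Psi>) - set R. \<tau> x < alph \<Psi>) \<and>
        (\<forall>c\<in>set (constrs \<Psi>). satisfies (alph \<Psi>) (override \<rho> \<tau>) c))"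
    if \<rho>: "\<rho> = rev (zip R vs)" and vs: "length vs = length R" "set vs \<subseteq> {..<alph \<Psi>}" for \<rho> vs
  proof -
    have fst: "fst ` set \<rho> = set R"
      using vs by (metis \<rho> map_fst_zip set_map set_rev)
    have bound: "(x, a) \<in> set \<rho> \<Longrightarrow> a < alph \<Psi>" for x a
      using vs by (auto simp: \<rho> dest: set_zip_rightD)
    have "satisfies (alph \<Psi>) \<tau> (result (restrict_constr_t (alph \<Psi>) \<rho> c))
        \<longleftrightarrow> satisfies (alph \<Psi>) (override \<rho> \<tau>) c"
      if "\<forall>x\<in>set (vars \<Psi>) - set R. \<tau> x < alph \<Psi>" "c \<in> set (constrs \<Psi>)" for \<tau> c
    proof (rule satisfies_restrict_constr_t)
      show "length (table c) = alph \<Psi> ^ length (scope c)" using wf that by (simp add: wf_constr_def)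
      then show "\<tau> x < alph \<Psi>" if "x \<in> set (scope (result (restrict_constr_t (alph \<Psi>) \<rho> c)))" for x
        using that \<open>\<forall>x\<in>set (vars \<Psi>) - set R. \<tau> x < alph \<Psi>\<close> wf[OF \<open>c \<in> _\<close>] fst
        by (auto simp: scope_restrict_constr_t wf_constr_def)
    qed (use bound in auto)
    then show ?thesis
      by (auto simp: satisfiable_def result_restrict_t fst)
  qed
  show ?thesis
  proof
    assume "result (solve_t \<Psi> R)"
    then obtain vs where vs: "length vs = length R" "set vs \<subseteq> {..<alph \<Psi>}"
      and s: "satisfiable (result (restrict_t \<Psi> (rev (zip R vs))))"
      unfolding solve by blast
    define \<rho> where "\<rho> = rev (zip R vs)"
    obtain \<tau> where \<tau>: "\<And>x. x \<in> set (vars \<Psi>) - set R \<Longrightarrow> \<tau> x < alph \<Psi>"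
      "\<And>c. c \<in> set (constrs \<Psi>) \<Longrightarrow> satisfies (alph \<Psi>) (override \<rho> \<tau>) c"
      using s sat[OF \<rho>_def vs] by (auto simp: \<rho>_def)
    have "override \<rho> \<tau> x < alph \<Psi>" if x: "x \<in> set (vars \<Psi>)" for x
    proof (cases "x \<in> set R")
      case True
      then obtain a where "map_of \<rho> x = Some a" "a \<in> set vs"
        unfolding \<rho>_def by (rule map_of_rev_zip[OF vs(1)])
      then show ?thesis using vs(2) by (auto simp: override_def)
    next
      case False
      then have "map_of \<rho> x = None" by (auto simp: \<rho>_def map_of_eq_None_iff dest: set_zip_leftD)
      then show ?thesis using \<tau> x False by (simp add: override_def)
    qed
    then show "satisfiable \<Psi>" using \<tau>(2) by (auto simp: satisfiable_def)
  next
    assume "satisfiable \<Psi>"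
    then obtain \<sigma> where \<sigma>: "\<And>x. x \<in> set (vars \<Psi>) \<Longrightarrow> \<sigma> x < alph \<Psi>"
      "\<And>c. c \<in> set (constrs \<Psi>) \<Longrightarrow> satisfies (alph \<Psi>) \<sigma> c"
      by (auto simp: satisfiable_def)
    define \<rho> where "\<rho> = rev (zip R (map \<sigma> R))"
    have vs: "length (map \<sigma> R) = length R" "set (map \<sigma> R) \<subseteq> {..<alph \<Psi>}"
      using \<sigma> R by auto
    have "override \<rho> \<sigma> x = \<sigma> x" for x
    proof (cases "x \<in> set R")
      case True
      then show ?thesis by (simp add: override_def \<rho>_def map_of_rev_zip_map)
    next
      case False
      then have "map_of \<rho> x = None" by (auto simp: \<rho>_def map_of_eq_None_iff dest: set_zip_leftD)
      then show ?thesis by (simp add: override_def)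
    qed
    then have "override \<rho> \<sigma> = \<sigma>" by auto
    then have "satisfiable (result (restrict_t \<Psi> \<rho>))"
      unfolding sat[OF \<rho>_def vs] using \<sigma> by (intro exI[of _ \<sigma>]) auto
    then show "result (solve_t \<Psi> R)" unfolding solve \<rho>_def using vs by blast
  qed
qed


section \<open>The cost of solving a CSP with a given separator\<close>

text \<open>The sum of scope length and number of variables appears because restricting a constraint
  looks up values in a tuple for its scope appended to the partial assignment.\<close>

definition size_within :: "nat \<Rightarrow> csp \<Rightarrow> bool" where
  "size_within N \<Psi> \<longleftrightarrow> 2 \<le> alph \<Psi> \<and> alph \<Psi> \<le> N \<and> length (vars \<Psi>) \<le> N \<and> length (constrs \<Psi>) \<le> N \<and>
     (\<forall>c\<in>set (constrs \<Psi>). wf_constr (alph \<Psi>) (set (vars \<Psi>)) c \<and> length (table c) \<le> N \<and>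
        length (scope c) + length (vars \<Psi>) \<le> N)"

text \<open>Restriction keeps every constraint at its position, even if its scope becomes empty. So
  the vertices stay the same and the edges of the remaining variables are unchanged, which
  identifies the components of the restricted CSP with those inspected by
  \<open>balanced_t\<close>.\<close>

lemma edges_restrict_t:
  assumes wf: "\<And>c. c \<in> set (constrs \<Psi>) \<Longrightarrow> wf_constr (alph \<Psi>) (set (vars \<Psi>)) c"
  shows "edges (result (hypergraph_of (result (restrict_t \<Psi> \<rho>)))) =
     filter (\<lambda>(x, e). x \<notin> fst ` set \<rho>) (edges (result (hypergraph_of \<Psi>)))"
proof -
  have "filter (\<lambda>i. x \<in> set (scope (map (\<lambda>c. result (restrict_constr_t (alph \<Psi>) \<rho> c)) (constrs \<Psi>) ! i)))
          [0..<length (constrs \<Psi>)]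
      = filter (\<lambda>i. x \<in> set (scope (constrs \<Psi> ! i))) [0..<length (constrs \<Psi>)]"
    if x: "x \<notin> fst ` set \<rho>" for x
  proof (rule filter_cong)
    fix i assume "i \<in> set [0..<length (constrs \<Psi>)]"
    then have i: "i < length (constrs \<Psi>)" by simp
    then have "length (table (constrs \<Psi> ! i)) = alph \<Psi> ^ length (scope (constrs \<Psi> ! i))"
      using wf by (simp add: wf_constr_def)
    from scope_restrict_constr_t[OF this, of \<rho>]
    show "x \<in> set (scope (map (\<lambda>c. result (restrict_constr_t (alph \<Psi>) \<rho> c)) (constrs \<Psi>) ! i)) \<longleftrightarrow>
        x \<in> set (scope (constrs \<Psi> ! i))"
      using x i by simp
  qed simp
  then show ?thesis
    unfolding result_hypergraph_of result_restrict_t hypergraph.sel csp.sel length_map filter_map o_def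
      case_prod_conv
    by (intro map_cong refl) auto
qed

text \<open>In this form the test is seen to depend on \<open>R\<close> only through
  \<open>set R\<close>, which the completeness proof of the exhaustive search exploits.\<close>

lemma result_balanced_t_iff:
  "result (balanced_t H R) \<longleftrightarrow>
     (let E = filter (\<lambda>(x, e). x \<notin> set R) (edges H) in
       \<forall>B\<in>set (result (components_t (verts H) E)).
         2 * length (filter (\<lambda>(x, e). set e \<inter> set B \<noteq> {}) E) \<le> length (edges H))"
  by (simp add: balanced_t_def incident_t_def case_prod_unfold Let_def)

text \<open>The variables of a component are the labels of the surviving edges that meet its block,
  and these edges are what the balance test counts. This turns balance into the factor d^(m/2) of
  the running time.\<close>

lemma length_vars_component_restrict:
  assumes wf: "\<And>c. c \<in> set (constrs \<Psi>) \<Longrightarrow> wf_constr (alph \<Psi>) (set (vars \<Psi>)) c"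
    and R: "fst ` set \<rho> = set R" and bal: "result (balanced_t (result (hypergraph_of \<Psi>)) R)"
    and \<Phi>: "\<Phi> = result (restrict_t \<Psi> \<rho>)" and B: "B \<in> set (blocks \<Phi>)"
  shows "2 * length (vars (component_csp \<Phi> B)) \<le> length (vars \<Psi>)"
proof -
  define H where "H = result (hypergraph_of \<Psi>)"
  define E where "E = filter (\<lambda>(x, e). x \<notin> set R) (edges H)"
  have E\<Phi>: "edges (result (hypergraph_of \<Phi>)) = E"
    using edges_restrict_t[OF wf, of \<rho>] by (simp add: \<Phi> E_def H_def R)
  have "verts (result (hypergraph_of \<Phi>)) = verts H"
    by (simp add: result_hypergraph_of H_def \<Phi> result_restrict_t)
  then have "B \<in> set (result (components_t (verts H) E))"
    using B by (simp add: blocks_def Let_def E\<Phi>)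
  moreover have "\<forall>B\<in>set (result (components_t (verts H) E)).
         2 * length (filter (\<lambda>(x, e). set e \<inter> set B \<noteq> {}) E) \<le> length (edges H)"
    using bal unfolding result_balanced_t_iff Let_def H_def[symmetric] E_def[symmetric] .
  ultimately have "2 * length (filter (\<lambda>(x, e). set e \<inter> set B \<noteq> {}) E) \<le> length (edges H)"
    by blast
  moreover have "length (edges H) = length (vars \<Psi>)"
    by (simp add: H_def result_hypergraph_of)
  ultimately show ?thesis by (simp add: component_csp_def E\<Phi>)
qed

context size_bound
begin

text \<open>The factor \<open>D\<close> is the exponential part of a cost, carried along while
  constants are absorbed by N.\<close>

lemma absorb_mult:
  assumes "x \<le> 15 * (N ^ e * D)" "e < E"
  shows "x \<le> N ^ E * D"
proof -
  have "x \<le> 16 * N ^ e * D" using assms(1) by simp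
  also have "\<dots> \<le> N ^ Suc e * D" using N_ge by (intro mult_le_mono1) simp
  also have "\<dots> \<le> N ^ E * D"
    using assms(2) N_ge by (intro mult_le_mono1 power_increasing) auto
  finally show ?thesis .
qed

lemma restrict_constr_t_le:
  assumes d: "1 \<le> d" "d \<le> N" and c: "length (table c) = d ^ length (scope c)" "length (table c) \<le> N"
    and \<rho>: "length (scope c) + length \<rho> \<le> N" and "9 \<le> K"
  shows "steps (restrict_constr_t d \<rho> c) \<le> N ^ K"
proof -
  define ys where "ys = filter (\<lambda>x. x \<notin> fst ` set \<rho>) (scope c)"
  define T where "T = result (tuples_t d (length ys))"
  define row where "row = (\<lambda>t. do { \<tau> \<leftarrow> zip_t ys t; \<sigma> \<leftarrow> append_t \<tau> \<rho>; satisfies_t d \<sigma> c })"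
  have ys: "length ys \<le> length (scope c)" by (simp add: ys_def)
  then have "d ^ length ys \<le> d ^ length (scope c)" using d by (intro power_increasing) auto
  then have dN: "d ^ length ys \<le> N" using c by simp
  have 1: "steps (filter_t (\<lambda>x. not_t (assigned_t \<rho> x)) (scope c)) \<le> N ^ 8"
    by (rule filter_t_le[where e = 3])
      (use \<rho> in \<open>auto intro!: not_t_le[where e = 2] assigned_t_le\<close>)
  have 2: "steps (length_t ys) \<le> N ^ 8"
    by (rule length_t_le) (use ys \<rho> in auto)
  have 3: "steps (tuples_t d (length ys)) \<le> N ^ 8"
    by (rule tuples_t_le) (use d dN ys \<rho> in auto)
  have "steps (row t) \<le> N ^ 6" for t
  proof -
    have "steps (zip_t ys t) \<le> N ^ 5" by (rule zip_t_le) (use ys \<rho> in auto)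
    moreover have "steps (append_t (zip ys t) \<rho>) \<le> N ^ 5"
      by (rule append_t_le) (use ys \<rho> in auto)
    moreover have "steps (satisfies_t d (zip ys t @ \<rho>) c) \<le> N ^ 5"
      by (rule satisfies_t_le) (use ys \<rho> c in auto)
    moreover have "steps (row t) = steps (zip_t ys t) + (steps (append_t (zip ys t) \<rho>)
        + steps (satisfies_t d (zip ys t @ \<rho>) c))"
      by (simp only: row_def steps_simps result_zip_t result_append_t)
    ultimately show ?thesis by (intro absorb[of _ 5]) auto
  qed
  then have 4: "steps (map_t row T) \<le> N ^ 8"
    by (rule map_t_le) (use dN in \<open>auto simp: T_def result_tuples_t\<close>)
  have "steps (restrict_constr_t d \<rho> c) = Suc (steps (filter_t (\<lambda>x. not_t (assigned_t \<rho> x)) (scope c)) +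
     (steps (length_t ys) + (steps (tuples_t d (length ys)) + steps (map_t row T))))"
    by (simp add: restrict_constr_t_def row_def T_def ys_def)
  then show ?thesis using 1 2 3 4 \<open>9 \<le> K\<close> by (intro absorb[of _ 8]) auto
qed

lemma restrict_t_le:
  assumes \<Psi>: "size_within N \<Psi>" and \<rho>: "length \<rho> \<le> length (vars \<Psi>)" and "12 \<le> K"
  shows "steps (restrict_t \<Psi> \<rho>) \<le> N ^ K"
proof -
  have "length \<rho> \<le> N" using \<rho> \<Psi> by (simp add: size_within_def)
  then have 1: "steps (filter_t (\<lambda>x. not_t (assigned_t \<rho> x)) (vars \<Psi>)) \<le> N ^ 11"
    using \<Psi> by (intro filter_t_le[where e = 3] not_t_le[where e = 2] assigned_t_le)
      (auto simp: size_within_def)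
  have "steps (restrict_constr_t (alph \<Psi>) \<rho> c) \<le> N ^ 9" if "c \<in> set (constrs \<Psi>)" for c
    using \<Psi> \<rho> that by (intro restrict_constr_t_le) (force simp: size_within_def wf_constr_def)+
  then have 2: "steps (map_t (restrict_constr_t (alph \<Psi>) \<rho>) (constrs \<Psi>)) \<le> N ^ 11"
    using \<Psi> by (intro map_t_le[where e = 9]) (auto simp: size_within_def)
  show ?thesis
    using 1 2 \<open>12 \<le> K\<close> unfolding restrict_t_def by (intro absorb[of _ 11]) auto
qed

lemma split_t_le:
  assumes "length (constrs \<Phi>) \<le> N" "length (vars \<Phi>) \<le> N"
    and "\<And>c. c \<in> set (constrs \<Phi>) \<Longrightarrow> length (scope c) \<le> N" and "12 \<le> K"
  shows "steps (split_t \<Phi>) \<le> N ^ K"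
proof -
  define H where "H = result (hypergraph_of \<Phi>)"
  define part where "part = (\<lambda>B. do { I \<leftarrow> incident_t (edges H) B; xs \<leftarrow> map_t (\<lambda>(x, e). ret x) I;
       cs \<leftarrow> map_t (\<lambda>i. nth_t (constrs \<Phi>) i) B; ret (CSP xs (alph \<Phi>) cs) })"
  have V: "length (verts H) \<le> N" and E: "length (edges H) \<le> N"
    using assms by (auto simp: H_def result_hypergraph_of)
  have e: "length e \<le> N" if "(x, e) \<in> set (edges H)" for x e
    using that assms(1) unfolding H_def edge_hypergraph_of
    by (auto intro: order_trans[OF length_filter_le])
  have P: "length (blocks \<Phi>) \<le> N" "length (concat (blocks \<Phi>)) \<le> N"
    using length_components_t[of "verts H" "edges H"] V by (auto simp: blocks_def H_def Let_def)
  have 1: "steps (hypergraph_of \<Phi>) \<le> N ^ 11"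
    by (rule hypergraph_of_le) (use assms in auto)
  have 2: "steps (components_t (verts H) (edges H)) \<le> N ^ 11"
    by (rule components_t_le[OF V E e]) auto
  have "steps (part B) \<le> N ^ 7" if B: "B \<in> set (blocks \<Phi>)" for B
  proof -
    define I where "I = result (incident_t (edges H) B)"
    have lB: "length B \<le> N" using length_le_concat[OF B] P by simp
    have "steps (incident_t (edges H) B) \<le> N ^ 6"
      by (rule incident_t_le[OF E e lB]) auto
    moreover have "length I \<le> N"
      using E by (auto simp: I_def incident_t_def intro: order_trans[OF length_filter_le])
    then have "steps (map_t (\<lambda>(x, e). ret x) I) \<le> N ^ 6"
      by (intro map_t_le[where e = 0]) auto
    moreover have "steps (map_t (\<lambda>i. nth_t (constrs \<Phi>) i) B) \<le> N ^ 6"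
      using lB assms(1) by (intro map_t_le[where e = 2] nth_t_le) auto
    moreover have "steps (part B) = steps (incident_t (edges H) B) + (steps (map_t (\<lambda>(x, e). ret x) I)
        + steps (map_t (\<lambda>i. nth_t (constrs \<Phi>) i) B))"
      by (simp add: part_def I_def)
    ultimately show ?thesis by (intro absorb[of _ 6]) auto
  qed
  then have 3: "steps (map_t part (blocks \<Phi>)) \<le> N ^ 11"
    using P by (intro map_t_le[where e = 7]) auto
  have "steps (split_t \<Phi>) = Suc (steps (hypergraph_of \<Phi>) + (steps (components_t (verts H) (edges H))
      + steps (map_t part (blocks \<Phi>))))"
    by (simp add: split_t_def H_def part_def blocks_def Let_def)
  then show ?thesis using 1 2 3 \<open>12 \<le> K\<close> by (intro absorb[of _ 11]) auto
qed

lemma exhaustive_sat_t_le: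
  assumes "2 \<le> alph \<Phi>" "length (constrs \<Phi>) \<le> N" "length (vars \<Phi>) \<le> N"
    and "\<And>c. c \<in> set (constrs \<Phi>) \<Longrightarrow> length (scope c) \<le> N \<and> length (table c) \<le> N"
  shows "steps (exhaustive_sat_t \<Phi>) \<le> N ^ 8 * alph \<Phi> ^ length (vars \<Phi>)"
proof -
  have leaf: "steps (all_t (satisfies_t (alph \<Phi>) \<sigma>) (constrs \<Phi>)) \<le> N ^ 7"
    if "map fst \<sigma> = rev (vars \<Phi>) @ map fst []" for \<sigma> :: passign
  proof -
    have "length \<sigma> = length (vars \<Phi>)" using that by (metis append_Nil2 length_map length_rev list.map(1))
    then show ?thesis
      using assms by (intro all_t_le[where e = 5] satisfies_t_le) auto
  qed
  have "steps (any_assign_t (alph \<Phi>) (\<lambda>\<sigma>. all_t (satisfies_t (alph \<Phi>) \<sigma>) (constrs \<Phi>)) (vars \<Phi>) []) + 4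
      \<le> (N ^ 7 + 5) * alph \<Phi> ^ length (vars \<Phi>)"
    using assms(1) leaf by (rule steps_any_assign_t_le)
  then have "steps (exhaustive_sat_t \<Phi>) \<le> (N ^ 7 + 5) * alph \<Phi> ^ length (vars \<Phi>)"
    unfolding exhaustive_sat_t_def steps_simps by linarith
  also have "\<dots> \<le> N ^ 8 * alph \<Phi> ^ length (vars \<Phi>)"
  proof (rule mult_le_mono1)
    have "5 \<le> N ^ 7" using N_ge self_le_power[of N 7] by linarith
    then show "N ^ 7 + 5 \<le> N ^ 8" by (intro absorb[of _ 7]) auto
  qed
  finally show ?thesis .
qed

lemma solve_t_le:
  assumes \<Psi>: "size_within N \<Psi>" and R: "length R \<le> length (vars \<Psi>)"
    and bal: "result (balanced_t (result (hypergraph_of \<Psi>)) R)"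
  shows "steps (solve_t \<Psi> R) \<le> N ^ 14 * alph \<Psi> ^ (length (vars \<Psi>) div 2 + length R)"
proof -
  define D where "D = alph \<Psi> ^ (length (vars \<Psi>) div 2)"
  have d: "2 \<le> alph \<Psi>" using \<Psi> by (simp add: size_within_def)
  then have D: "1 \<le> D" unfolding D_def by (intro one_le_power) simp
  define leaf where "leaf = (\<lambda>\<rho>. do { \<Phi> \<leftarrow> restrict_t \<Psi> \<rho>; \<Phi>s \<leftarrow> split_t \<Phi>; all_t exhaustive_sat_t \<Phi>s })"
  have leaf: "steps (leaf \<rho>) \<le> N ^ 13 * D" if "map fst \<rho> = rev R @ map fst []" for \<rho> :: passign
  proof -
    define \<Phi> where "\<Phi> = result (restrict_t \<Psi> \<rho>)"
    have l\<rho>: "length \<rho> = length R" using that by (metis append_Nil2 length_map length_rev list.map(1))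
    have fst: "fst ` set \<rho> = set R" using that by (metis append_Nil2 list.map(1) set_map set_rev)
    have wf: "wf_constr (alph \<Psi>) (set (vars \<Psi>)) c" if "c \<in> set (constrs \<Psi>)" for c
      using \<Psi> that by (simp add: size_within_def)
    have \<Phi>: "alph \<Phi> = alph \<Psi>" "length (constrs \<Phi>) = length (constrs \<Psi>)" "length (vars \<Phi>) \<le> N"
      using \<Psi> by (auto simp: \<Phi>_def result_restrict_t size_within_def intro: order_trans[OF length_filter_le])
    have c\<Phi>: "length (scope c) \<le> N \<and> length (table c) \<le> N" if c: "c \<in> set (constrs \<Phi>)" for c
    proof -
      obtain b where b: "b \<in> set (constrs \<Psi>)" "c = result (restrict_constr_t (alph \<Psi>) \<rho> b)"
        using c unfolding \<Phi>_def result_restrict_t csp.sel set_map by blast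
      have tb: "length (table b) = alph \<Psi> ^ length (scope b)" using wf[OF b(1)] by (simp add: wf_constr_def)
      have "length (scope c) \<le> length (scope b)"
        unfolding b(2) scope_restrict_constr_t[OF tb] by simp
      moreover from this have "length (table c) \<le> length (table b)"
        unfolding tb using d length_table_restrict_constr_t[OF tb, of \<rho>]
        by (simp add: b(2))
      moreover have "length (scope b) \<le> N" "length (table b) \<le> N"
        using \<Psi> b(1) by (auto simp: size_within_def)
      ultimately show ?thesis by simp
    qed
    have 1: "steps (restrict_t \<Psi> \<rho>) \<le> N ^ 12"
      by (rule restrict_t_le[OF \<Psi>]) (use l\<rho> R in auto)
    have 2: "steps (split_t \<Phi>) \<le> N ^ 12"
      by (rule split_t_le) (use \<Phi> c\<Phi> \<Psi> in \<open>auto simp: size_within_def\<close>)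
    have lP: "length (blocks \<Phi>) \<le> N" "length (concat (blocks \<Phi>)) \<le> N"
      using length_components_t[of "verts (result (hypergraph_of \<Phi>))" "edges (result (hypergraph_of \<Phi>))"]
        \<Phi>(2) \<Psi> by (auto simp: blocks_def Let_def result_hypergraph_of size_within_def)
    have comp: "steps (exhaustive_sat_t (component_csp \<Phi> B)) \<le> N ^ 8 * D" if B: "B \<in> set (blocks \<Phi>)" for B
    proof -
      have half: "2 * length (vars (component_csp \<Phi> B)) \<le> length (vars \<Psi>)"
        using wf fst bal \<Phi>_def B by (rule length_vars_component_restrict)
      have "length B \<le> N" using length_le_concat[OF B] lP by simp
      then have "steps (exhaustive_sat_t (component_csp \<Phi> B))
          \<le> N ^ 8 * alph (component_csp \<Phi> B) ^ length (vars (component_csp \<Phi> B))"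
        using half d \<Phi> \<Psi> c\<Phi> blocks_bound[OF B]
        by (intro exhaustive_sat_t_le) (auto simp: size_within_def component_csp_def)
      also have "\<dots> \<le> N ^ 8 * D"
        using d half by (auto simp: D_def \<Phi> intro!: mult_le_mono2 power_increasing)
      finally show ?thesis .
    qed
    have "steps (all_t exhaustive_sat_t (map (component_csp \<Phi>) (blocks \<Phi>)))
        \<le> length (map (component_csp \<Phi>) (blocks \<Phi>)) * Suc (N ^ 8 * D) + 1"
      by (rule steps_all_t_le) (auto intro: comp)
    also have "\<dots> \<le> N * Suc (N ^ 8 * D) + 1" using lP by (intro add_le_mono mult_le_mono1) auto
    also have "\<dots> \<le> 3 * (N ^ 9 * D)"
    proof -
      have "N * 1 \<le> N ^ 9 * D" using D N_ge by (intro mult_le_mono self_le_power) auto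
      moreover have "N * (N ^ 8 * D) = N ^ 9 * D" by (simp add: power_numeral_reduce)
      ultimately show ?thesis using N_ge unfolding mult_Suc_right by linarith
    qed
    also have "\<dots> \<le> 3 * (N ^ 12 * D)"
      using N_ge by (intro mult_le_mono mult_le_mono1 power_increasing) auto
    finally have 3: "steps (all_t exhaustive_sat_t (map (component_csp \<Phi>) (blocks \<Phi>))) \<le> 3 * (N ^ 12 * D)" .
    have "N ^ 12 * 1 \<le> N ^ 12 * D" using D by (rule mult_le_mono2)
    moreover have "steps (leaf \<rho>) = steps (restrict_t \<Psi> \<rho>) + (steps (split_t \<Phi>)
        + steps (all_t exhaustive_sat_t (map (component_csp \<Phi>) (blocks \<Phi>))))"
      by (simp only: leaf_def steps_simps \<Phi>_def result_split_t)
    ultimately have "steps (leaf \<rho>) \<le> 15 * (N ^ 12 * D)" using 1 2 3 by linarith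
    then show ?thesis by (rule absorb_mult) simp
  qed
  have "steps (any_assign_t (alph \<Psi>) leaf R []) + 4 \<le> (N ^ 13 * D + 5) * alph \<Psi> ^ length R"
    using d leaf by (rule steps_any_assign_t_le)
  then have "steps (solve_t \<Psi> R) + 3 \<le> (N ^ 13 * D + 5) * alph \<Psi> ^ length R"
    unfolding solve_t_def leaf_def steps_simps by linarith
  also have "\<dots> \<le> (15 * (N ^ 13 * D)) * alph \<Psi> ^ length R"
  proof (rule mult_le_mono1)
    have "N * 1 \<le> N ^ 13 * D" using D N_ge by (intro mult_le_mono self_le_power) auto
    then show "N ^ 13 * D + 5 \<le> 15 * (N ^ 13 * D)" using N_ge by linarith
  qed
  finally have "steps (solve_t \<Psi> R) \<le> 15 * (N ^ 13 * (D * alph \<Psi> ^ length R))"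
    by (simp add: mult_ac)
  then have "steps (solve_t \<Psi> R) \<le> N ^ 14 * (D * alph \<Psi> ^ length R)" by (rule absorb_mult) simp
  then show ?thesis by (simp add: D_def power_add)
qed

end


section \<open>Search for a separator\<close>

lemma search_t_Some:
  assumes "result (search_t p xs b R) = Some S"
  shows "result (p S)" "set S \<subseteq> set xs \<union> set R" "length S \<le> length R + b" "length S \<le> length R + length xs"
  using assms
proof (atomize (full), induction xs arbitrary: b R)
  case Nil
  then show ?case by (auto split: if_splits)
next
  case (Cons x xs)
  show ?case
  proof (cases "result (search_t p xs b R) = Some S")
    case True
    then show ?thesis using Cons.IH[of b R] by auto
  next
    case False
    then have "b > 0" "result (search_t p xs (b - 1) (x # R)) = Some S"
      using Cons.prems by (auto split: if_splits)
    then show ?thesis using Cons.IH[of "b - 1" "x # R"] by auto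
  qed
qed

text \<open>Deciding for each element whether it belongs to \<open>T\<close> describes a path
  through the recursion that ends with a test of some list whose set is
  \<open>T \<union> set R\<close>. The test is assumed to see only the set, so the order in which
  the list was built is irrelevant.\<close>

lemma search_t_None:
  assumes "result (search_t p xs b R) = None"
    and p: "\<And>S. result (p S) \<longleftrightarrow> Q (set S)"
    and "T \<subseteq> set xs" "card T \<le> b"
  shows "\<not> Q (T \<union> set R)"
  using assms(1,3,4)
proof (induction xs arbitrary: b R T)
  case Nil
  then show ?case using p by (auto split: if_splits)
next
  case (Cons x xs)
  have fin: "finite T" using Cons.prems(2) finite_subset by blast
  show ?case
  proof (cases "x \<in> T")
    case False
    then have "T \<subseteq> set xs" using Cons.prems by auto
    moreover have "result (search_t p xs b R) = None"
      using Cons.prems(1) by (auto split: if_splits)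
    ultimately show ?thesis using Cons by blast
  next
    case True
    then have "b > 0" using Cons.prems(3) fin by (metis card_gt_0_iff empty_iff le_zero_eq not_gr_zero)
    then have "result (search_t p xs (b - 1) (x # R)) = None"
      using Cons.prems(1) by (auto split: if_splits)
    moreover have "T - {x} \<subseteq> set xs" using Cons.prems by auto
    moreover have "card (T - {x}) \<le> b - 1" using True fin Cons.prems(3) by simp
    ultimately have "\<not> Q ((T - {x}) \<union> set (x # R))" by (rule Cons.IH)
    moreover have "(T - {x}) \<union> set (x # R) = T \<union> set R" using True by auto
    ultimately show ?thesis by simp
  qed
qed

text \<open>The search may stop at a set other than the given \<open>R\<close>; later arguments use
  only the balance and size of the set that it returns.\<close>

lemma separator_det_complete:
  assumes "result (balanced_t H R)" "set R \<subseteq> fst ` set (edges H)"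
    and "length R \<le> nat \<lfloor>(1 / 2 - eps r) * real (length (edges H))\<rfloor> + s"
  obtains S where "result (separator_det r s H) = Some S" "result (balanced_t H S)"
    "set S \<subseteq> fst ` set (edges H)" "length S \<le> length (edges H)"
    "length S \<le> nat \<lfloor>(1 / 2 - eps r) * real (length (edges H))\<rfloor> + s"
proof -
  define b where "b = nat \<lfloor>(1 / 2 - eps r) * real (length (edges H))\<rfloor> + s"
  define xs where "xs = map fst (edges H)"
  define Q where "Q T \<longleftrightarrow> (let E = filter (\<lambda>(x, e). x \<notin> T) (edges H) in
       \<forall>B\<in>set (result (components_t (verts H) E)).
         2 * length (filter (\<lambda>(x, e). set e \<inter> set B \<noteq> {}) E) \<le> length (edges H))" for T
  have Q: "result (balanced_t H S) \<longleftrightarrow> Q (set S)" for S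
    unfolding result_balanced_t_iff Q_def ..
  have res: "result (separator_det r s H) = result (search_t (balanced_t H) xs b [])"
    by (simp add: separator_det_def case_prod_unfold b_def xs_def)
  have "card (set R) \<le> b" using assms(3) card_length[of R] unfolding b_def by linarith
  then have "result (search_t (balanced_t H) xs b []) \<noteq> None"
    using search_t_None[of "balanced_t H" xs b "[]" Q "set R", OF _ Q] assms(1,2) Q[of R]
    by (auto simp: xs_def)
  then obtain S where S: "result (search_t (balanced_t H) xs b []) = Some S" by blast
  show ?thesis
    by (rule that[of S]) (use search_t_Some[OF S] S in \<open>auto simp: res xs_def b_def\<close>)
qed

section \<open>Padding of hyperedges and separators obtained from vertex cuts\<close>

definition vertex_degree :: "edge list \<Rightarrow> nat \<Rightarrow> nat" where
  "vertex_degree E v = length (filter (\<lambda>(x, e). v \<in> set e) E)"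

definition pads :: "nat \<Rightarrow> edge list \<Rightarrow> edge list \<Rightarrow> bool" where
  "pads r = list_all2 (\<lambda>(x, e) (x', e'). x' = x \<and> set e \<subseteq> set e' \<and> distinct e' \<and> length e' = r)"

text \<open>Every new vertex is used for a single edge, so new vertices have degree at most 1 and
  old ones keep their degree. Hence padding respects any degree bound k >= 1.\<close>

lemma pad_t:
  assumes "result (pad_t r i E) = (E', j)"
    and "\<forall>(x, e)\<in>set E. distinct e \<and> length e \<le> r \<and> set e \<subseteq> {..<i}"
  shows "i \<le> j" "j \<le> i + r * length E" "pads r E E'"
    "\<And>x e. (x, e) \<in> set E' \<Longrightarrow> set e \<subseteq> {..<j}"
    "\<And>v. v < i \<Longrightarrow> vertex_degree E' v = vertex_degree E v" "\<And>v. i \<le> v \<Longrightarrow> vertex_degree E' v \<le> 1"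
proof -
  have "i \<le> j \<and> j \<le> i + r * length E \<and> pads r E E' \<and> (\<forall>(x, e)\<in>set E'. set e \<subseteq> {..<j}) \<and>
      (\<forall>v<i. vertex_degree E' v = vertex_degree E v) \<and> (\<forall>v\<ge>i. vertex_degree E' v \<le> 1)"
    using assms
  proof (induction E arbitrary: i E')
    case Nil
    then show ?case by (simp add: vertex_degree_def pads_def)
  next
    case (Cons xe E)
    obtain x e where xe: "xe = (x, e)" by (cases xe)
    define i' where "i' = i + (r - length e)"
    obtain E1 where E1: "result (pad_t r i' E) = (E1, j)" and E': "E' = (x, e @ [i..<i']) # E1"
      using Cons.prems(1) by (auto simp: xe i'_def split: prod.splits)
    have e: "distinct e" "length e \<le> r" "set e \<subseteq> {..<i}" using Cons.prems(2) by (auto simp: xe)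
    have old: "\<forall>(y, f)\<in>set E. distinct f \<and> length f \<le> r \<and> set f \<subseteq> {..<i}"
      using Cons.prems(2) by simp
    then have "\<forall>(y, f)\<in>set E. distinct f \<and> length f \<le> r \<and> set f \<subseteq> {..<i'}"
      by (fastforce simp: i'_def)
    from Cons.IH[OF E1 this]
    have IH: "i' \<le> j" "j \<le> i' + r * length E" "pads r E E1" "\<forall>(x, e)\<in>set E1. set e \<subseteq> {..<j}"
      "\<forall>v<i'. vertex_degree E1 v = vertex_degree E v" "\<forall>v\<ge>i'. vertex_degree E1 v \<le> 1"
      by blast+
    have i': "i \<le> i'" "i' \<le> i + r" by (auto simp: i'_def)
    have deg0: "vertex_degree E v = 0" if "i \<le> v" for v
      using old that by (fastforce simp: vertex_degree_def filter_empty_conv)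
    have "\<forall>(x, e)\<in>set E'. set e \<subseteq> {..<j}"
      using IH e i' by (auto simp: E')
    moreover have "\<forall>v<i. vertex_degree E' v = vertex_degree (xe # E) v"
      using IH(5) i' by (auto simp: E' xe vertex_degree_def)
    moreover have "vertex_degree E' v \<le> 1" if "i \<le> v" for v
    proof (cases "v < i'")
      case True
      then have "vertex_degree E1 v = 0" using IH(5) deg0 that by simp
      then show ?thesis by (simp add: E' vertex_degree_def)
    next
      case False
      then have "v \<notin> set (e @ [i..<i'])" using e that by auto
      then show ?thesis using IH(6) False by (simp add: E' vertex_degree_def)
    qed
    moreover have "pads r (xe # E) E'"
      using IH(3) e by (auto simp: pads_def E' xe i'_def)
    ultimately show ?case using IH(1,2) i' by auto
  qed
  then show "i \<le> j" "j \<le> i + r * length E" "pads r E E'"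
    "\<And>x e. (x, e) \<in> set E' \<Longrightarrow> set e \<subseteq> {..<j}"
    "\<And>v. v < i \<Longrightarrow> vertex_degree E' v = vertex_degree E v" "\<And>v. i \<le> v \<Longrightarrow> vertex_degree E' v \<le> 1"
    by auto
qed

lemma padded_t:
  assumes verts: "verts H = [0..<n]"
    and edges: "\<forall>(x, e)\<in>set (edges H). distinct e \<and> length e \<le> r \<and> set e \<subseteq> {..<n}"
    and deg: "\<And>v. v < n \<Longrightarrow> vertex_degree (edges H) v \<le> k" and k: "1 \<le> k"
  defines "H' \<equiv> result (padded_t r H)"
  shows "pads r (edges H) (edges H')" "distinct (verts H')"
    "\<And>x e. (x, e) \<in> set (edges H') \<Longrightarrow> set e \<subseteq> set (verts H')"
    "\<And>v. vertex_degree (edges H') v \<le> k" "length (verts H') \<le> n + r * length (edges H)"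
proof -
  obtain E j where Ej: "result (pad_t r n (edges H)) = (E, j)" by fastforce
  note pad = pad_t[OF Ej edges]
  have H': "H' = Hypergraph (filter (\<lambda>v. \<exists>(x, e)\<in>set E. v \<in> set e) [0..<j]) E"
    by (simp add: H'_def padded_t_def verts Ej case_prod_unfold)
  show "pads r (edges H) (edges H')" using pad by (simp add: H')
  show "distinct (verts H')" by (simp add: H')
  show "set e \<subseteq> set (verts H')" if "(x, e) \<in> set (edges H')" for x e
    using pad(4)[of x e] that by (auto simp: H')
  show "vertex_degree (edges H') v \<le> k" for v
    using pad(5,6)[of v] deg[of v] k by (cases "v < n") (auto simp: H')
  have "length (verts H') \<le> length [0..<j]" unfolding H' hypergraph.sel by (rule length_filter_le)
  then show "length (verts H') \<le> n + r * length (edges H)" using pad(2) by simp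
qed

lemma pads_labels: "pads r E E' \<Longrightarrow> map fst E' = map fst E"
  unfolding pads_def by (induction rule: list_all2_induct) auto

lemma pads_length: "pads r E E' \<Longrightarrow> length E' = length E"
  unfolding pads_def by (auto dest: list_all2_lengthD)

lemma pads_mem: "pads r E E' \<Longrightarrow> (x, e) \<in> set E \<Longrightarrow> \<exists>e'. (x, e') \<in> set E' \<and> set e \<subseteq> set e'"
  unfolding pads_def by (induction rule: list_all2_induct) auto

lemma pads_size: "pads r E E' \<Longrightarrow> (x, e) \<in> set E' \<Longrightarrow> distinct e \<and> length e = r"
  unfolding pads_def by (induction rule: list_all2_induct) auto

definition inside :: "edge list \<Rightarrow> nat set \<Rightarrow> edge list" where
  "inside E S = filter (\<lambda>(x, e). set e \<subseteq> S) E"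

definition outside :: "edge list \<Rightarrow> nat set \<Rightarrow> edge list" where
  "outside E S = filter (\<lambda>(x, e). set e \<inter> S = {}) E"

definition crossing :: "edge list \<Rightarrow> nat set \<Rightarrow> edge list" where
  "crossing E S = filter (\<lambda>(x, e). set e \<inter> S \<noteq> {} \<and> \<not> set e \<subseteq> S) E"

text \<open>Only an empty edge can be inside a set and inside its complement at once. Padded edges
  have r > 0 vertices, so the three classes partition them.\<close>

lemma length_inside_outside_crossing:
  assumes "\<And>x e. (x, e) \<in> set E \<Longrightarrow> e \<noteq> []"
  shows "length (inside E S) + length (outside E S) + length (crossing E S) = length E"
  using assms
proof (induction E)
  case (Cons xe E)
  obtain x e where xe: "xe = (x, e)" by (cases xe)
  have "e \<noteq> []" using Cons.prems[of x e] by (simp add: xe)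
  then have "\<not> (set e \<subseteq> S \<and> set e \<inter> S = {})" by (cases e) auto
  moreover have "length (inside E S) + length (outside E S) + length (crossing E S) = length E"
    by (rule Cons.IH) (use Cons.prems in auto)
  ultimately show ?case by (auto simp: xe inside_def outside_def crossing_def)
qed (simp add: inside_def outside_def crossing_def)

definition good_cut :: "nat \<Rightarrow> nat \<Rightarrow> edge list \<Rightarrow> nat set \<Rightarrow> bool" where
  "good_cut r s E S \<longleftrightarrow> \<bar>real (length (inside E S)) - real (length E) / 2\<bar> \<le> real s \<and>
     real (length (crossing E S)) \<le> (1 / 2 - eps r) * real (length E) + real s"

definition cut_labels :: "edge list \<Rightarrow> nat set \<Rightarrow> nat list" where
  "cut_labels E S = map fst (crossing E S @
     take (length (inside E S) - length E div 2) (inside E S) @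
     take (length (outside E S) - length E div 2) (outside E S))"

lemma result_cut_t:
  "result (cut_t r s E S) = (if good_cut r s E (set S) then Some (cut_labels E (set S)) else None)"
proof -
  have 1: "filter (\<lambda>xe. result (case xe of (x, e) \<Rightarrow> all_t (\<lambda>v. member_t v S) e)) E = inside E (set S)"
    unfolding inside_def by (rule filter_cong) auto
  have 2: "filter (\<lambda>xe. result (case xe of (x, e) \<Rightarrow> all_t (\<lambda>v. not_t (member_t v S)) e)) E
      = outside E (set S)"
    unfolding outside_def by (rule filter_cong) auto
  have 3: "filter (\<lambda>xe. result (case xe of (x, e) \<Rightarrow> do {
            b \<leftarrow> any_t (\<lambda>v. member_t v S) e;
            if b then any_t (\<lambda>v. not_t (member_t v S)) e else ret False })) E = crossing E (set S)"
    unfolding crossing_def by (rule filter_cong) (auto split: if_splits)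
  have "(case xe of (x, e) \<Rightarrow> ret x) = ret (fst xe)" for xe :: edge by (cases xe) simp
  then show ?thesis
    unfolding cut_t_def result_simps result_filter_t result_length_t 1 2 3 good_cut_def
    by (simp add: cut_labels_def)
qed

lemma cut_labels:
  assumes E: "pads r E0 E" and r: "1 \<le> r" and good: "good_cut r s E S"
  shows "set (cut_labels E S) \<subseteq> fst ` set E0"
    "length (cut_labels E S) \<le> length E0"
    "real (length (cut_labels E S)) \<le> (1 / 2 - eps r) * real (length E0) + 2 * real s"
proof -
  have ne: "e \<noteq> []" if "(x, e) \<in> set E" for x e
    using pads_size[OF E that] r by auto
  have lE: "length E = length E0" using E by (rule pads_length)
  define m where "m = length E"
  define a where "a = length (inside E S)"
  define b where "b = length (outside E S)"
  define c where "c = length (crossing E S)"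
  have sum: "a + b + c = m"
    unfolding a_def b_def c_def m_def by (rule length_inside_outside_crossing) (rule ne)
  have len: "length (cut_labels E S) = c + (a - m div 2) + (b - m div 2)"
    by (simp add: cut_labels_def a_def b_def c_def m_def)
  then show "length (cut_labels E S) \<le> length E0" using sum by (simp add: m_def lE)
  have "set (cut_labels E S) \<subseteq> fst ` set E"
    unfolding cut_labels_def set_map
    by (intro image_mono) (auto simp: inside_def outside_def crossing_def dest!: in_set_takeD)
  also have "fst ` set E = fst ` set E0" using pads_labels[OF E] by (metis set_map)
  finally show "set (cut_labels E S) \<subseteq> fst ` set E0" .
  have g: "\<bar>real a - real m / 2\<bar> \<le> real s" "real c \<le> (1 / 2 - eps r) * real m + real s"
    using good by (simp_all add: good_cut_def a_def c_def m_def)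
  have "2 * a \<le> m + 2 * s" "m \<le> 2 * a + 2 * s" using g(1) by linarith+
  \<comment> \<open>As a + b <= m, at most one of a and b exceeds \<open>m div 2\<close>, and the
    tolerance for a bounds the excess of either by s. The completion thus costs a second s in
    addition to the one allowed for the crossing edges, whence \<open>2 * real s\<close>.\<close>
  then have "(a - m div 2) + (b - m div 2) \<le> s"
  proof -
    define h where "h = m div 2"
    have "m = 2 * h \<or> m = 2 * h + 1" unfolding h_def by presburger
    then show ?thesis
      unfolding h_def[symmetric] using sum \<open>2 * a \<le> m + 2 * s\<close> \<open>m \<le> 2 * a + 2 * s\<close>
      by (cases "a \<le> h"; cases "b \<le> h") auto
  qed
  then show "real (length (cut_labels E S)) \<le> (1 / 2 - eps r) * real (length E0) + 2 * real s"
    using g(2) unfolding len by (simp add: lE[symmetric] m_def)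
qed

text \<open>Labels survive padding, so edges of the original hypergraph can be counted through a
  list of padded edges.\<close>

lemma length_filter_labels_le:
  assumes "distinct (map fst E)" "\<And>xe. xe \<in> set E \<Longrightarrow> P xe \<Longrightarrow> fst xe \<in> set (map fst L)"
  shows "length (filter P E) \<le> length L"
proof -
  have "distinct (map fst (filter P E))" using assms(1) by (rule distinct_map_filter)
  then have "length (filter P E) = card (set (map fst (filter P E)))"
    by (metis distinct_card length_map)
  also have "\<dots> \<le> card (set (map fst L))" using assms(2) by (intro card_mono) auto
  also have "\<dots> \<le> length L" using card_length[of "map fst L"] by simp
  finally show ?thesis .
qed

text \<open>A surviving edge is contained in a padded edge that lies on one side of the cut, since
  the labels of crossing edges were removed. So no component changes sides, and the edges at a
  component carry labels left over on its side, of which there are at most \<open>m div 2\<close>.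
  This holds for every \<open>S\<close>; \<open>good_cut\<close> serves to bound the number of
  labels removed.\<close>

lemma balanced_cut_labels:
  assumes E: "pads r (edges H) E" and dist: "distinct (map fst (edges H))"
    and verts: "\<And>x e. (x, e) \<in> set (edges H) \<Longrightarrow> set e \<subseteq> set (verts H)"
  shows "result (balanced_t H (cut_labels E S))"
proof -
  define L where "L = set (cut_labels E S)"
  define m where "m = length E"
  define A where "A = drop (length (inside E S) - m div 2) (inside E S)"
  define B where "B = drop (length (outside E S) - m div 2) (outside E S)"
  have lE: "length (edges H) = m" using pads_length[OF E] by (simp add: m_def)
  have lA: "length A \<le> m div 2" and lB: "length B \<le> m div 2" by (auto simp: A_def B_def)
  define E' where "E' = filter (\<lambda>(x, e). x \<notin> L) (edges H)"
  have lab: "(set e \<subseteq> S \<and> x \<in> set (map fst A)) \<or> (set e \<inter> S = {} \<and> x \<in> set (map fst B))"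
    if "(x, e) \<in> set E'" for x e
  proof -
    have xe: "(x, e) \<in> set (edges H)" "x \<notin> L" using that by (auto simp: E'_def)
    then obtain e' where e': "(x, e') \<in> set E" "set e \<subseteq> set e'" using pads_mem[OF E] by blast
    have x: "x \<notin> set (map fst (crossing E S))"
      "x \<notin> set (map fst (take (length (inside E S) - m div 2) (inside E S)))"
      "x \<notin> set (map fst (take (length (outside E S) - m div 2) (outside E S)))"
      using xe(2) unfolding L_def cut_labels_def m_def by auto
    have "(x, e') \<notin> set (crossing E S)"
    proof
      assume "(x, e') \<in> set (crossing E S)"
      then have "fst (x, e') \<in> set (map fst (crossing E S))" unfolding set_map by (rule imageI)
      then show False using x(1) by simp
    qed
    then consider "set e' \<subseteq> S" | "set e' \<inter> S = {}" using e'(1) by (auto simp: crossing_def)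
    then show ?thesis
    proof cases
      case 1
      then have "(x, e') \<in> set (inside E S)" using e' by (simp add: inside_def)
      then have "fst (x, e') \<in> set (map fst (inside E S))" unfolding set_map by (rule imageI)
      moreover have "map fst (inside E S) = map fst (take (length (inside E S) - m div 2) (inside E S)) @ map fst A"
        unfolding A_def map_append[symmetric] by simp
      ultimately have "x \<in> set (map fst A)" using x(2) by (metis Un_iff fst_conv set_append)
      then show ?thesis using 1 e' by blast
    next
      case 2
      then have "(x, e') \<in> set (outside E S)" using e' by (simp add: outside_def)
      then have "fst (x, e') \<in> set (map fst (outside E S))" unfolding set_map by (rule imageI)
      moreover have "map fst (outside E S) = map fst (take (length (outside E S) - m div 2) (outside E S)) @ map fst B"
        unfolding B_def map_append[symmetric] by simp
      ultimately have "x \<in> set (map fst B)" using x(3) by (metis Un_iff fst_conv set_append)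
      then show ?thesis using 2 e' by blast
    qed
  qed
  \<comment> \<open>A path of surviving edges never crosses the cut.\<close>
  have side: "u \<in> S \<longleftrightarrow> v \<in> S" if "linked E' u v" for u v
    using that unfolding linked_def
  proof (induction rule: rtranclp_induct)
    case (step v w)
    then obtain x e where "(x, e) \<in> set E'" "v \<in> set e" "w \<in> set e" by auto
    then show ?case using lab[of x e] step.IH by blast
  qed simp
  have dist': "distinct (map fst E')" unfolding E'_def using dist by (rule distinct_map_filter)
  have P: "block_partition (verts H) E' (result (components_t (verts H) E'))"
    by (rule block_partition_components_t) (use verts in \<open>auto simp: E'_def\<close>)
  have "2 * length (filter (\<lambda>(x, e). set e \<inter> set C \<noteq> {}) E') \<le> length (edges H)"
    if C: "C \<in> set (result (components_t (verts H) E'))" for C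
  proof -
    have link: "linked E' u v" if "u \<in> set C" "v \<in> set C" for u v
      using P C that unfolding block_partition_def by blast
    have "\<exists>D :: edge list. length D \<le> m div 2 \<and> (\<forall>x e. (x, e) \<in> set E' \<longrightarrow> set e \<inter> set C \<noteq> {} \<longrightarrow> x \<in> set (map fst D))"
    proof (cases "set C \<inter> S = {}")
      case True
      have "x \<in> set (map fst B)" if "(x, e) \<in> set E'" "set e \<inter> set C \<noteq> {}" for x e
        using lab[OF that(1)] that(2) True by blast
      then show ?thesis using lB by (intro exI[of _ B]) blast
    next
      case False
      then have "set C \<subseteq> S" using link side by blast
      then have "x \<in> set (map fst A)" if "(x, e) \<in> set E'" "set e \<inter> set C \<noteq> {}" for x e
        using lab[OF that(1)] that(2) by blast
      then show ?thesis using lA by (intro exI[of _ A]) blast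
    qed
    then obtain D :: "edge list" where D: "length D \<le> m div 2"
      "\<And>x e. (x, e) \<in> set E' \<Longrightarrow> set e \<inter> set C \<noteq> {} \<Longrightarrow> x \<in> set (map fst D)" by blast
    have "length (filter (\<lambda>(x, e). set e \<inter> set C \<noteq> {}) E') \<le> length D"
    proof (rule length_filter_labels_le[OF dist'])
      fix xe assume "xe \<in> set E'" "case xe of (x, e) \<Rightarrow> set e \<inter> set C \<noteq> {}"
      then show "fst xe \<in> set (map fst D)"
        using D(2)[of "fst xe" "snd xe"] by (auto simp: case_prod_unfold)
    qed
    then show ?thesis using D(1) lE by linarith
  qed
  then show ?thesis
    unfolding result_balanced_t_iff Let_def E'_def[unfolded L_def, symmetric] by blast
qed

context size_bound
begin

lemma padded_t_le:
  assumes V: "length (verts H) \<le> N" and E: "length (edges H) \<le> N" and r: "r \<le> N"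
    and e: "\<forall>(x, e)\<in>set (edges H). distinct e \<and> length e \<le> r \<and> set e \<subseteq> {..<length (verts H)}"
    and sum: "length (verts H) + r * length (edges H) \<le> N" and "8 \<le> K"
  shows "steps (padded_t r H) \<le> N ^ K"
proof -
  obtain F j where Fj: "result (pad_t r (length (verts H)) (edges H)) = (F, j)" by fastforce
  note pad = pad_t[OF Fj e]
  have pad_le: "steps (pad_t r i E) \<le> length E * (2 * r + 5) + 1"
    if "\<forall>(x, e)\<in>set E. length e \<le> r" for i E
    using that
  proof (induction E arbitrary: i)
    case (Cons xe E)
    then have "steps (pad_t r (i + (r - length (snd xe))) E) \<le> length E * (2 * r + 5) + 1" by simp
    moreover have "length (snd xe) \<le> r" using Cons.prems by (cases xe) auto
    ultimately show ?case by (simp add: case_prod_unfold)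
  qed simp
  have "steps (pad_t r (length (verts H)) (edges H)) \<le> length (edges H) * (2 * r + 5) + 1"
    by (rule pad_le) (use e in auto)
  also have "\<dots> \<le> N * Suc (N ^ 2) + 1"
  proof (intro add_le_mono mult_le_mono)
    have "16 * N \<le> N * N" using N_ge by (rule mult_le_mono1)
    then show "2 * r + 5 \<le> Suc (N ^ 2)" using r N_ge unfolding power2_eq_square by linarith
  qed (use E in auto)
  finally have 1: "steps (pad_t r (length (verts H)) (edges H)) \<le> N ^ 7"
    by (rule list_le) auto
  have 2: "steps (length_t (verts H)) \<le> N ^ 7" using V by (rule length_t_le) simp
  have j: "j \<le> N" using pad(2) sum by simp
  then have 3: "steps (range_t 0 j) \<le> N ^ 7" by (rule range_t_le) simp
  have lF: "length F \<le> N" using pads_length[OF pad(3)] E by simp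
  have "length f \<le> N" if "(x, f) \<in> set F" for x f using pads_size[OF pad(3) that] r by simp
  then have 4: "steps (filter_t (\<lambda>v. any_t (\<lambda>(x, e). member_t v e) F) [0..<j]) \<le> N ^ 7"
    using j lF by (intro filter_t_le[where e = 4] any_t_le[where e = 2]) (auto intro!: member_t_le)
  have "steps (padded_t r H) = Suc (steps (length_t (verts H)) +
      (steps (pad_t r (length (verts H)) (edges H)) + (steps (range_t 0 j)
       + steps (filter_t (\<lambda>v. any_t (\<lambda>(x, e). member_t v e) F) [0..<j]))))"
    by (simp add: padded_t_def Fj case_prod_unfold)
  then show ?thesis using 1 2 3 4 \<open>8 \<le> K\<close> by (intro absorb[of _ 7]) auto
qed

lemma cut_t_le:
  assumes E: "length E \<le> N" and e: "\<And>x e. (x, e) \<in> set E \<Longrightarrow> e \<noteq> [] \<and> length e \<le> N" and S: "length S \<le> N" and "9 \<le> K"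
  shows "steps (cut_t r s E S) \<le> N ^ K"
proof -
  define A where "A = inside E (set S)"
  define B where "B = outside E (set S)"
  define C where "C = crossing E (set S)"
  have ABC: "length A + length B + length C \<le> N"
    unfolding A_def B_def C_def using E e by (subst length_inside_outside_crossing) auto
  have mem: "steps (member_t v S) \<le> N ^ 2" for v using S by (rule member_t_le) simp
  have nmem: "steps (not_t (member_t v S)) \<le> N ^ 3" for v using mem by (rule not_t_le) simp
  have le: "length f \<le> N" if "(x, f) \<in> set E" for x f using e that by blast
  let ?fA = "\<lambda>(x, e). all_t (\<lambda>v. member_t v S) e"
  let ?fB = "\<lambda>(x, e). all_t (\<lambda>v. not_t (member_t v S)) e"
  let ?fC = "\<lambda>(x, e). do { b \<leftarrow> any_t (\<lambda>v. member_t v S) e;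
            if b then any_t (\<lambda>v. not_t (member_t v S)) e else ret False }"
  have 1: "steps (filter_t ?fA E) \<le> N ^ 8"
    by (rule filter_t_le[where e = 4]) (use E le mem in \<open>auto intro!: all_t_le[where e = 2]\<close>)
  have 2: "steps (filter_t ?fB E) \<le> N ^ 8"
    by (rule filter_t_le[where e = 5]) (use E le nmem in \<open>auto intro!: all_t_le[where e = 3]\<close>)
  have "steps (?fC xe) \<le> N ^ 6" if "xe \<in> set E" for xe
  proof (rule absorb)
    have "steps (any_t (\<lambda>v. member_t v S) (snd xe)) \<le> N ^ 5"
      using le[of "fst xe" "snd xe"] that mem by (intro any_t_le[where e = 2]) auto
    moreover have "steps (any_t (\<lambda>v. not_t (member_t v S)) (snd xe)) \<le> N ^ 5"
      using le[of "fst xe" "snd xe"] that nmem by (intro any_t_le[where e = 3]) auto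
    ultimately show "steps (?fC xe) \<le> 15 * N ^ 5 + 1" by (auto simp: case_prod_unfold)
  qed simp
  then have 3: "steps (filter_t ?fC E) \<le> N ^ 8"
    using E by (intro filter_t_le[where e = 6]) auto
  define A' where "A' = take (length A - length E div 2) A"
  define B' where "B' = take (length B - length E div 2) B"
  have A': "length A' \<le> length A" "length B' \<le> length B" by (auto simp: A'_def B'_def)
  have 4: "steps (length_t E) \<le> N ^ 8" "steps (length_t A) \<le> N ^ 8" "steps (length_t B) \<le> N ^ 8"
    "steps (length_t C) \<le> N ^ 8"
    by (rule length_t_le; use E ABC in simp)+
  have 5: "steps (take_t (length A - length E div 2) A) \<le> N ^ 8"
    "steps (take_t (length B - length E div 2) B) \<le> N ^ 8"
    by (rule take_t_le; use ABC in simp)+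
  have 6: "steps (append_t A' B') \<le> N ^ 8" "steps (append_t C (A' @ B')) \<le> N ^ 8"
    by (rule append_t_le; use ABC A' in simp)+
  have 7: "steps (map_t (\<lambda>(x, e). ret x) (C @ A' @ B')) \<le> N ^ 8"
    by (rule map_t_le[where e = 0]) (use ABC A' in auto)
  have res: "result (filter_t ?fA E) = A" "result (filter_t ?fB E) = B" "result (filter_t ?fC E) = C"
    unfolding result_filter_t A_def B_def C_def inside_def outside_def crossing_def
    by (rule filter_cong; auto split: if_splits)+
  have "steps (cut_t r s E S) \<le> Suc (steps (length_t E) + (steps (filter_t ?fA E) + (steps (filter_t ?fB E)
     + (steps (filter_t ?fC E) + (steps (length_t A) + (steps (length_t B) + (steps (length_t C)
     + (steps (take_t (length A - length E div 2) A) + (steps (take_t (length B - length E div 2) B)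
     + (steps (append_t A' B') + (steps (append_t C (A' @ B')) + steps (map_t (\<lambda>(x, e). ret x) (C @ A' @ B')))))))))))))"
    unfolding cut_t_def steps_simps res result_length_t
    by (simp only: steps_simps result_length_t result_take_t result_append_t A'_def B'_def split: if_split) simp
  then show ?thesis using 1 2 3 4 5 6 7 \<open>9 \<le> K\<close> by (intro absorb[of _ 8]) linarith+
qed

end


section \<open>Random cuts\<close>

primrec random_subset :: "real \<Rightarrow> nat list \<Rightarrow> nat list pmf" where
  "random_subset q [] = return_pmf []"
| "random_subset q (v # V) = bind_pmf (bernoulli_pmf q)
     (\<lambda>b. map_pmf (\<lambda>S. if b then v # S else S) (random_subset q V))"

lemma bind_rand_lift_timed:
  "bind_rand (spmf_of_pmf p) (\<lambda>x. lift_timed (f x)) =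
     spmf_of_pmf (map_pmf (\<lambda>x. Timed (result (f (result x))) (steps x + steps (f (result x)))) p)"
  by (simp add: bind_rand_def lift_timed_def) (simp add: map_pmf_def spmf_of_pmf_bind)

text \<open>Each vertex costs exactly one toss and one call, so the step count is constant and only
  the distribution of the set is left to study, as a \<open>pmf\<close> on a finite support.\<close>

lemma sample_eq:
  "sample q V = spmf_of_pmf (map_pmf (\<lambda>S. Timed S (2 * length V + 1)) (random_subset q V))"
proof (induction V)
  case Nil
  show ?case by (simp add: lift_timed_def tick_def ret_def)
next
  case (Cons v V)
  have coin: "coin q = spmf_of_pmf (map_pmf (\<lambda>b. Timed b 1) (bernoulli_pmf q))"
    by (simp add: coin_def tick_def ret_def)
  have "sample q (v # V) = bind_pmf (bernoulli_pmf q) (\<lambda>b. spmf_of_pmf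
      (map_pmf (\<lambda>S. Timed (if b then v # S else S) (Suc (Suc (Suc (2 * length V))))) (random_subset q V)))"
    unfolding sample.simps Cons bind_rand_lift_timed coin
    by (simp add: bind_rand_def bind_map_pmf map_pmf_comp tick_def ret_def cong: if_cong)
  then show ?case
    by (simp add: map_bind_pmf map_pmf_comp spmf_of_pmf_bind)
qed

lemma finite_set_random_subset [simp]: "finite (set_pmf (random_subset q V))"
  by (induction V) auto

lemma set_random_subset:
  "S \<in> set_pmf (random_subset q V) \<Longrightarrow> set S \<subseteq> set V \<and> length S \<le> length V"
  by (induction V arbitrary: S) (fastforce split: if_splits)+

lemma expectation_random_subset_Cons:
  fixes h :: "nat list \<Rightarrow> real"
  assumes "0 \<le> q" "q \<le> 1"
  shows "measure_pmf.expectation (random_subset q (v # V)) h =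
     q * measure_pmf.expectation (random_subset q V) (\<lambda>S. h (v # S)) +
     (1 - q) * measure_pmf.expectation (random_subset q V) h"
  using assms by (simp, subst pmf_expectation_bind[of UNIV]) (auto simp: UNIV_bool)

text \<open>The vertices are chosen independently, so each vertex of A contributes q, each vertex of
  B contributes 1 - q, and the others contribute 1. Applied to one edge or to the union of two
  disjoint edges, as A or as B, this gives the means and the pair probabilities for the second
  moments.\<close>

lemma expectation_random_subset_avoid:
  assumes "0 \<le> q" "q \<le> 1" and "distinct V" "A \<subseteq> set V" "B \<subseteq> set V" "A \<inter> B = {}"
  shows "measure_pmf.expectation (random_subset q V) (\<lambda>S. of_bool (A \<subseteq> set S \<and> B \<inter> set S = {}) :: real) =
    q ^ card A * (1 - q) ^ card B"
  using assms(3-)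
proof (induction V arbitrary: A B)
  case Nil
  then show ?case by simp
next
  case (Cons v V)
  let ?E = "measure_pmf.expectation (random_subset q V)"
  have fin: "finite A" "finite B" using Cons.prems finite_subset by blast+
  have notin: "set S \<subseteq> set V \<Longrightarrow> v \<notin> set S" for S using Cons.prems by auto
  have cong: "?E f = ?E g" if "\<And>S. set S \<subseteq> set V \<Longrightarrow> f S = g S" for f g :: "nat list \<Rightarrow> real"
    using that set_random_subset by (intro integral_cong_AE) (auto simp: AE_measure_pmf_iff)
  have AB: "A - {v} \<subseteq> set V" "B - {v} \<subseteq> set V" "distinct V" using Cons.prems by auto
  have IH: "?E (\<lambda>S. of_bool (A - {v} \<subseteq> set S \<and> (B - {v}) \<inter> set S = {}) :: real)
      = q ^ card (A - {v}) * (1 - q) ^ card (B - {v})"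
    using Cons.prems AB by (intro Cons.IH) auto
  consider "v \<in> A" "v \<notin> B" | "v \<in> B" "v \<notin> A" | "v \<notin> A" "v \<notin> B" using Cons.prems by blast
  then show ?case
  proof cases
    case 1
    have "?E (\<lambda>S. of_bool (A \<subseteq> set (v # S) \<and> B \<inter> set (v # S) = {}) :: real)
        = ?E (\<lambda>S. of_bool (A - {v} \<subseteq> set S \<and> (B - {v}) \<inter> set S = {}) :: real)"
      by (rule cong) (use 1 in \<open>auto simp: of_bool_def\<close>)
    moreover have "?E (\<lambda>S. of_bool (A \<subseteq> set S \<and> B \<inter> set S = {}) :: real) = ?E (\<lambda>S. 0)"
      by (rule cong) (use 1 notin in auto)
    moreover have "card A = Suc (card (A - {v}))" using fin(1) 1(1) by (rule card.remove)
    moreover have "card (B - {v}) = card B" using 1 by simp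
    ultimately show ?thesis
      unfolding expectation_random_subset_Cons[OF assms(1,2)] by (simp only: IH) simp
  next
    case 2
    have "?E (\<lambda>S. of_bool (A \<subseteq> set S \<and> B \<inter> set S = {}) :: real)
        = ?E (\<lambda>S. of_bool (A - {v} \<subseteq> set S \<and> (B - {v}) \<inter> set S = {}) :: real)"
      by (rule cong) (use 2 notin in \<open>auto simp: of_bool_def\<close>)
    moreover have "?E (\<lambda>S. of_bool (A \<subseteq> set (v # S) \<and> B \<inter> set (v # S) = {}) :: real) = ?E (\<lambda>S. 0)"
      by (rule cong) (use 2 in auto)
    moreover have "card B = Suc (card (B - {v}))" using fin(2) 2(1) by (rule card.remove)
    moreover have "card (A - {v}) = card A" using 2 by simp
    ultimately show ?thesis
      unfolding expectation_random_subset_Cons[OF assms(1,2)] by (simp only: IH) simp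
  next
    case 3
    have "?E (\<lambda>S. of_bool (A \<subseteq> set (v # S) \<and> B \<inter> set (v # S) = {}) :: real)
        = ?E (\<lambda>S. of_bool (A - {v} \<subseteq> set S \<and> (B - {v}) \<inter> set S = {}) :: real)"
      by (rule cong) (use 3 in \<open>auto simp: of_bool_def\<close>)
    moreover have "A - {v} = A" "B - {v} = B" using 3 by auto
    ultimately show ?thesis
      unfolding expectation_random_subset_Cons[OF assms(1,2)] using IH by (simp add: algebra_simps)
  qed
qed

text \<open>Expanding the square gives a sum of covariances. It vanishes for pairs outside
  \<open>D\<close>, and each pair in \<open>D\<close> contributes at most 1 because the values lie
  between 0 and 1.\<close>

lemma second_moment_le:
  fixes f :: "nat \<Rightarrow> 'a \<Rightarrow> real" and P :: "'a pmf"
  assumes fin: "finite (set_pmf P)" and f: "\<And>t x. 0 \<le> f t x \<and> f t x \<le> 1"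
    and mean: "\<And>t. t < m \<Longrightarrow> measure_pmf.expectation P (f t) = p"
    and indep: "\<And>t u. t < m \<Longrightarrow> u < m \<Longrightarrow> (t, u) \<notin> D \<Longrightarrow>
      measure_pmf.expectation P (\<lambda>x. f t x * f u x) = p ^ 2"
    and D: "D \<subseteq> {..<m} \<times> {..<m}"
  shows "measure_pmf.expectation P (\<lambda>x. ((\<Sum>t<m. f t x) - real m * p) ^ 2) \<le> real (card D)"
proof -
  let ?E = "measure_pmf.expectation P"
  note int = integrable_measure_pmf_finite[OF fin]
  have finD: "finite D" using D finite_subset by blast
  have cov: "?E (\<lambda>x. (f t x - p) * (f u x - p)) \<le> of_bool ((t, u) \<in> D)" if tu: "t < m" "u < m" for t u
  proof -
    have "?E (\<lambda>x. (f t x - p) * (f u x - p)) = ?E (\<lambda>x. f t x * f u x - p * f t x - p * f u x + p ^ 2)"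
      by (rule Bochner_Integration.integral_cong) (auto simp: algebra_simps power2_eq_square)
    also have "\<dots> = ?E (\<lambda>x. f t x * f u x) - p * ?E (f t) - p * ?E (f u) + p ^ 2"
      by (simp add: int)
    also have "\<dots> = ?E (\<lambda>x. f t x * f u x) - p ^ 2"
      using mean[OF tu(1)] mean[OF tu(2)] by (simp add: power2_eq_square)
    also have "\<dots> \<le> of_bool ((t, u) \<in> D)"
    proof (cases "(t, u) \<in> D")
      case True
      have "?E (\<lambda>x. f t x * f u x) \<le> ?E (\<lambda>x. 1)"
        using f by (intro integral_mono int mult_le_one) auto
      then have "?E (\<lambda>x. f t x * f u x) \<le> 1" by simp
      then have "?E (\<lambda>x. f t x * f u x) - p ^ 2 \<le> 1" using zero_le_power2[of p] by linarith
      then show ?thesis using True by simp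
    next
      case False
      then show ?thesis using indep[OF tu] by simp
    qed
    finally show ?thesis .
  qed
  have "?E (\<lambda>x. ((\<Sum>t<m. f t x) - real m * p) ^ 2)
      = ?E (\<lambda>x. \<Sum>t<m. \<Sum>u<m. (f t x - p) * (f u x - p))"
  proof (rule Bochner_Integration.integral_cong)
    fix x
    have "(\<Sum>t<m. f t x) - real m * p = (\<Sum>t<m. f t x - p)" by (simp add: sum_subtractf)
    then show "((\<Sum>t<m. f t x) - real m * p) ^ 2 = (\<Sum>t<m. \<Sum>u<m. (f t x - p) * (f u x - p))"
      by (simp add: power2_eq_square sum_product)
  qed simp
  also have "\<dots> = (\<Sum>t<m. \<Sum>u<m. ?E (\<lambda>x. (f t x - p) * (f u x - p)))"
    by (simp add: int Bochner_Integration.integral_sum)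
  also have "\<dots> \<le> (\<Sum>t<m. \<Sum>u<m. of_bool ((t, u) \<in> D))"
    using cov by (intro sum_mono) auto
  also have "\<dots> = (\<Sum>z\<in>{..<m} \<times> {..<m}. of_bool (z \<in> D))"
    by (subst sum.cartesian_product) (simp only: case_prod_unfold prod.collapse)
  also have "\<dots> = real (card D)"
    using D by (simp add: Int_absorb1)
  finally show ?thesis .
qed

text \<open>Each of the r vertices of an edge lies in at most k edges, so an edge meets at most r k
  edges, itself included.\<close>

lemma card_meeting_pairs_le:
  assumes size: "\<And>x e. (x, e) \<in> set E \<Longrightarrow> distinct e \<and> length e = r"
    and deg: "\<And>v. vertex_degree E v \<le> k"
  shows "card {(t, u). t < length E \<and> u < length E \<and> set (snd (E ! t)) \<inter> set (snd (E ! u)) \<noteq> {}}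
    \<le> length E * (r * k)"
proof -
  let ?e = "\<lambda>t. set (snd (E ! t))"
  have deg': "card {u. u < length E \<and> v \<in> ?e u} \<le> k" for v
    using deg[of v] by (simp add: vertex_degree_def length_filter_conv_card case_prod_unfold)
  have row: "card {u. u < length E \<and> ?e t \<inter> ?e u \<noteq> {}} \<le> r * k" if t: "t < length E" for t
  proof -
    have "distinct (snd (E ! t)) \<and> length (snd (E ! t)) = r"
      using size[of "fst (E ! t)" "snd (E ! t)"] t by simp
    then have "card (?e t) = r" by (metis distinct_card)
    have "{u. u < length E \<and> ?e t \<inter> ?e u \<noteq> {}} = (\<Union>v\<in>?e t. {u. u < length E \<and> v \<in> ?e u})" by auto
    also have "card \<dots> \<le> (\<Sum>v\<in>?e t. card {u. u < length E \<and> v \<in> ?e u})"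
      by (rule card_UN_le) simp
    also have "\<dots> \<le> (\<Sum>v\<in>?e t. k)" by (intro sum_mono deg')
    finally show ?thesis using \<open>card (?e t) = r\<close> by simp
  qed
  have "{(t, u). t < length E \<and> u < length E \<and> ?e t \<inter> ?e u \<noteq> {}}
      = (SIGMA t:{..<length E}. {u. u < length E \<and> ?e t \<inter> ?e u \<noteq> {}})" by auto
  also have "card \<dots> = (\<Sum>t<length E. card {u. u < length E \<and> ?e t \<inter> ?e u \<noteq> {}})" by simp
  also have "\<dots> \<le> (\<Sum>t<length E. r * k)" by (intro sum_mono row) simp
  finally show ?thesis by simp
qed

text \<open>The case r = 2 is extremal: 2 powr (-1/2) >= 7/10, since 49/100 <= 1/2, so the base of
  the power is at most 3/10, and the exponent is at least 2. The bound 9/100 is small enough for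
  both later uses, namely 1 - eps r >= 2/3 when d >= 3 and 4 eps r <= 1/2 when d = 2.\<close>

lemma eps_bounds:
  assumes "2 \<le> r"
  shows "0 \<le> eps r" "eps r \<le> 9 / 100"
proof -
  have r: "2 powr (- 1 / real r) \<le> 1"
    using powr_mono[of "- 1 / real r" 0 2] by simp
  have "7 / 10 \<le> (2 :: real) powr (- 1 / 2)"
  proof -
    have "((2 :: real) powr (- 1 / 2)) ^ 2 = 2 powr (- 1 / 2 + - 1 / 2)"
      unfolding power2_eq_square by (rule powr_add[symmetric])
    also have "- 1 / 2 + - 1 / 2 = (- 1 :: real)" by simp
    finally have "(7 / 10) ^ 2 \<le> ((2 :: real) powr (- 1 / 2)) ^ 2"
      by (simp add: powr_minus power2_eq_square)
    then show ?thesis by (rule power2_le_imp_le) simp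
  qed
  also have "\<dots> \<le> 2 powr (- 1 / real r)" using assms by (intro powr_mono) (auto simp: field_simps)
  finally have *: "1 - 2 powr (- 1 / real r) \<le> 3 / 10" by simp
  show "0 \<le> eps r" unfolding eps_def using r by simp
  have "eps r \<le> (1 - 2 powr (- 1 / real r)) ^ 2"
    unfolding eps_def using assms r by (intro power_decreasing) auto
  also have "\<dots> \<le> (3 / 10) ^ 2" using * r by (intro power_mono) auto
  finally show "eps r \<le> 9 / 100" by (simp add: power2_eq_square)
qed

text \<open>Markov's inequality is applied once, to the sum of the squared deviations of the numbers
  of inside and outside edges. A bad cut forces one of these deviations above s/2, and each second
  moment is at most m r k.\<close>

lemma prob_good_cut:
  assumes E: "\<And>x e. (x, e) \<in> set E \<Longrightarrow> distinct e \<and> length e = r" and r: "2 \<le> r"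
    and V: "distinct V" "\<And>x e. (x, e) \<in> set E \<Longrightarrow> set e \<subseteq> set V"
    and deg: "\<And>v. vertex_degree E v \<le> k"
    and s: "16 * (length E * (r * k)) \<le> s ^ 2" "0 < s"
  shows "measure_pmf.prob (random_subset (2 powr (- 1 / real r)) V) {S. \<not> good_cut r s E (set S)} \<le> 1 / 2"
proof -
  define q :: real where "q = 2 powr (- 1 / real r)"
  have q: "0 \<le> q" "q \<le> 1"
    using powr_mono[of "- 1 / real r" 0 2] by (auto simp: q_def)
  have "q ^ r = 2 powr (- 1 / real r * real r)" unfolding q_def using r by (subst powr_power) auto
  also have "- 1 / real r * real r = - 1" using r by simp
  finally have qr: "q ^ r = 1 / 2" by (simp add: powr_minus)
  define P where "P = random_subset q V"
  define m where "m = length E"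
  define e where "e t = set (snd (E ! t))" for t
  define D where "D = {(t, u). t < m \<and> u < m \<and> e t \<inter> e u \<noteq> {}}"
  let ?E = "measure_pmf.expectation P :: (nat list \<Rightarrow> real) \<Rightarrow> real"
  have fin: "finite (set_pmf P)" by (simp add: P_def)
  note int = integrable_measure_pmf_finite[OF fin]
  have D: "D \<subseteq> {..<m} \<times> {..<m}" by (auto simp: D_def)
  have cardD: "card D \<le> m * (r * k)"
    using card_meeting_pairs_le[of E r k] E deg by (simp add: D_def m_def e_def)
  have ev: "e t \<subseteq> set V" "card (e t) = r" if "t < m" for t
  proof -
    have "(fst (E ! t), snd (E ! t)) \<in> set E" using that by (simp add: m_def)
    then show "e t \<subseteq> set V" "card (e t) = r"
      using E V(2) unfolding e_def by (blast, metis distinct_card)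
  qed
  have avoid: "?E (\<lambda>S. of_bool (A \<subseteq> set S \<and> B \<inter> set S = {}) :: real) = q ^ card A * (1 - q) ^ card B"
    if "A \<subseteq> set V" "B \<subseteq> set V" "A \<inter> B = {}" for A B
    unfolding P_def using q V(1) that by (rule expectation_random_subset_avoid)
  have disj: "e t \<inter> e u = {}" "card (e t \<union> e u) = r + r" "e t \<union> e u \<subseteq> set V"
    if "t < m" "u < m" "(t, u) \<notin> D" for t u
  proof -
    show 1: "e t \<inter> e u = {}" using that by (auto simp: D_def)
    show "card (e t \<union> e u) = r + r"
      using ev(2)[OF that(1)] ev(2)[OF that(2)] 1 by (subst card_Un_disjoint) (auto simp: e_def)
    show "e t \<union> e u \<subseteq> set V" using ev(1) that by blast
  qed
  define X where "X S = (\<Sum>t<m. of_bool (e t \<subseteq> set S) :: real)" for S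
  define Y where "Y S = (\<Sum>t<m. of_bool (e t \<inter> set S = {}) :: real)" for S
  have XV: "?E (\<lambda>S. (X S - real m * (1 / 2)) ^ 2) \<le> real (card D)"
    unfolding X_def
  proof (rule second_moment_le[OF fin _ _ _ D])
    show "?E (\<lambda>S. of_bool (e t \<subseteq> set S)) = 1 / 2" if "t < m" for t
      using avoid[of "e t" "{}"] ev[OF that] by (simp add: qr)
    show "?E (\<lambda>S. of_bool (e t \<subseteq> set S) * of_bool (e u \<subseteq> set S)) = (1 / 2) ^ 2"
      if "t < m" "u < m" "(t, u) \<notin> D" for t u
    proof -
      have "of_bool (e t \<subseteq> set S) * of_bool (e u \<subseteq> set S) = (of_bool (e t \<union> e u \<subseteq> set S) :: real)" for S
        by (auto simp: of_bool_def)
      then show ?thesis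
        using avoid[of "e t \<union> e u" "{}"] disj[OF that] by (simp add: power_add qr power2_eq_square)
    qed
  qed auto
  have YV: "?E (\<lambda>S. (Y S - real m * eps r) ^ 2) \<le> real (card D)"
    unfolding Y_def
  proof (rule second_moment_le[OF fin _ _ _ D])
    show "?E (\<lambda>S. of_bool (e t \<inter> set S = {})) = eps r" if "t < m" for t
      using avoid[of "{}" "e t"] ev[OF that] by (simp add: eps_def q_def)
    show "?E (\<lambda>S. of_bool (e t \<inter> set S = {}) * of_bool (e u \<inter> set S = {})) = (eps r) ^ 2"
      if "t < m" "u < m" "(t, u) \<notin> D" for t u
    proof -
      have "of_bool (e t \<inter> set S = {}) * of_bool (e u \<inter> set S = {})
          = (of_bool ((e t \<union> e u) \<inter> set S = {}) :: real)" for S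
        by (auto simp: of_bool_def)
      then show ?thesis
        using avoid[of "{}" "e t \<union> e u"] disj[OF that]
        by (simp add: power_add eps_def q_def power2_eq_square)
    qed
  qed auto
  have XI: "X S = real (length (inside E (set S)))" for S
    by (simp add: X_def inside_def length_filter_conv_card case_prod_unfold m_def e_def of_bool_def
        sum.If_cases Int_def lessThan_def)
  have YI: "Y S = real (length (outside E (set S)))" for S
    by (simp add: Y_def outside_def length_filter_conv_card case_prod_unfold m_def e_def of_bool_def
        sum.If_cases Int_def lessThan_def)
  have bad: "(real s / 2) ^ 2 * of_bool (\<not> good_cut r s E (set S))
      \<le> (X S - real m * (1 / 2)) ^ 2 + (Y S - real m * eps r) ^ 2" for S
  proof (cases "good_cut r s E (set S)")
    case False
    have "length (inside E (set S)) + length (outside E (set S)) + length (crossing E (set S)) = m"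
      unfolding m_def
    proof (rule length_inside_outside_crossing)
      show "f \<noteq> []" if "(x, f) \<in> set E" for x f using E[OF that] r by auto
    qed
    then have c: "real (length (crossing E (set S))) = real m - X S - Y S"
      unfolding XI YI by linarith
    \<comment> \<open>The number of crossing edges is m - X - Y, so its error can be the sum of the
      errors of X and Y; allowing s/2 for each keeps it within s.\<close>
    have "\<not> (\<bar>X S - real m * (1 / 2)\<bar> \<le> real s / 2 \<and> \<bar>Y S - real m * eps r\<bar> \<le> real s / 2)"
    proof
      assume *: "\<bar>X S - real m * (1 / 2)\<bar> \<le> real s / 2 \<and> \<bar>Y S - real m * eps r\<bar> \<le> real s / 2"
      then have "\<bar>X S - real m / 2\<bar> \<le> real s" by simp
      moreover have "real m - X S - Y S \<le> (1 / 2 - eps r) * real m + real s"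
        using * unfolding left_diff_distrib abs_le_iff by (simp add: mult.commute)
      ultimately have "good_cut r s E (set S)"
        unfolding good_cut_def c XI[symmetric] m_def[symmetric] by blast
      with False show False ..
    qed
    then have "(real s / 2) ^ 2 \<le> (X S - real m * (1 / 2)) ^ 2 \<or>
        (real s / 2) ^ 2 \<le> (Y S - real m * eps r) ^ 2"
      by (auto simp: abs_le_square_iff[symmetric])
    then have "(real s / 2) ^ 2 \<le> (X S - real m * (1 / 2)) ^ 2 + (Y S - real m * eps r) ^ 2"
      using zero_le_power2[of "X S - real m * (1 / 2)"] zero_le_power2[of "Y S - real m * eps r"] by linarith
    then show ?thesis using False by simp
  qed simp
  have "(real s / 2) ^ 2 * measure_pmf.prob P {S. \<not> good_cut r s E (set S)}
      = ?E (\<lambda>S. (real s / 2) ^ 2 * of_bool (\<not> good_cut r s E (set S)))"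
  proof -
    have "measure_pmf.prob P {S. \<not> good_cut r s E (set S)} = ?E (indicator {S. \<not> good_cut r s E (set S)})"
      by simp
    also have "\<dots> = ?E (\<lambda>S. of_bool (\<not> good_cut r s E (set S)))"
      by (rule Bochner_Integration.integral_cong) (auto simp: indicator_def)
    finally show ?thesis by simp
  qed
  also have "\<dots> \<le> ?E (\<lambda>S. (X S - real m * (1 / 2)) ^ 2 + (Y S - real m * eps r) ^ 2)"
    by (intro integral_mono int bad)
  also have "\<dots> = ?E (\<lambda>S. (X S - real m * (1 / 2)) ^ 2) + ?E (\<lambda>S. (Y S - real m * eps r) ^ 2)"
    by (rule Bochner_Integration.integral_add) (rule int)+
  also have "\<dots> \<le> 2 * real (m * (r * k))"
  proof -
    have "real (card D) \<le> real (m * (r * k))" using cardD unfolding of_nat_le_iff .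
    then show ?thesis using XV YV by linarith
  qed
  \<comment> \<open>The constant 16 is fixed here: 2 m r k <= s^2 / 8 means 16 m r k <= s^2.\<close>
  also have "\<dots> \<le> (real s / 2) ^ 2 * (1 / 2)"
  proof -
    have "real (16 * (m * (r * k))) \<le> real (s ^ 2)" using s(1) unfolding m_def of_nat_le_iff .
    then show ?thesis by (simp add: power_divide)
  qed
  finally have "(real s / 2) ^ 2 * measure_pmf.prob P {S. \<not> good_cut r s E (set S)} \<le> (real s / 2) ^ 2 * (1 / 2)" .
  then show ?thesis using s(2) unfolding P_def q_def by (simp add: mult_le_cancel_left)
qed

section \<open>Repeated trials\<close>

text \<open>
  The number of steps of the loop satisfies an equation that does not exclude an infinite
  expectation; it is applied to the number of steps truncated at n, whose expectation is finite.
\<close>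

lemma repeat_rand:
  fixes D :: "'a option timed pmf"
  assumes none: "measure_pmf.prob D {x. result x = None} \<le> 1 / 2"
    and c: "\<And>x. x \<in> set_pmf D \<Longrightarrow> steps x \<le> c"
    and Q: "\<And>x a. x \<in> set_pmf D \<Longrightarrow> result x = Some a \<Longrightarrow> Q a"
  obtains D' where "repeat_rand (spmf_of_pmf D) = spmf_of_pmf D'"
    "\<And>y. y \<in> set_pmf D' \<Longrightarrow> Q (result y)"
    "(\<integral>\<^sup>+ y. of_nat (steps y) \<partial>measure_pmf D') \<le> ennreal (2 * (real c + 1))"
proof -
  define W where "W = repeat_rand (spmf_of_pmf D)"
  define g :: "'a option timed \<Rightarrow> 'a timed \<Rightarrow> 'a timed"
    where "g x y = Timed (result y) (Suc (steps x + steps y))" for x y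
  have rec: "W = bind_pmf D (\<lambda>x. case result x of None \<Rightarrow> map_spmf (g x) W
      | Some a \<Rightarrow> return_spmf (Timed a (Suc (steps x))))"
    using repeat_rand.simps[of "spmf_of_pmf D"] unfolding bind_spmf_of_pmf W_def g_def .
  \<comment> \<open>The loop equation multiplies the probability of divergence by the failure
    probability of one trial. This probability is thus at most half of itself, hence zero, and
    \<open>W\<close> comes from a proper distribution.\<close>
  have "pmf W None = (\<integral>x. pmf (case result x of None \<Rightarrow> map_spmf (g x) W
      | Some a \<Rightarrow> return_spmf (Timed a (Suc (steps x)))) None \<partial>measure_pmf D)"
    by (subst rec) (rule pmf_bind)
  also have "\<dots> = (\<integral>x. indicator {x. result x = None} x * pmf W None \<partial>measure_pmf D)"
    by (intro Bochner_Integration.integral_cong) (auto simp: pmf_None_eq_weight_spmf split: option.split)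
  also have "\<dots> = measure_pmf.prob D {x. result x = None} * pmf W None" by simp
  also have "\<dots> \<le> 1 / 2 * pmf W None" using none by (intro mult_right_mono) auto
  finally have "pmf W None \<le> 1 / 2 * pmf W None" .
  then have "pmf W None = 0" using pmf_nonneg[of W None] by linarith
  then obtain D' where W: "W = spmf_of_pmf D'"
    by (auto simp: lossless_iff_pmf_None[symmetric] lossless_spmf_conv_spmf_of_pmf)
  \<comment> \<open>The embedding of \<open>pmf\<close> into \<open>spmf\<close> is injective, so
    the loop equation descends from \<open>W\<close> to \<open>D'\<close>.\<close>
  have "spmf_of_pmf D' = spmf_of_pmf (bind_pmf D (\<lambda>x. case result x of None \<Rightarrow> map_pmf (g x) D'
      | Some a \<Rightarrow> return_pmf (Timed a (Suc (steps x)))))"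
    unfolding spmf_of_pmf_bind
    by (subst W[symmetric], subst rec) (auto simp: W intro!: bind_pmf_cong split: option.split)
  then have rec': "D' = bind_pmf D (\<lambda>x. case result x of None \<Rightarrow> map_pmf (g x) D'
      | Some a \<Rightarrow> return_pmf (Timed a (Suc (steps x))))"
    unfolding spmf_of_pmf_def by (rule injD[OF pmf.inj_map, rotated]) auto
  have "Q (result y)" if "y \<in> set_pmf D'" for y
    using that
  \<comment> \<open>Each round costs at least one step, so the part of a run after a failed trial
    has a smaller count than the whole run.\<close>
  proof (induction "steps y" arbitrary: y rule: less_induct)
    case less
    from less.prems obtain x where x: "x \<in> set_pmf D"
      "y \<in> set_pmf (case result x of None \<Rightarrow> map_pmf (g x) D'
        | Some a \<Rightarrow> return_pmf (Timed a (Suc (steps x))))"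
      by (subst (asm) rec') auto
    show ?case
    proof (cases "result x")
      case None
      then obtain z where "z \<in> set_pmf D'" "y = g x z" using x(2) by auto
      then show ?thesis using less.hyps[of z] by (simp add: g_def)
    next
      case (Some a)
      then show ?thesis using x Q by auto
    qed
  qed
  moreover have "(\<integral>\<^sup>+ y. of_nat (steps y) \<partial>measure_pmf D') \<le> ennreal (2 * (real c + 1))"
  proof -
    define F :: "nat \<Rightarrow> 'a timed \<Rightarrow> ennreal" where "F n y = of_nat (min (steps y) n)" for n y
    define I where "I n = (\<integral>\<^sup>+ y. F n y \<partial>measure_pmf D')" for n
    have bound: "I n \<le> ennreal (2 * (real c + 1))" for n
    proof -
      have inner: "(\<integral>\<^sup>+ y. F n y \<partial>measure_pmf (case result x of None \<Rightarrow> map_pmf (g x) D'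
            | Some a \<Rightarrow> return_pmf (Timed a (Suc (steps x)))))
          \<le> of_nat (Suc c) + I n * indicator {x. result x = None} x" if x: "x \<in> set_pmf D" for x
      proof (cases "result x")
        case None
        have "(\<integral>\<^sup>+ y. F n (g x y) \<partial>measure_pmf D') \<le> (\<integral>\<^sup>+ y. of_nat (Suc c) + F n y \<partial>measure_pmf D')"
        proof (rule nn_integral_mono)
          fix y :: "'a timed"
          have "min (Suc (steps x + steps y)) n \<le> Suc c + min (steps y) n" using c[OF x] by simp
          then have "(of_nat (min (Suc (steps x + steps y)) n) :: ennreal) \<le> of_nat (Suc c + min (steps y) n)"
            unfolding of_nat_le_iff .
          then show "F n (g x y) \<le> of_nat (Suc c) + F n y" by (simp add: F_def g_def add.assoc)
        qed
        also have "\<dots> = of_nat (Suc c) + I n"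
          unfolding I_def by (subst nn_integral_add) (auto simp: measure_pmf.emeasure_space_1)
        finally show ?thesis using None by simp
      next
        case (Some a)
        have "(of_nat (min (Suc (steps x)) n) :: ennreal) \<le> of_nat (Suc c)"
          using c[OF x] unfolding of_nat_le_iff by simp
        then show ?thesis using Some by (simp add: F_def)
      qed
      have "I n = (\<integral>\<^sup>+ x. \<integral>\<^sup>+ y. F n y \<partial>measure_pmf (case result x of None \<Rightarrow> map_pmf (g x) D'
            | Some a \<Rightarrow> return_pmf (Timed a (Suc (steps x)))) \<partial>measure_pmf D)"
        unfolding I_def by (subst rec') (rule nn_integral_bind_pmf)
      also have "\<dots> \<le> (\<integral>\<^sup>+ x. of_nat (Suc c) + I n * indicator {x. result x = None} x \<partial>measure_pmf D)"
        using inner by (intro nn_integral_mono_AE) (simp add: AE_measure_pmf_iff)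
      also have "\<dots> = of_nat (Suc c) + I n * emeasure (measure_pmf D) {x. result x = None}"
        by (subst nn_integral_add) (auto simp: measure_pmf.emeasure_space_1 nn_integral_cmult_indicator)
      also have "\<dots> \<le> of_nat (Suc c) + I n * ennreal (1 / 2)"
        using none unfolding measure_pmf.emeasure_eq_measure by (intro add_left_mono mult_left_mono ennreal_leI) auto
      \<comment> \<open>Once \<open>I n\<close> is known to be finite, this can be solved for it and
        yields twice the cost of one round.\<close>
      finally have le: "I n \<le> of_nat (Suc c) + I n * ennreal (1 / 2)" .
      have "I n \<le> (\<integral>\<^sup>+ y. of_nat n \<partial>measure_pmf D')"
        unfolding I_def F_def by (intro nn_integral_mono) (simp only: of_nat_le_iff min.cobounded2)
      then have "I n \<le> of_nat n" by (simp add: measure_pmf.emeasure_space_1)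
      then obtain i where i: "I n = ennreal i" "0 \<le> i"
        by (metis ennreal_cases ennreal_of_nat_eq_real_of_nat neq_top_trans ennreal_neq_top)
      have "ennreal i \<le> ennreal (real (Suc c) + i * (1 / 2))"
        using le i by (simp only: ennreal_of_nat_eq_real_of_nat[symmetric] ennreal_plus ennreal_mult
            of_nat_0_le_iff mult_nonneg_nonneg zero_le_divide_1_iff zero_le_numeral)
      then have "i \<le> real (Suc c) + i * (1 / 2)"
        using i(2) by (subst (asm) ennreal_le_iff) auto
      then show ?thesis unfolding i by (intro ennreal_leI) simp
    qed
    have "(\<integral>\<^sup>+ y. of_nat (steps y) \<partial>measure_pmf D') = (\<integral>\<^sup>+ y. (SUP n. F n y) \<partial>measure_pmf D')"
    proof (rule nn_integral_cong)
      fix y :: "'a timed"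
      have "(SUP n. F n y) = of_nat (steps y)"
      proof (rule SUP_eqI)
        show "F n y \<le> of_nat (steps y)" for n unfolding F_def of_nat_le_iff by simp
        show "of_nat (steps y) \<le> z" if "\<And>n. n \<in> UNIV \<Longrightarrow> F n y \<le> z" for z
          using that[of "steps y"] by (simp add: F_def)
      qed
      then show "of_nat (steps y) = (SUP n. F n y)" ..
    qed
    also have "\<dots> = (SUP n. I n)"
      unfolding I_def
    proof (rule nn_integral_monotone_convergence_SUP)
      show "incseq F" unfolding incseq_def le_fun_def F_def of_nat_le_iff by auto
    qed simp
    also have "\<dots> \<le> ennreal (2 * (real c + 1))" using bound by (rule SUP_least)
    finally show ?thesis .
  qed
  ultimately show ?thesis using that[of D'] W unfolding W_def by blast
qed


section \<open>Running times\<close>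

text \<open>For q = exp (- h) the logarithm of the left side is, up to s, at most m times ln 2 -
  \<epsilon> h + h^2 / 8 by Hoeffding's lemma for a fair coin. The choice h = 4 \<epsilon> minimises
  this and leaves -2 \<epsilon>^2 besides ln 2.\<close>

lemma binomial_tail_factor:
  fixes \<epsilon> :: real
  assumes "0 \<le> \<epsilon>" "\<epsilon> \<le> 9 / 100"
    and b: "real b \<le> (1 / 2 - \<epsilon>) * real m + real s"
  shows "(1 / exp (- 4 * \<epsilon>)) ^ b * (1 + exp (- 4 * \<epsilon>)) ^ m \<le> 2 powr ((1 - 2 * \<epsilon>\<^sup>2) * real m + real s)"
proof -
  \<comment> \<open>This is the logarithm of the moment generating function of a centred fair coin
    at 4 \<epsilon>.\<close>
  have "- (4 * \<epsilon>) * (1 / 2) + ln (1 + 1 / 2 * (exp (4 * \<epsilon>) - 1)) \<le> (4 * \<epsilon>)\<^sup>2 / 8"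
    using assms(1) by (intro Hoeffdings_lemma_aux) auto
  then have "ln ((1 + exp (4 * \<epsilon>)) / 2) \<le> 2 * \<epsilon> + 2 * \<epsilon>\<^sup>2"
    by (simp add: power2_eq_square field_simps)
  moreover have pos: "0 < (1 + exp (4 * \<epsilon>)) / 2" by (simp add: add_pos_pos)
  ultimately have "(1 + exp (4 * \<epsilon>)) / 2 \<le> exp (2 * \<epsilon> + 2 * \<epsilon>\<^sup>2)"
    by (metis exp_le_cancel_iff exp_ln)
  then have "2 * exp (- 4 * \<epsilon>) * ((1 + exp (4 * \<epsilon>)) / 2) \<le> 2 * exp (- 4 * \<epsilon>) * exp (2 * \<epsilon> + 2 * \<epsilon>\<^sup>2)"
    by (intro mult_left_mono) auto
  also have "2 * exp (- 4 * \<epsilon>) * ((1 + exp (4 * \<epsilon>)) / 2) = 1 + exp (- 4 * \<epsilon>)"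
    by (simp add: algebra_simps exp_minus)
  also have "2 * exp (- 4 * \<epsilon>) * exp (2 * \<epsilon> + 2 * \<epsilon>\<^sup>2) = 2 * exp (- 2 * \<epsilon> + 2 * \<epsilon>\<^sup>2)"
    by (simp add: exp_add[symmetric] mult.assoc)
  finally have "(1 + exp (- 4 * \<epsilon>)) ^ m \<le> (2 * exp (- 2 * \<epsilon> + 2 * \<epsilon>\<^sup>2)) ^ m"
    by (intro power_mono) (auto simp: add_nonneg_nonneg)
  also have "\<dots> = 2 ^ m * exp (real m * (- 2 * \<epsilon> + 2 * \<epsilon>\<^sup>2))"
    by (simp add: power_mult_distrib exp_of_nat_mult)
  finally have 1: "(1 + exp (- 4 * \<epsilon>)) ^ m \<le> 2 ^ m * exp (real m * (- 2 * \<epsilon> + 2 * \<epsilon>\<^sup>2))" .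
  have "(1 / exp (- 4 * \<epsilon>)) ^ b = exp (real b * (4 * \<epsilon>))"
    by (simp add: exp_minus exp_of_nat_mult divide_inverse)
  also have "\<dots> \<le> exp (((1 / 2 - \<epsilon>) * real m + real s) * (4 * \<epsilon>))"
    using b assms(1) by (simp add: mult_right_mono)
  finally have 2: "(1 / exp (- 4 * \<epsilon>)) ^ b \<le> exp (((1 / 2 - \<epsilon>) * real m + real s) * (4 * \<epsilon>))" .
  have "(1 / exp (- 4 * \<epsilon>)) ^ b * (1 + exp (- 4 * \<epsilon>)) ^ m
      \<le> exp (((1 / 2 - \<epsilon>) * real m + real s) * (4 * \<epsilon>)) * (2 ^ m * exp (real m * (- 2 * \<epsilon> + 2 * \<epsilon>\<^sup>2)))"
    using 1 2 by (intro mult_mono) (auto simp: add_nonneg_nonneg)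
  also have "\<dots> = 2 ^ m * exp (((1 / 2 - \<epsilon>) * real m + real s) * (4 * \<epsilon>) + real m * (- 2 * \<epsilon> + 2 * \<epsilon>\<^sup>2))"
    by (simp add: exp_add)
  also have "((1 / 2 - \<epsilon>) * real m + real s) * (4 * \<epsilon>) + real m * (- 2 * \<epsilon> + 2 * \<epsilon>\<^sup>2)
      = - 2 * \<epsilon>\<^sup>2 * real m + real s * (4 * \<epsilon>)"
    by (simp add: algebra_simps power2_eq_square)
  also have "2 ^ m * exp (- 2 * \<epsilon>\<^sup>2 * real m + real s * (4 * \<epsilon>))
      = 2 ^ m * (exp (- 2 * \<epsilon>\<^sup>2 * real m) * exp (4 * \<epsilon>) ^ s)"
    by (simp only: exp_add exp_of_nat_mult)
  \<comment> \<open>Passing from base e to base 2 weakens the decaying factor, as ln 2 < 1. The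
    slack costs exp (4 \<epsilon>) <= 2 for each unit of s.\<close>
  also have "\<dots> \<le> 2 ^ m * (2 powr (- 2 * \<epsilon>\<^sup>2 * real m) * 2 ^ s)"
  proof (intro mult_left_mono mult_mono power_mono)
    have "ln 2 * (2 * \<epsilon>\<^sup>2 * real m) \<le> 1 * (2 * \<epsilon>\<^sup>2 * real m)"
      using ln_2_less_1 by (intro mult_right_mono) auto
    then show "exp (- 2 * \<epsilon>\<^sup>2 * real m) \<le> 2 powr (- 2 * \<epsilon>\<^sup>2 * real m)"
      by (simp add: powr_def mult_ac)
    show "exp (4 * \<epsilon>) \<le> 2"
      using exp_bound_half[of "4 * \<epsilon>"] assms by simp
  qed auto
  also have "\<dots> = 2 powr ((1 - 2 * \<epsilon>\<^sup>2) * real m + real s)"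
  proof -
    have "(1 - 2 * \<epsilon>\<^sup>2) * real m + real s = real m + (- 2 * \<epsilon>\<^sup>2 * real m + real s)"
      by (simp add: algebra_simps)
    then show ?thesis by (simp only: powr_add powr_realpow zero_less_numeral)
  qed
  finally show ?thesis .
qed

section \<open>Correctness and running time for one fixed CSP\<close>

locale bounded_csp =
  fixes r k d :: nat and \<Psi> :: csp
  assumes r: "2 \<le> r" and k: "1 \<le> k" and d: "1 \<le> d" and csp: "is_csp d k \<Psi>"
    and vars_ne: "1 \<le> num_vars \<Psi>" and freq: "var_frequency \<Psi> \<le> r"
begin

definition m :: nat where "m = length (vars \<Psi>)"
definition n :: nat where "n = length (constrs \<Psi>)"
definition H :: hypergraph where "H = result (hypergraph_of \<Psi>)"
definition H' :: hypergraph where "H' = result (padded_t r H)"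

lemma num_vars: "num_vars \<Psi> = m"
  using csp by (simp add: num_vars_def m_def is_csp_def distinct_card)

lemma m_pos: "1 \<le> m"
  using vars_ne by (simp add: num_vars)

lemma alph: "alph \<Psi> = d"
  using csp by (simp add: is_csp_def)

lemma wf: "c \<in> set (constrs \<Psi>) \<Longrightarrow> wf_constr (alph \<Psi>) (set (vars \<Psi>)) c"
  using csp by (simp add: is_csp_def wf_constr_def)

lemma occurrences: "x \<in> set (vars \<Psi>) \<Longrightarrow> card {c \<in> set (constrs \<Psi>). x \<in> set (scope c)} \<le> r"
  using freq unfolding var_frequency_def by (subst (asm) Max_le_iff) auto

text \<open>Apart from the two constant constraints, every constraint contains a variable.\<close>

lemma n_le: "n \<le> r * m + 2"
proof -
  define C where "C x = {c \<in> set (constrs \<Psi>). x \<in> set (scope c)}" for x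
  have "set (constrs \<Psi>) \<subseteq> (\<Union>x\<in>set (vars \<Psi>). C x) \<union> {Constr [] [False], Constr [] [True]}"
  proof
    fix c assume c: "c \<in> set (constrs \<Psi>)"
    show "c \<in> (\<Union>x\<in>set (vars \<Psi>). C x) \<union> {Constr [] [False], Constr [] [True]}"
    proof (cases "scope c")
      case Nil
      then have "length (table c) = 1" using csp c by (simp add: is_csp_def)
      then obtain b where "table c = [b]" by (auto simp: length_Suc_conv)
      then have "c = Constr [] [b]" using Nil by (metis constr.collapse)
      then show ?thesis by (cases b) auto
    next
      case (Cons x xs)
      then have "x \<in> set (vars \<Psi>)" "c \<in> C x" using csp c by (auto simp: is_csp_def C_def)
      then show ?thesis by blast
    qed
  qed
  then have "card (set (constrs \<Psi>)) \<le> card ((\<Union>x\<in>set (vars \<Psi>). C x) \<union> {Constr [] [False], Constr [] [True]})"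
    by (rule card_mono[rotated]) (simp add: C_def)
  also have "\<dots> \<le> card (\<Union>x\<in>set (vars \<Psi>). C x) + card {Constr [] [False], Constr [] [True]}"
    by (rule card_Un_le)
  also have "\<dots> \<le> (\<Sum>x\<in>set (vars \<Psi>). card (C x)) + 2"
    by (intro add_mono card_UN_le) auto
  also have "\<dots> \<le> (\<Sum>x\<in>set (vars \<Psi>). r) + 2"
    unfolding C_def by (intro add_mono sum_mono occurrences) auto
  also have "\<dots> = r * m + 2" using num_vars by (simp add: num_vars_def)
  finally show ?thesis using csp by (simp add: n_def is_csp_def distinct_card)
qed

lemma verts_H: "verts H = [0..<n]"
  by (simp add: H_def result_hypergraph_of n_def)

lemma length_edges_H: "length (edges H) = m"
  by (simp add: H_def result_hypergraph_of m_def)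

lemma labels_H: "map fst (edges H) = vars \<Psi>"
  by (simp add: H_def result_hypergraph_of o_def)

lemma distinct_labels_H: "distinct (map fst (edges H))"
  using csp by (simp add: labels_H is_csp_def)

lemma labels_set_H: "fst ` set (edges H) = set (vars \<Psi>)"
  by (metis labels_H set_map)

lemma edges_H: "\<forall>(x, e)\<in>set (edges H). distinct e \<and> length e \<le> r \<and> set e \<subseteq> {..<n}"
proof (intro ballI, clarify)
  fix x e assume "(x, e) \<in> set (edges H)"
  then have x: "x \<in> set (vars \<Psi>)" and e: "e = filter (\<lambda>i. x \<in> set (scope (constrs \<Psi> ! i))) [0..<n]"
    by (simp_all add: H_def edge_hypergraph_of n_def)
  \<comment> \<open>The frequency counts constraints while an edge consists of positions; since the
    constraints are distinct, positions map injectively to constraints.\<close>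
  have "card (set e) \<le> card {c \<in> set (constrs \<Psi>). x \<in> set (scope c)}"
  proof (rule card_inj_on_le)
    show "inj_on ((!) (constrs \<Psi>)) (set e)"
      using csp by (intro inj_on_nth) (auto simp: e n_def is_csp_def)
  qed (auto simp: e n_def)
  then have "length e \<le> r" using occurrences[OF x] by (simp add: e distinct_card[symmetric])
  then show "distinct e \<and> length e \<le> r \<and> set e \<subseteq> {..<n}" by (auto simp: e)
qed

lemma edges_HD: "(x, e) \<in> set (edges H) \<Longrightarrow> length e \<le> r \<and> set e \<subseteq> set (verts H)"
  using bspec[OF edges_H, of "(x, e)"] by (auto simp: verts_H)

lemma vertex_degree_H:
  assumes "v < n"
  shows "vertex_degree (edges H) v \<le> k"
proof -
  have c: "constrs \<Psi> ! v \<in> set (constrs \<Psi>)" using assms by (simp add: n_def)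
  have "vertex_degree (edges H) v = length (filter (\<lambda>x. x \<in> set (scope (constrs \<Psi> ! v))) (vars \<Psi>))"
    using assms by (simp add: vertex_degree_def H_def result_hypergraph_of filter_map o_def n_def)
  also have "\<dots> = card (set (filter (\<lambda>x. x \<in> set (scope (constrs \<Psi> ! v))) (vars \<Psi>)))"
    using csp by (intro distinct_card[symmetric]) (simp add: is_csp_def)
  also have "\<dots> \<le> card (set (scope (constrs \<Psi> ! v)))" by (intro card_mono) auto
  also have "\<dots> \<le> length (scope (constrs \<Psi> ! v))" by (rule card_length)
  also have "\<dots> \<le> k" using csp c by (simp add: is_csp_def)
  finally show ?thesis .
qed

lemma H':
  "pads r (edges H) (edges H')" "distinct (verts H')"
  "\<And>x e. (x, e) \<in> set (edges H') \<Longrightarrow> set e \<subseteq> set (verts H')"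
  "\<And>v. vertex_degree (edges H') v \<le> k" "length (verts H') \<le> n + r * m"
  using padded_t[OF verts_H edges_H vertex_degree_H k, folded H'_def] by (simp_all add: length_edges_H)

lemma length_edges_H': "length (edges H') = m"
  using pads_length[OF H'(1)] by (simp add: length_edges_H)

lemma cut_separator:
  assumes "good_cut r s (edges H') S"
  defines "R \<equiv> cut_labels (edges H') S"
  shows "result (balanced_t H R)" "set R \<subseteq> set (vars \<Psi>)" "length R \<le> m"
    "real (length R) \<le> (1 / 2 - eps r) * real m + 2 * real s"
proof -
  show "result (balanced_t H R)"
    unfolding R_def by (rule balanced_cut_labels[OF H'(1) distinct_labels_H]) (simp add: edges_HD)
  show "set R \<subseteq> set (vars \<Psi>)" "length R \<le> m" "real (length R) \<le> (1 / 2 - eps r) * real m + 2 * real s"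
    using cut_labels[OF H'(1) _ assms(1)] r by (simp_all add: R_def length_edges_H labels_set_H)
qed

lemma prob_bad_cut:
  assumes "16 * (m * (r * k)) \<le> s ^ 2" "0 < s"
  shows "measure_pmf.prob (random_subset (2 powr (- 1 / real r)) (verts H'))
    {S. \<not> good_cut r s (edges H') (set S)} \<le> 1 / 2"
  using assms pads_size[OF H'(1)] r H'(2-4) by (intro prob_good_cut) (auto simp: length_edges_H')

text \<open>The probabilistic method: a bad cut has probability at most 1/2, so a good one with
  tolerance \<open>s1\<close> exists. Its separator exceeds (1/2 - eps r) m by at most
  \<open>2 * s1\<close>, which the budget \<open>s\<close> of the search covers.\<close>

lemma separator_det_found:
  assumes s1: "16 * (m * (r * k)) \<le> s1 ^ 2" "0 < s1" and s: "2 * s1 \<le> s"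
  obtains R where "result (separator_det r s H) = Some R" "result (balanced_t H R)"
    "set R \<subseteq> set (vars \<Psi>)" "length R \<le> m"
    "real (length R) \<le> (1 / 2 - eps r) * real m + real s"
proof -
  let ?P = "random_subset (2 powr (- 1 / real r)) (verts H')"
  have nonneg: "0 \<le> (1 / 2 - eps r) * real m" using eps_bounds[OF r] by simp
  have "\<exists>S. good_cut r s1 (edges H') (set S)"
  proof (rule ccontr)
    assume "\<nexists>S. good_cut r s1 (edges H') (set S)"
    then have "{S. \<not> good_cut r s1 (edges H') (set S)} = UNIV" by auto
    then show False using prob_bad_cut[OF s1] by simp
  qed
  then obtain S where "good_cut r s1 (edges H') (set S)" by blast
  note R = cut_separator[OF this]
  define R where "R = cut_labels (edges H') (set S)"
  \<comment> \<open>The length of \<open>R\<close> and \<open>2 * s1\<close> are integers, so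
    rounding the limit down loses nothing.\<close>
  have "real_of_int (int (length R) - int (2 * s1)) \<le> (1 / 2 - eps r) * real m"
    using R(4) by (simp add: R_def)
  then have "int (length R) - int (2 * s1) \<le> \<lfloor>(1 / 2 - eps r) * real m\<rfloor>"
    by (simp only: le_floor_iff)
  then have len: "length R \<le> nat \<lfloor>(1 / 2 - eps r) * real (length (edges H))\<rfloor> + s"
    using s by (simp add: length_edges_H)
  have lab: "set R \<subseteq> fst ` set (edges H)" using R(2) by (simp add: R_def labels_set_H)
  show ?thesis
  proof (rule separator_det_complete[OF R(1)[folded R_def] lab len])
    fix T assume T: "result (separator_det r s H) = Some T" "result (balanced_t H T)"
      "set T \<subseteq> fst ` set (edges H)" "length T \<le> length (edges H)"
      "length T \<le> nat \<lfloor>(1 / 2 - eps r) * real (length (edges H))\<rfloor> + s"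
    have "real (nat \<lfloor>(1 / 2 - eps r) * real m\<rfloor>) \<le> (1 / 2 - eps r) * real m"
      using nonneg by simp
    moreover have "real (length T) \<le> real (nat \<lfloor>(1 / 2 - eps r) * real m\<rfloor> + s)"
      using T(5) unfolding of_nat_le_iff length_edges_H .
    ultimately have "real (length T) \<le> (1 / 2 - eps r) * real m + real s" by simp
    then show thesis using T by (intro that[of T]) (simp_all add: labels_set_H length_edges_H)
  qed
qed

lemma result_csp_sat_det:
  assumes "16 * (m * (r * k)) \<le> s1 ^ 2" "0 < s1" "2 * s1 \<le> s"
  shows "result (csp_sat_det r s \<Psi>) = Some (satisfiable \<Psi>)"
proof -
  obtain R where R: "result (separator_det r s H) = Some R" "set R \<subseteq> set (vars \<Psi>)"
    using assms by (rule separator_det_found)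
  have "result (solve_t \<Psi> R) \<longleftrightarrow> satisfiable \<Psi>"
    using wf R(2) d by (intro result_solve_t) (auto simp: alph)
  then show ?thesis using R(1) by (simp add: csp_sat_det_def H_def[symmetric])
qed

text \<open>The factor d^k bounds the truth tables, and r m bounds the constraints and padded
  vertices up to constants. Being a product, \<open>N\<close> is easily compared with a power of
  d.\<close>

definition N :: nat where "N = 16 * r * m * d ^ k"

lemma N_bounds:
  assumes "2 \<le> d"
  shows "16 \<le> N" "r \<le> N" "n + r * m \<le> N" "size_within N \<Psi>" "m \<le> N" "n \<le> N"
proof -
  have D: "k < d ^ k" "1 \<le> d ^ k" "d \<le> d ^ k"
    using assms k power_gt_expt[of d k] self_le_power[of d k] by auto
  have rm: "1 \<le> r * m" using r m_pos by simp
  \<comment> \<open>For integers a, b >= 1 one has a + b <= a b + 1; so the product also controls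
    sums of the two kinds of sizes.\<close>
  have NN: "16 * (r * m) + 16 * d ^ k \<le> N + 16"
  proof -
    obtain a b where "r * m = Suc a" "d ^ k = Suc b" using rm D(2) by (metis Suc_le_D One_nat_def)
    then show ?thesis unfolding N_def mult.assoc[of 16 r m] mult.assoc[of 16 "r * m"] by simp
  qed
  have m: "m \<le> r * m" "r \<le> r * m" using r m_pos by simp_all
  show "16 \<le> N" "r \<le> N" "n + r * m \<le> N" "m \<le> N" "n \<le> N"
    using NN D rm m n_le by linarith+
  have "m \<le> N" "n \<le> N" "d \<le> N"
    using NN D rm m n_le by linarith+
  then show "size_within N \<Psi>"
    unfolding size_within_def
  proof (intro conjI ballI)
    fix c assume c: "c \<in> set (constrs \<Psi>)"
    have sc: "length (scope c) \<le> k" "length (table c) = d ^ length (scope c)"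
      using csp c by (simp_all add: is_csp_def)
    then have "length (table c) \<le> d ^ k" using assms by (simp add: power_increasing)
    then show "length (table c) \<le> N" using NN rm by linarith
    show "length (scope c) + length (vars \<Psi>) \<le> N"
      using sc NN D rm m unfolding m_def[symmetric] by linarith
  qed (use assms wf in \<open>auto simp: alph m_def n_def\<close>)
qed

text \<open>Replacing the base 2 by d in the power for 16 r m is harmless for d >= 2 and makes the
  exponent independent of d. This permits a single error term for all alphabets.\<close>

lemma N_le_powr:
  assumes "2 \<le> d"
  shows "real N \<le> real d powr (log 2 (16 * real r * real m) + real k)"
proof -
  have pos: "1 \<le> 16 * real r * real m"
  proof -
    have "1 * 1 \<le> real r * real m" using r m_pos by (intro mult_mono) auto
    then show ?thesis by simp
  qed
  have "16 * real r * real m = 2 powr log 2 (16 * real r * real m)" using pos by simp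
  also have "\<dots> \<le> real d powr log 2 (16 * real r * real m)"
    using assms pos by (intro powr_mono2) (auto simp: zero_le_log_cancel_iff)
  finally have "16 * real r * real m * real d ^ k \<le> real d powr log 2 (16 * real r * real m) * real d ^ k"
    by (rule mult_right_mono) simp
  then show ?thesis using assms by (simp add: N_def powr_add powr_realpow)
qed

lemma N_power_le_powr:
  assumes "2 \<le> d"
  shows "real N ^ e \<le> real d powr (real e * (log 2 (16 * real r * real m) + real k))"
proof -
  have "real N ^ e \<le> (real d powr (log 2 (16 * real r * real m) + real k)) ^ e"
    by (intro power_mono N_le_powr assms) simp
  also have "\<dots> = real d powr (real e * (log 2 (16 * real r * real m) + real k))"
    using assms by (subst powr_power) (auto simp: mult.commute)
  finally show ?thesis .
qed

lemma steps_solve_le: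
  assumes d: "2 \<le> d" and R: "length R \<le> m" "result (balanced_t H R)"
    and len: "real (length R) \<le> (1 / 2 - eps r) * real m + t"
  shows "real (steps (solve_t \<Psi> R)) \<le> real N ^ 14 * real d powr ((1 - eps r) * real m + t)"
proof -
  interpret size_bound N using N_bounds[OF d] by unfold_locales
  have "steps (solve_t \<Psi> R) \<le> N ^ 14 * d ^ (m div 2 + length R)"
    using solve_t_le[of \<Psi> R] N_bounds[OF d] R by (simp add: alph m_def H_def)
  then have "real (steps (solve_t \<Psi> R)) \<le> real (N ^ 14 * d ^ (m div 2 + length R))"
    unfolding of_nat_le_iff .
  also have "\<dots> = real N ^ 14 * real d powr real (m div 2 + length R)"
    using d by (subst powr_realpow) auto
  also have "\<dots> \<le> real N ^ 14 * real d powr ((1 - eps r) * real m + t)"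
  proof (intro mult_left_mono powr_mono)
    have "real (m div 2) \<le> real m / 2" by linarith
    then show "real (m div 2 + length R) \<le> (1 - eps r) * real m + t"
      using len by (simp add: algebra_simps)
  qed (use d in auto)
  finally show ?thesis .
qed

text \<open>\<open>T\<close> has to dominate both enumerations, the search for a separator and the
  solving phase. The parameter q is left open because the two alphabet cases use different counts: q
  = 1 for d >= 3 and q = exp (- 4 eps r) for d = 2.\<close>

lemma steps_csp_sat_det_le:
  assumes s1: "16 * (m * (r * k)) \<le> s1 ^ 2" "0 < s1" "2 * s1 \<le> s" and d: "2 \<le> d"
    and q: "1 / 2 \<le> q" "q \<le> 1" and T: "1 \<le> T"
    and search: "\<And>b. real b \<le> (1 / 2 - eps r) * real m + real s \<Longrightarrow> (1 / q) ^ b * (1 + q) ^ m \<le> T"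
    and solve: "real d powr ((1 - eps r) * real m + real s) \<le> T"
  shows "real (steps (csp_sat_det r s \<Psi>)) \<le> real N ^ 15 * T"
proof -
  interpret size_bound N using N_bounds[OF d] by unfold_locales
  obtain R where R: "result (separator_det r s H) = Some R" "result (balanced_t H R)"
    "set R \<subseteq> set (vars \<Psi>)" "length R \<le> m" "real (length R) \<le> (1 / 2 - eps r) * real m + real s"
    using s1 by (rule separator_det_found)
  define b where "b = nat \<lfloor>(1 / 2 - eps r) * real m\<rfloor> + s"
  define xs where "xs = map fst (edges H)"
  have xs: "length xs = m" by (simp add: xs_def length_edges_H)
  have sizes: "length (verts H) \<le> N" "length (edges H) \<le> N"
    using N_bounds[OF d] by (auto simp: verts_H length_edges_H)
  have bal: "steps (balanced_t H S) \<le> N ^ 11" if "length S \<le> N" for S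
  proof (rule balanced_t_le[OF sizes _ that])
    show "length e \<le> N" if "(x, e) \<in> set (edges H)" for x e
      using edges_HD[OF that] N_bounds(2)[OF d] by simp
  qed simp
  have hyp: "steps (hypergraph_of \<Psi>) \<le> N ^ 14"
    using N_bounds(4)[OF d] by (intro hypergraph_of_le) (auto simp: size_within_def)
  have lab: "steps (map_t (\<lambda>(x, e). ret x) (edges H)) \<le> N ^ 14"
    using sizes by (intro map_t_le[where e = 0]) auto
  have len: "steps (length_t xs) \<le> N ^ 14"
    using N_bounds[OF d] xs by (intro length_t_le) auto
  have "real (steps (search_t (balanced_t H) xs b [])) + 1
      \<le> (real (N ^ 11) + 2) * ((1 / q) ^ b * (1 + q) ^ length xs)"
    using N_bounds(5)[OF d] xs by (intro steps_search_t_le q bal) auto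
  also have "(1 / q) ^ b * (1 + q) ^ length xs \<le> T"
    unfolding xs by (rule search) (use eps_bounds[OF r] in \<open>simp add: b_def\<close>)
  then have "(real (N ^ 11) + 2) * ((1 / q) ^ b * (1 + q) ^ length xs) \<le> (real (N ^ 11) + 2) * T"
    by (intro mult_left_mono) auto
  finally have srch: "real (steps (search_t (balanced_t H) xs b [])) + 1 \<le> (real (N ^ 11) + 2) * T" .
  have "real (N ^ 11) + 2 \<le> real (N ^ 14)"
  proof -
    have "2 \<le> N ^ 13" using N_ge self_le_power[of N 13] by linarith
    moreover have "N ^ 11 \<le> N ^ 13" using N_ge by (intro power_increasing) auto
    ultimately have "N ^ 11 + 2 \<le> N ^ 14" by (intro absorb[of _ 13]) auto
    then have "real (N ^ 11 + 2) \<le> real (N ^ 14)" unfolding of_nat_le_iff .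
    then show ?thesis by simp
  qed
  then have "(real (N ^ 11) + 2) * T \<le> real (N ^ 14) * T" using T by (intro mult_right_mono) auto
  with srch have srch': "real (steps (search_t (balanced_t H) xs b [])) \<le> real N ^ 14 * T" by simp
  have "real (steps (solve_t \<Psi> R)) \<le> real N ^ 14 * real d powr ((1 - eps r) * real m + real s)"
    using d R by (intro steps_solve_le) auto
  also have "\<dots> \<le> real N ^ 14 * T" using solve by (intro mult_left_mono) auto
  finally have solve': "real (steps (solve_t \<Psi> R)) \<le> real N ^ 14 * T" .
  have "steps (csp_sat_det r s \<Psi>) = Suc (steps (hypergraph_of \<Psi>) + (Suc (steps (map_t (\<lambda>(x, e). ret x) (edges H))
      + (steps (length_t xs) + steps (search_t (balanced_t H) xs b []))) + steps (solve_t \<Psi> R)))"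
    using R(1) by (simp add: csp_sat_det_def H_def[symmetric] separator_det_def b_def xs_def
        case_prod_unfold length_edges_H)
  then have "real (steps (csp_sat_det r s \<Psi>)) = 1 + (real (steps (hypergraph_of \<Psi>)) +
      (1 + (real (steps (map_t (\<lambda>(x, e). ret x) (edges H))) + (real (steps (length_t xs)) +
        real (steps (search_t (balanced_t H) xs b []))))) + real (steps (solve_t \<Psi> R)))"
    by simp
  moreover have NT: "real N ^ 14 * 1 \<le> real N ^ 14 * T" using T by (intro mult_left_mono) auto
  moreover have "1 * 1 \<le> real N ^ 14 * T" using N_ge T by (intro mult_mono one_le_power) auto
  moreover have "real (steps (hypergraph_of \<Psi>)) \<le> real N ^ 14"
    "real (steps (map_t (\<lambda>(x, e). ret x) (edges H))) \<le> real N ^ 14"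
    "real (steps (length_t xs)) \<le> real N ^ 14"
    using hyp lab len by (simp_all only: of_nat_le_iff flip: of_nat_power)
  ultimately have "real (steps (csp_sat_det r s \<Psi>)) \<le> 16 * (real N ^ 14 * T)"
    using srch' solve' by linarith
  also have "\<dots> \<le> real N * (real N ^ 14 * T)" using N_ge T by (intro mult_right_mono) auto
  also have "\<dots> = real N ^ 15 * T" by (simp add: power_numeral_reduce)
  finally show ?thesis .
qed

lemma bind_rand_lift:
  "bind_rand (lift_timed p) f = map_spmf (\<lambda>y. Timed (result y) (steps p + steps y)) (f (result p))"
  by (simp add: bind_rand_def lift_timed_def)

text \<open>The algorithm is deterministic work before and after a loop that terminates with
  probability 1. With the loop isolated as a distribution \<open>D\<close> on separators,
  correctness and expected time follow from properties that hold on its whole support.\<close>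

lemma csp_sat_rand_eq:
  assumes s: "16 * (m * (r * k)) \<le> s ^ 2" "0 < s"
    and c: "\<And>S. set S \<subseteq> set (verts H') \<Longrightarrow> length S \<le> length (verts H') \<Longrightarrow>
      Suc (2 * length (verts H')) + steps (cut_t r s (edges H') S) \<le> c"
  obtains D where "csp_sat_rand r s \<Psi> = spmf_of_pmf (map_pmf (\<lambda>y. Timed (result (solve_t \<Psi> (result y)))
      (Suc (steps (hypergraph_of \<Psi>)) + (steps (padded_t r H) + steps y + steps (solve_t \<Psi> (result y))))) D)"
    "\<And>y. y \<in> set_pmf D \<Longrightarrow> result (balanced_t H (result y)) \<and> set (result y) \<subseteq> set (vars \<Psi>) \<and>
       length (result y) \<le> m \<and> real (length (result y)) \<le> (1 / 2 - eps r) * real m + 2 * real s"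
    "(\<integral>\<^sup>+ y. of_nat (steps y) \<partial>measure_pmf D) \<le> ennreal (2 * (real c + 1))"
proof -
  define V where "V = verts H'"
  define P where "P = random_subset (2 powr (- 1 / real r)) V"
  define E where "E = edges H'"
  define D0 where "D0 = map_pmf (\<lambda>S. Timed (result (cut_t r s E S)) (Suc (2 * length V) + steps (cut_t r s E S))) P"
  have trial: "bind_rand (sample (2 powr (- 1 / real r)) V) (\<lambda>S. lift_timed (cut_t r s E S)) = spmf_of_pmf D0"
    unfolding sample_eq bind_rand_lift_timed by (simp add: D0_def P_def map_pmf_comp)
  have "measure_pmf.prob D0 {x. result x = None} = measure_pmf.prob P {S. \<not> good_cut r s E (set S)}"
    by (simp add: D0_def result_cut_t vimage_def)
  also have "\<dots> \<le> 1 / 2" unfolding P_def V_def E_def by (rule prob_bad_cut[OF s])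
  finally have none: "measure_pmf.prob D0 {x. result x = None} \<le> 1 / 2" .
  define Q where "Q R \<longleftrightarrow> result (balanced_t H R) \<and> set R \<subseteq> set (vars \<Psi>) \<and>
       length R \<le> m \<and> real (length R) \<le> (1 / 2 - eps r) * real m + 2 * real s" for R
  have cost: "steps x \<le> c" if "x \<in> set_pmf D0" for x
    using that c set_random_subset unfolding D0_def P_def V_def E_def by fastforce
  have good: "Q R" if x: "x \<in> set_pmf D0" "result x = Some R" for x R
  proof -
    obtain S where S: "good_cut r s (edges H') (set S)" "R = cut_labels (edges H') (set S)"
      using x unfolding D0_def E_def by (auto simp: result_cut_t split: if_splits)
    show ?thesis unfolding Q_def S(2) using cut_separator[OF S(1)] by (intro conjI)
  qed
  obtain D where D: "repeat_rand (spmf_of_pmf D0) = spmf_of_pmf D"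
    "\<And>y. y \<in> set_pmf D \<Longrightarrow> Q (result y)"
    "(\<integral>\<^sup>+ y. of_nat (steps y) \<partial>measure_pmf D) \<le> ennreal (2 * (real c + 1))"
    by (rule repeat_rand[where Q = Q, OF none cost good]) (assumption | rule that)+
  have "csp_sat_rand r s \<Psi> = spmf_of_pmf (map_pmf (\<lambda>y. Timed (result (solve_t \<Psi> (result y)))
      (Suc (steps (hypergraph_of \<Psi>)) + (steps (padded_t r H) + steps y + steps (solve_t \<Psi> (result y))))) D)"
    unfolding csp_sat_rand_def separator_rand_def bind_rand_lift result_simps
      H_def[symmetric] H'_def[symmetric] V_def[symmetric] E_def[symmetric] trial D(1)
    by (simp add: bind_rand_lift_timed map_pmf_comp)
  then show ?thesis using D(2,3) unfolding Q_def by (rule that)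
qed

lemma result_csp_sat_rand:
  assumes "16 * (m * (r * k)) \<le> s ^ 2" "0 < s"
  shows "map_spmf result (csp_sat_rand r s \<Psi>) = return_spmf (satisfiable \<Psi>)"
proof -
  let ?c = "\<lambda>S. Suc (2 * length (verts H')) + steps (cut_t r s (edges H') S)"
  \<comment> \<open>Correctness includes d = 1, which \<open>N_bounds\<close> does not cover. Any
    finite bound on the cost of a trial serves here, and only finitely many lists can be
    sampled.\<close>
  define A where "A = {S. set S \<subseteq> set (verts H') \<and> length S \<le> length (verts H')}"
  have "finite A" unfolding A_def by (rule finite_lists_length_le) simp
  then have c: "?c S \<le> Max (?c ` A)" if "set S \<subseteq> set (verts H')" "length S \<le> length (verts H')" for S
    using that by (intro Max_ge) (auto simp: A_def)
  obtain D where
    D: "csp_sat_rand r s \<Psi> = spmf_of_pmf (map_pmf (\<lambda>y. Timed (result (solve_t \<Psi> (result y)))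
      (Suc (steps (hypergraph_of \<Psi>)) + (steps (padded_t r H) + steps y + steps (solve_t \<Psi> (result y))))) D)"
    "\<And>y. y \<in> set_pmf D \<Longrightarrow> result (balanced_t H (result y)) \<and> set (result y) \<subseteq> set (vars \<Psi>) \<and>
       length (result y) \<le> m \<and> real (length (result y)) \<le> (1 / 2 - eps r) * real m + 2 * real s"
    by (rule csp_sat_rand_eq[OF assms c]) (assumption | rule that)+
  have "map_pmf (\<lambda>y. result (solve_t \<Psi> (result y))) D = map_pmf (\<lambda>y. satisfiable \<Psi>) D"
    using wf d D(2) by (intro map_pmf_cong refl result_solve_t) (auto simp: alph)
  then show ?thesis by (simp add: D(1) map_pmf_comp)
qed

lemma expected_steps_csp_sat_rand_le:
  assumes s: "16 * (m * (r * k)) \<le> s ^ 2" "0 < s" and d: "2 \<le> d"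
  shows "expected_steps (csp_sat_rand r s \<Psi>)
    \<le> ennreal (real N ^ 15 * real d powr ((1 - eps r) * real m + 2 * real s))"
proof -
  interpret size_bound N using N_bounds[OF d] by unfold_locales
  define T where "T = real d powr ((1 - eps r) * real m + 2 * real s)"
  have T: "1 \<le> T"
    unfolding T_def using d eps_bounds[OF r] by (intro ge_one_powr_ge_zero) auto
  have V: "length (verts H') \<le> N" using H'(5) N_bounds(3)[OF d] by linarith
  have E: "length (edges H') \<le> N" using N_bounds(5)[OF d] by (simp add: length_edges_H')
  have e: "f \<noteq> [] \<and> length f \<le> N" if "(x, f) \<in> set (edges H')" for x f
    using pads_size[OF H'(1) that] r N_bounds(2)[OF d] by auto
  have c: "Suc (2 * length (verts H')) + steps (cut_t r s (edges H') S) \<le> N ^ 10"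
    if "set S \<subseteq> set (verts H')" "length S \<le> length (verts H')" for S
  proof (rule absorb[of _ 9])
    have "steps (cut_t r s (edges H') S) \<le> N ^ 9"
      by (rule cut_t_le[OF E e]) (use that V in auto)
    moreover have "N \<le> N ^ 9" using N_ge by (intro self_le_power) auto
    ultimately show "Suc (2 * length (verts H')) + steps (cut_t r s (edges H') S) \<le> 15 * N ^ 9 + 1"
      using V by linarith
  qed simp
  obtain D where
    D: "csp_sat_rand r s \<Psi> = spmf_of_pmf (map_pmf (\<lambda>y. Timed (result (solve_t \<Psi> (result y)))
      (Suc (steps (hypergraph_of \<Psi>)) + (steps (padded_t r H) + steps y + steps (solve_t \<Psi> (result y))))) D)"
    "\<And>y. y \<in> set_pmf D \<Longrightarrow> result (balanced_t H (result y)) \<and> set (result y) \<subseteq> set (vars \<Psi>) \<and>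
       length (result y) \<le> m \<and> real (length (result y)) \<le> (1 / 2 - eps r) * real m + 2 * real s"
    "(\<integral>\<^sup>+ y. of_nat (steps y) \<partial>measure_pmf D) \<le> ennreal (2 * (real (N ^ 10) + 1))"
    by (rule csp_sat_rand_eq[OF s c]) (assumption | rule that)+
  define A where "A = Suc (steps (hypergraph_of \<Psi>)) + steps (padded_t r H)"
  have hyp: "steps (hypergraph_of \<Psi>) \<le> N ^ 14"
    using N_bounds(4)[OF d] by (intro hypergraph_of_le) (auto simp: size_within_def)
  have pad: "steps (padded_t r H) \<le> N ^ 14"
    using N_bounds[OF d] edges_H by (intro padded_t_le) (auto simp: verts_H length_edges_H)
  have "expected_steps (csp_sat_rand r s \<Psi>) = (\<integral>\<^sup>+ y. of_nat (Suc (steps (hypergraph_of \<Psi>)) +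
      (steps (padded_t r H) + steps y + steps (solve_t \<Psi> (result y)))) \<partial>measure_pmf D)"
    by (simp add: expected_steps_def D(1))
  \<comment> \<open>Every separator in the support is balanced and small, so the solving phase has a
    uniform bound and only the steps of the loop remain under the integral.\<close>
  also have "\<dots> \<le> (\<integral>\<^sup>+ y. ennreal (real A + real N ^ 14 * T) + of_nat (steps y) \<partial>measure_pmf D)"
  proof (rule nn_integral_mono_AE, unfold AE_measure_pmf_iff, rule ballI)
    fix y assume "y \<in> set_pmf D"
    then have "real (steps (solve_t \<Psi> (result y))) \<le> real N ^ 14 * T"
      using D(2) d unfolding T_def by (intro steps_solve_le) auto
    then have "real (Suc (steps (hypergraph_of \<Psi>)) + (steps (padded_t r H) + steps y + steps (solve_t \<Psi> (result y))))
        \<le> (real A + real N ^ 14 * T) + real (steps y)"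
      by (simp add: A_def)
    then have "ennreal (real (Suc (steps (hypergraph_of \<Psi>)) + (steps (padded_t r H) + steps y + steps (solve_t \<Psi> (result y)))))
        \<le> ennreal ((real A + real N ^ 14 * T) + real (steps y))"
      by (rule ennreal_leI)
    also have "\<dots> = ennreal (real A + real N ^ 14 * T) + ennreal (real (steps y))"
      using T by (intro ennreal_plus) auto
    finally show "of_nat (Suc (steps (hypergraph_of \<Psi>)) + (steps (padded_t r H) + steps y + steps (solve_t \<Psi> (result y))))
        \<le> ennreal (real A + real N ^ 14 * T) + of_nat (steps y)"
      unfolding ennreal_of_nat_eq_real_of_nat .
  qed
  also have "\<dots> = ennreal (real A + real N ^ 14 * T) + (\<integral>\<^sup>+ y. of_nat (steps y) \<partial>measure_pmf D)"
    by (subst nn_integral_add) (auto simp: measure_pmf.emeasure_space_1)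
  also have "\<dots> \<le> ennreal (real A + real N ^ 14 * T) + ennreal (2 * (real (N ^ 10) + 1))"
    using D(3) by (rule add_left_mono)
  also have "\<dots> = ennreal (real A + real N ^ 14 * T + 2 * (real (N ^ 10) + 1))"
    using T by (subst ennreal_plus) auto
  also have "\<dots> \<le> ennreal (real N ^ 15 * T)"
  proof (rule ennreal_leI)
    have NT: "real N ^ 14 * 1 \<le> real N ^ 14 * T" using T by (intro mult_left_mono) auto
    have "N ^ 10 \<le> N ^ 14" using N_ge by (intro power_increasing) auto
    then have "real (steps (hypergraph_of \<Psi>)) \<le> real N ^ 14" "real (steps (padded_t r H)) \<le> real N ^ 14"
      "real (N ^ 10) \<le> real N ^ 14"
      using hyp pad by (simp_all only: of_nat_le_iff flip: of_nat_power)
    moreover have "1 * 1 \<le> real N ^ 14 * T" using N_ge T by (intro mult_mono one_le_power) auto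
    moreover have "real A = 1 + real (steps (hypergraph_of \<Psi>)) + real (steps (padded_t r H))"
      by (simp add: A_def)
    moreover have "a + x + 2 * (b + 1) \<le> 16 * x"
      if "h \<le> M" "p \<le> M" "b \<le> M" "1 * 1 \<le> x" "a = 1 + h + p" "M * 1 \<le> x" for a b h p x M :: real
      using that unfolding that(5) by argo
    ultimately have "real A + real N ^ 14 * T + 2 * (real (N ^ 10) + 1) \<le> 16 * (real N ^ 14 * T)"
      using NT by blast
    also have "\<dots> \<le> real N * (real N ^ 14 * T)" using N_ge T by (intro mult_right_mono) auto
    also have "\<dots> = real N ^ 15 * T" by (simp add: power_numeral_reduce)
    finally show "real A + real N ^ 14 * T + 2 * (real (N ^ 10) + 1) \<le> real N ^ 15 * T" .
  qed
  finally show ?thesis by (simp add: T_def)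
qed

text \<open>Even a search through all 2^m sets is affordable, since 2 <= 3 powr (2/3) <= d powr (1 -
  eps r). So the limit on the size of the sets may be ignored in counting them, which is q =
  1.\<close>

lemma steps_csp_sat_det_ge3:
  assumes "16 * (m * (r * k)) \<le> s1 ^ 2" "0 < s1" "2 * s1 \<le> s" and d3: "3 \<le> d"
  shows "real (steps (csp_sat_det r s \<Psi>)) \<le> real N ^ 15 * real d powr ((1 - eps r) * real m + real s)"
proof (rule steps_csp_sat_det_le[OF assms(1-3), where q = 1])
  note eps = eps_bounds[OF r]
  show "1 \<le> real d powr ((1 - eps r) * real m + real s)"
    using d3 eps by (intro ge_one_powr_ge_zero) auto
  \<comment> \<open>After cubing, this is 8 <= 9.\<close>
  have "2 \<le> (3 :: real) powr (2 / 3)"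
  proof (rule power_le_imp_le_base)
    have "((3 :: real) powr (2 / 3)) ^ 3 = 3 powr 2" by (subst powr_power) auto
    then show "(2 :: real) ^ Suc 2 \<le> (3 powr (2 / 3)) ^ Suc 2" by (simp add: eval_nat_numeral)
  qed simp
  also have "\<dots> \<le> real d powr (2 / 3)" using d3 by (intro powr_mono2) auto
  also have "\<dots> \<le> real d powr (1 - eps r)" using d3 eps by (intro powr_mono) auto
  finally have "2 ^ m \<le> (real d powr (1 - eps r)) ^ m" by (rule power_mono) simp
  also have "\<dots> = real d powr ((1 - eps r) * real m)" using d3 m_pos by (subst powr_power) (auto simp: mult.commute)
  also have "\<dots> \<le> real d powr ((1 - eps r) * real m + real s)" using d3 by (intro powr_mono) auto
  finally show "(1 / 1) ^ b * (1 + 1) ^ m \<le> real d powr ((1 - eps r) * real m + real s)" for b :: nat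
    by simp
qed (use d3 in auto)

text \<open>Here the search dominates: 2 (eps r)^2 <= eps r, so its bound also covers the solving
  phase. The choice of q is the one optimised in \<open>binomial_tail_factor\<close>.\<close>

lemma steps_csp_sat_det_2:
  assumes "16 * (m * (r * k)) \<le> s1 ^ 2" "0 < s1" "2 * s1 \<le> s" and d2: "d = 2"
  shows "real (steps (csp_sat_det r s \<Psi>)) \<le> real N ^ 15 * 2 powr ((1 - 2 * (eps r)\<^sup>2) * real m + real s)"
proof (rule steps_csp_sat_det_le[OF assms(1-3), where q = "exp (- 4 * eps r)"])
  note eps = eps_bounds[OF r]
  have sq: "2 * (eps r)\<^sup>2 \<le> eps r"
  proof -
    have "eps r * (2 * eps r) \<le> eps r * 1" using eps by (intro mult_left_mono) auto
    then show ?thesis by (simp add: power2_eq_square)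
  qed
  have "exp (4 * eps r) \<le> 2" using exp_bound_half[of "4 * eps r"] eps by simp
  then show "1 / 2 \<le> exp (- 4 * eps r)" by (simp add: exp_minus field_simps)
  show "exp (- 4 * eps r) \<le> 1" using eps by simp
  have "2 * (eps r)\<^sup>2 \<le> 1" using sq eps by linarith
  then show "1 \<le> 2 powr ((1 - 2 * (eps r)\<^sup>2) * real m + real s)" by (intro ge_one_powr_ge_zero) auto
  show "real d powr ((1 - eps r) * real m + real s) \<le> 2 powr ((1 - 2 * (eps r)\<^sup>2) * real m + real s)"
    unfolding d2 of_nat_numeral using sq by (intro powr_mono add_right_mono mult_right_mono) auto
  show "(1 / exp (- 4 * eps r)) ^ b * (1 + exp (- 4 * eps r)) ^ m
      \<le> 2 powr ((1 - 2 * (eps r)\<^sup>2) * real m + real s)"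
    if "real b \<le> (1 / 2 - eps r) * real m + real s" for b
    using eps that by (rule binomial_tail_factor)
qed (use d2 in auto)

end


section \<open>Choice of the sublinear terms\<close>

definition slack :: "nat \<Rightarrow> nat \<Rightarrow> nat \<Rightarrow> nat" where
  "slack r k m = nat \<lceil>sqrt (16 * real m * (real r * real k))\<rceil> + 1"

text \<open>These are the two conditions on the tolerance in \<open>prob_good_cut\<close>. Rounding
  the square root up gives the first, and the summand 1 gives the second for every m.\<close>

lemma slack: "16 * (m * (r * k)) \<le> slack r k m ^ 2" "0 < slack r k m"
proof -
  have "real (16 * (m * (r * k))) = (sqrt (16 * real m * (real r * real k)))\<^sup>2" by simp
  also have "\<dots> \<le> (real (slack r k m))\<^sup>2"
    by (intro power_mono) (auto simp: slack_def intro: order_trans[OF real_nat_ceiling_ge])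
  finally have "real (16 * (m * (r * k))) \<le> real (slack r k m ^ 2)" by simp
  then show "16 * (m * (r * k)) \<le> slack r k m ^ 2" unfolding of_nat_le_iff .
qed (simp add: slack_def)

lemma sublinear_of_sqrt:
  fixes k :: "nat \<Rightarrow> nat"
  assumes "(\<lambda>m. real (k m)) \<in> o(\<lambda>m. sqrt (real m))"
  shows "(\<lambda>m. real (k m)) \<in> o(\<lambda>m. real m)"
proof -
  have "(\<lambda>m. sqrt (real m)) \<in> O(\<lambda>m. real m)" by real_asymp
  then show ?thesis by (rule landau_o.small_big_trans[OF assms])
qed

text \<open>If k is o(m), then m r k is o(m^2), and its square root is o(m).\<close>

lemma slack_sublinear:
  fixes k :: "nat \<Rightarrow> nat"
  assumes "(\<lambda>m. real (k m)) \<in> o(\<lambda>m. real m)"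
  shows "(\<lambda>m. real (2 * slack r (k m) m)) \<in> o(\<lambda>m. real m)"
proof -
  have sq: "(\<lambda>m. sqrt (16 * real m * (real r * real (k m)))) \<in> o(\<lambda>m. real m)"
  proof (rule landau_o.smallI)
    fix c :: real assume c: "c > 0"
    \<comment> \<open>The constant is chosen such that 16 r k <= c^2 m; using r + 1 keeps the
      denominator positive.\<close>
    have "\<forall>\<^sub>F m in sequentially. norm (real (k m)) \<le> c\<^sup>2 / (16 * (real r + 1)) * norm (real m)"
      using c by (intro landau_o.smallD[OF assms]) (auto intro!: divide_pos_pos)
    then show "\<forall>\<^sub>F m in sequentially. norm (sqrt (16 * real m * (real r * real (k m)))) \<le> c * norm (real m)"
    proof (rule eventually_mono)
      fix m assume "norm (real (k m)) \<le> c\<^sup>2 / (16 * (real r + 1)) * norm (real m)"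
      then have "16 * (real r + 1) * real (k m) \<le> c\<^sup>2 * real m" by (simp add: field_simps)
      moreover have "16 * (real r * real (k m)) \<le> 16 * (real r + 1) * real (k m)"
        by (simp add: algebra_simps)
      ultimately have "16 * (real r * real (k m)) \<le> c\<^sup>2 * real m" by linarith
      then have "real m * (16 * (real r * real (k m))) \<le> real m * (c\<^sup>2 * real m)"
        by (rule mult_left_mono) simp
      then have "16 * real m * (real r * real (k m)) \<le> (c * real m)\<^sup>2"
        by (simp add: power2_eq_square mult_ac)
      then have "sqrt (16 * real m * (real r * real (k m))) \<le> c * real m"
        using c by (intro real_le_lsqrt) auto
      then show "norm (sqrt (16 * real m * (real r * real (k m)))) \<le> c * norm (real m)" by simp
    qed
  qed
  have "(\<lambda>m. 4 :: real) \<in> o(\<lambda>m. real m)" by real_asymp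
  moreover have "(\<lambda>m. 2 * sqrt (16 * real m * (real r * real (k m)))) \<in> o(\<lambda>m. real m)"
    using sq by simp
  ultimately have "(\<lambda>m. 2 * sqrt (16 * real m * (real r * real (k m))) + 4) \<in> o(\<lambda>m. real m)"
    by (intro sum_in_smallo)
  \<comment> \<open>Rounding up and the summand 1 cost at most 2, and doubling makes this 4.\<close>
  moreover have "(\<lambda>m. real (2 * slack r (k m) m)) \<in> O(\<lambda>m. 2 * sqrt (16 * real m * (real r * real (k m))) + 4)"
  proof (rule bigoI[of _ 1], rule always_eventually, rule allI)
    fix m
    have "0 \<le> sqrt (16 * real m * (real r * real (k m)))" by simp
    moreover from this have "real (slack r (k m) m) \<le> sqrt (16 * real m * (real r * real (k m))) + 2"
      unfolding slack_def using of_int_ceiling_le_add_one[of "sqrt (16 * real m * (real r * real (k m)))"]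
      by (simp add: of_nat_nat add.commute)
    ultimately show "norm (real (2 * slack r (k m) m))
        \<le> 1 * norm (2 * sqrt (16 * real m * (real r * real (k m))) + 4)"
      by simp
  qed
  ultimately show ?thesis by (rule landau_o.big_small_trans[rotated])
qed

theorem theorem4p2:
  fixes r :: nat and k :: "nat \<Rightarrow> nat"
  assumes "r \<ge> 2"
    and "\<And>m. k m \<ge> 1"
    and "(\<lambda>m. real (k m)) \<in> o(\<lambda>m. sqrt (real m))"
  shows "\<exists>s\<^sub>0 :: nat \<Rightarrow> nat. (\<lambda>m. real (s\<^sub>0 m)) \<in> o(\<lambda>m. real m) \<and>
    (\<forall>s :: nat \<Rightarrow> nat. (\<lambda>m. real (s m)) \<in> o(\<lambda>m. real m) \<and> (\<forall>m. s\<^sub>0 m \<le> s m) \<longrightarrow>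
      (\<exists>g :: nat \<Rightarrow> real. g \<in> o(\<lambda>m. real m) \<and>
        (\<forall>(m :: nat) (d :: nat) (\<Psi> :: csp).
          m \<ge> 1 \<and> d \<ge> 1 \<and> is_csp d (k m) \<Psi> \<and> num_vars \<Psi> = m \<and> var_frequency \<Psi> \<le> r \<longrightarrow>
            result (csp_sat_det r (s m) \<Psi>) = Some (satisfiable \<Psi>) \<and>
            map_spmf result (csp_sat_rand r (s m) \<Psi>) = return_spmf (satisfiable \<Psi>) \<and>
            (d \<ge> 3 \<longrightarrow>
              real (steps (csp_sat_det r (s m) \<Psi>)) \<le> real d powr ((1 - eps r) * real m + g m)) \<and>
            (d = 2 \<longrightarrow>
              expected_steps (csp_sat_rand r (s m) \<Psi>)
                \<le> ennreal (2 powr ((1 - eps r) * real m + g m)) \<and>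
              real (steps (csp_sat_det r (s m) \<Psi>))
                \<le> 2 powr ((1 - 2 * (eps r)\<^sup>2) * real m + g m)))))"
proof (intro exI[of _ "\<lambda>m. 2 * slack r (k m) m"] conjI allI impI)
  have k: "(\<lambda>m. real (k m)) \<in> o(\<lambda>m. real m)" using assms(3) by (rule sublinear_of_sqrt)
  then show "(\<lambda>m. real (2 * slack r (k m) m)) \<in> o(\<lambda>m. real m)" by (rule slack_sublinear)
  fix s :: "nat \<Rightarrow> nat"
  assume s: "(\<lambda>m. real (s m)) \<in> o(\<lambda>m. real m) \<and> (\<forall>m. 2 * slack r (k m) m \<le> s m)"
  define h where "h m = log 2 (16 * real r * real m) + real (k m)" for m
  \<comment> \<open>The first summand covers the excess of the separator over (1/2 - eps r) m, which
    can reach 2 s in the randomised version; the second comes from the factor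
    \<open>N ^ 15\<close>.\<close>
  define g where "g m = 2 * real (s m) + 15 * h m" for m
  have "(\<lambda>m. log 2 (16 * real r * real m)) \<in> o(\<lambda>m. real m)"
    using assms(1) by real_asymp
  then have "h \<in> o(\<lambda>m. real m)"
    unfolding h_def using k by (rule sum_in_smallo)
  then have g: "g \<in> o(\<lambda>m. real m)"
    unfolding g_def using s by (intro sum_in_smallo) simp_all
  have main: "result (csp_sat_det r (s m) \<Psi>) = Some (satisfiable \<Psi>) \<and>
      map_spmf result (csp_sat_rand r (s m) \<Psi>) = return_spmf (satisfiable \<Psi>) \<and>
      (d \<ge> 3 \<longrightarrow> real (steps (csp_sat_det r (s m) \<Psi>)) \<le> real d powr ((1 - eps r) * real m + g m)) \<and>
      (d = 2 \<longrightarrow>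
        expected_steps (csp_sat_rand r (s m) \<Psi>) \<le> ennreal (2 powr ((1 - eps r) * real m + g m)) \<and>
        real (steps (csp_sat_det r (s m) \<Psi>)) \<le> 2 powr ((1 - 2 * (eps r)\<^sup>2) * real m + g m))"
    if \<Psi>: "m \<ge> 1 \<and> d \<ge> 1 \<and> is_csp d (k m) \<Psi> \<and> num_vars \<Psi> = m \<and> var_frequency \<Psi> \<le> r"
    for m d :: nat and \<Psi> :: csp
  proof -
    interpret bounded_csp r "k m" d \<Psi>
      using \<Psi> assms by unfold_locales auto
    define M where "M = bounded_csp.m \<Psi>"
    have M: "M = m" using num_vars \<Psi> by (simp add: M_def)
    note slack1 = slack[where m = M and r = r and k = "k m"]
    have s_ge: "2 * slack r (k m) M \<le> s m" using s by (simp add: M)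
    \<comment> \<open>The randomised version uses \<open>s m\<close> itself as the tolerance of its
      cuts. The deterministic one takes \<open>slack\<close> as the tolerance of the cut that it
      needs to exist and \<open>s m\<close> as the budget of its search.\<close>
    then have "slack r (k m) M ^ 2 \<le> s m ^ 2" by (intro power_mono) auto
    with slack1(1) have "16 * (M * (r * k m)) \<le> s m ^ 2" by (rule order_trans)
    moreover have "0 < s m" using slack1(2) s_ge by simp
    ultimately have slack2: "16 * (M * (r * k m)) \<le> s m ^ 2" "0 < s m" by blast+
    have absorb: "real N ^ 15 * real d powr (x * real M + t) \<le> real d powr (x * real M + g M)"
      if "2 \<le> d" "t \<le> 2 * real (s m)" for x t
    proof -
      have "real N ^ 15 * real d powr (x * real M + t) \<le> real d powr (15 * h m) * real d powr (x * real M + t)"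
        using N_power_le_powr[OF that(1), of 15] M by (intro mult_right_mono) (auto simp: h_def M_def)
      also have "\<dots> = real d powr (x * real M + (t + 15 * h m))" by (simp add: powr_add[symmetric] add_ac)
      also have "\<dots> \<le> real d powr (x * real M + g M)"
        using that by (intro powr_mono) (auto simp: g_def M)
      finally show ?thesis .
    qed
    have "real (steps (csp_sat_det r (s m) \<Psi>)) \<le> real d powr ((1 - eps r) * real M + g M)" if "3 \<le> d"
    proof -
      have "real (steps (csp_sat_det r (s m) \<Psi>)) \<le> real N ^ 15 * real d powr ((1 - eps r) * real M + real (s m))"
        unfolding M_def by (rule steps_csp_sat_det_ge3[OF slack1[unfolded M_def] s_ge[unfolded M_def] that])
      also have "\<dots> \<le> real d powr ((1 - eps r) * real M + g M)" using that by (intro absorb) auto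
      finally show ?thesis .
    qed
    moreover have "real (steps (csp_sat_det r (s m) \<Psi>)) \<le> 2 powr ((1 - 2 * (eps r)\<^sup>2) * real M + g M)"
      if "d = 2"
    proof -
      have "real (steps (csp_sat_det r (s m) \<Psi>)) \<le> real N ^ 15 * 2 powr ((1 - 2 * (eps r)\<^sup>2) * real M + real (s m))"
        unfolding M_def by (rule steps_csp_sat_det_2[OF slack1[unfolded M_def] s_ge[unfolded M_def] that])
      also have "\<dots> \<le> 2 powr ((1 - 2 * (eps r)\<^sup>2) * real M + g M)"
        using absorb[of "real (s m)" "1 - 2 * (eps r)\<^sup>2"] that by simp
      finally show ?thesis .
    qed
    moreover have "expected_steps (csp_sat_rand r (s m) \<Psi>) \<le> ennreal (2 powr ((1 - eps r) * real M + g M))"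
      if "d = 2"
    proof -
      have "expected_steps (csp_sat_rand r (s m) \<Psi>)
          \<le> ennreal (real N ^ 15 * real d powr ((1 - eps r) * real M + 2 * real (s m)))"
        using that unfolding M_def by (intro expected_steps_csp_sat_rand_le slack2[unfolded M_def]) auto
      also have "\<dots> \<le> ennreal (2 powr ((1 - eps r) * real M + g M))"
        using absorb[of "2 * real (s m)" "1 - eps r"] that by (intro ennreal_leI) simp
      finally show ?thesis .
    qed
    moreover have "result (csp_sat_det r (s m) \<Psi>) = Some (satisfiable \<Psi>)"
      by (rule result_csp_sat_det[OF slack1[unfolded M_def] s_ge[unfolded M_def]])
    moreover have "map_spmf result (csp_sat_rand r (s m) \<Psi>) = return_spmf (satisfiable \<Psi>)"
      by (rule result_csp_sat_rand[OF slack2[unfolded M_def]])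
    ultimately show ?thesis unfolding M by blast
  qed
  show "\<exists>g :: nat \<Rightarrow> real. g \<in> o(\<lambda>m. real m) \<and>
        (\<forall>(m :: nat) (d :: nat) (\<Psi> :: csp).
          m \<ge> 1 \<and> d \<ge> 1 \<and> is_csp d (k m) \<Psi> \<and> num_vars \<Psi> = m \<and> var_frequency \<Psi> \<le> r \<longrightarrow>
            result (csp_sat_det r (s m) \<Psi>) = Some (satisfiable \<Psi>) \<and>
            map_spmf result (csp_sat_rand r (s m) \<Psi>) = return_spmf (satisfiable \<Psi>) \<and>
            (d \<ge> 3 \<longrightarrow>
              real (steps (csp_sat_det r (s m) \<Psi>)) \<le> real d powr ((1 - eps r) * real m + g m)) \<and>
            (d = 2 \<longrightarrow>
              expected_steps (csp_sat_rand r (s m) \<Psi>)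
                \<le> ennreal (2 powr ((1 - eps r) * real m + g m)) \<and>
              real (steps (csp_sat_det r (s m) \<Psi>))
                \<le> 2 powr ((1 - 2 * (eps r)\<^sup>2) * real m + g m)))"
  proof (rule exI[of _ g], rule conjI[OF g], intro allI impI)
  qed (rule main)
qed

end
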